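(* Let $K=\mathbb{F}_{2^\tau}((\pi))$ with ring of integers $\mathcal{O}=\mathbb{F}_{2^\tau}[[\pi]]$ and normalized valuation $\nu$. Let $m_i(X)=X^2+a_iX+b_i\in\mathcal{O}[X]$, for $i\in\{1,2\}$, and let $q_1,q_2\in\mathbb{M}_2(K)\setminus K$ be (non-scalar) matrices satisfying $m_1(q_1)=0$, $m_2(q_2)=0$ and $q_1\overline{q_2}+q_2\overline{q_1}=\lambda$ with $\lambda\in K$. Put $$\Delta=\lambda^2+a_1a_2\lambda+a_1^2b_2+a_2^2b_1 .$$ Define the fake distance $d_f$ by $$d_f=-\tfrac12\,\nu\!\left(\frac{\Delta}{e_1^2e_2^2}\right)+c_1+c_2,$$ where, for each $i\in\{1,2\}$, $e_i=a_i$ if $m_i$ is separable and $e_i=1$ if $m_i$ is inseparable, and $$c_i=\begin{cases}0 & \text{if } m_i\in A^s\cup A^i,\\ -t_i & \text{if } m_i\in B^s,\\ t_i & \text{if } m_i\in B^i,\end{cases}$$ with $t_i=-\left\lfloor\frac{\nu(\mathbb{D}(b_i/a_i^2))-1}{2}\right\rfloor$ if $m_i\in B^s$ and $t_i=\left\lfloor\frac{\nu(\delta(b_i))-1}{2}\right\rfloor$ if $m_i\in B^i$. (So $d_f=-\infty$ exactly when $\Delta=0$.) If $d_f>0$, then $d_f$ equals the distance in the Bruhat-Tits tree $\mathfrak{t}(K)$ between the stems $\mathfrak{m}_K(q_1)$ and $\mathfrak{m}_K(q_2)$. If $d_f\le 0$, then the stems intersect and the length of the intersection $\mathfrak{m}_K(q_1)\cap\mathfrak{m}_K(q_2)$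 is $$\min\{-2d_f,\,l(q_1),\,l(q_2)\},$$ except in the following cases: (a) When $m_1$ and $m_2$ are both reducible inseparable polynomials (and $d_f\le 0$): if $\lambda\neq0$, the intersection $\mathfrak{m}_K(q_1)\cap\mathfrak{m}_K(q_2)$ is a thick line of depth $\lfloor\nu(\lambda)/2\rfloor$ whose stem is a single vertex if $\nu(\lambda)$ is even and an edge (a line of length $1$) otherwise; if $\lambda=0$, then either $\mathfrak{m}_K(q_1)\subseteq\mathfrak{m}_K(q_2)$ or $\mathfrak{m}_K(q_2)\subseteq\mathfrak{m}_K(q_1)$. (b) When $m_1$ and $m_2$ are both reducible separable polynomials and $d_f=-\infty$: the formula gives an intersection of length $2\infty$ (a maximal path), and this holds if $q_1q_2=q_2q_1$; but if $q_1q_2\neq q_2q_1$, the intersection is a ray instead.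
   Context: Scalars $\lambda\in K$ are identified with scalar matrices. For $A=\begin{pmatrix}a&b\\c&d\end{pmatrix}\in\mathbb{M}_2(K)$ (characteristic two) put $\overline{A}=\begin{pmatrix}d&b\\c&a\end{pmatrix}$; then $q_1\overline{q_2}+q_2\overline{q_1}$ is always a scalar matrix. Valuation and defects. $\nu(0)=\infty$, and for a fractional ideal $I=a\mathcal{O}$, $\nu(I)=\nu(a)$. For $a\in K$ the Artin-Schreier defect is $\mathbb{D}(a)=\bigcap_{h\in K}(h^2+h+a)$ and the quadratic defect is $\delta(a)=\bigcap_{h\in K}(h^2+a)$, where $(c)=c\mathcal{O}$. Polynomial classes. $X^2+cX+d\in K[X]$ is separable if $c\neq0$, inseparable otherwise. It is ramified (unramified) if its splitting field is ramified (unramified) over $K$. $A^s$ is the set of separable polynomials that are reducible or unramified; $B^s$ is the set of ramified irreducible separable polynomials; $A^i$ is the set of reducible inseparable polynomials; $B^i$ is the set of irreducible inseparable polynomials (which are always ramified). Bruhat-Tits tree. $\mathfrak{t}(K)$ is the graph whose vertices are the closed balls $B_a^{[r]}=\{x\in K:\nu(x-a)\ge r\}$, $a\in K$, $r\in\mathbb{Z}$, two balls being neighbors when one is a maximal proper sub-ball of the other. It is a tree. Vertices correspond bijectively to maximal orders of $\mathbb{M}_2(K)$: $B_a^{[r]}$ corresponds to the endomorphism ring $\mathfrak{D}_{B}=\mathrm{End}_{\mathcal{O}}(\Lambda)$ of the lattice $\Lambda\subset K^2$ spanned over $\mathcal{O}$ by $\begin{pmatrix}a\\1\end{pmatrix}$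 and $\begin{pmatrix}\pi^r\\0\end{pmatrix}$. Subgraphs are full subgraphs. For $q\in\mathbb{M}_2(K)$ integral over $\mathcal{O}$, the branch $\mathfrak{s}_K(q)$ is the full subgraph whose vertices are the balls $B$ with $q\in\mathfrak{D}_B$. Lines. A line is the full subgraph on the vertices of a walk without backtracking, which may be finite (length = number of edges, a single vertex having length $0$), single infinite (a ray, length $\infty$) or double infinite (a maximal path, length $2\infty$). Lengths are ordered with $n<\infty<2\infty$ for every finite $n$, and if $d_f=-\infty$ then $-2d_f$ is read as $2\infty$. For a line $\mathfrak{p}$ and an integer $n\ge0$, the thick line $\mathfrak{p}^{[n]}$ is the full subgraph of vertices at distance at most $n$ from $\mathfrak{p}$; $\mathfrak{p}$ is its stem and $n$ its depth. A leaf is a vertex of valency one. An infinite foliage (horoball) is the union of a strictly increasing sequence of thick lines with a common leaf; concretely, it is a union $\bigcup_{n\ge0}\{v_n\}^{[n]}$ for a ray with vertices $v_0,v_1,v_2,\dots$. Stems. For $q\in\mathbb{M}_2(K)\setminus K$ integral over $\mathcal{O}$, $\mathfrak{s}_K(q)$ is an infinite foliage if the minimal polynomial of $q$ is reducible and inseparable, and a thick line otherwise (known fact). In the thick line case $\mathfrak{m}_K(q)$ denotes the stem of $\mathfrak{s}_K(q)$ and $l(q)$ the length of this stem; in the infinite foliage case one sets, by convention, $\mathfrak{m}_K(q)=\mathfrak{s}_K(q)$ and $l(q)=\infty$. One always has $l(q)\in\{0,1,\infty,2\infty\}$. *)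

theory Defs
  imports
    "HOL-Algebra.Algebraic_Closure_Type"
    "HOL-Computational_Algebra.Computational_Algebra"
    "HOL-Analysis.Analysis"
begin

section \<open>The local field \<open>'k fls\<close>\<close>

text \<open>
  \<open>K\<close> is the field \<open>'k fls\<close> of formal Laurent series in the uniformizer \<^const>\<open>fls_X\<close>. The
  definitions make sense for every field \<open>'k\<close>; the theorem assumes that \<open>'k\<close> has \<open>2^\<tau>\<close> elements.
\<close>

definition val :: "'k::field fls \<Rightarrow> ereal" where
  "val f = (if f = 0 then \<infinity> else ereal (of_int (fls_subdegree f)))"

definition integers :: "'k::field fls set" where
  "integers = {x. 0 \<le> val x}"

definition principal_ideal :: "'k::field fls \<Rightarrow> 'k fls set" where
  "principal_ideal c = {c * x | x. x \<in> integers}"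

text \<open>The valuation of a fractional ideal; it is well defined because generators of the same
  ideal differ by a unit, and every \<open>\<O>\<close>-submodule used below is principal (possibly zero).\<close>
definition ideal_val :: "'k::field fls set \<Rightarrow> ereal" where
  "ideal_val I = (THE v. \<exists>c. I = principal_ideal c \<and> v = val c)"

definition artin_schreier_defect :: "'k::field fls \<Rightarrow> 'k fls set" where
  "artin_schreier_defect a = (\<Inter>h. principal_ideal (h^2 + h + a))"

definition quadratic_defect :: "'k::field fls \<Rightarrow> 'k fls set" where
  "quadratic_defect a = (\<Inter>h. principal_ideal (h^2 + a))"


section \<open>Ramification of splitting fields\<close>

definition splitting_field :: "'k::field fls poly \<Rightarrow> 'k fls alg_closure set" where
  "splitting_field m = \<Inter> {L. range to_ac \<subseteq> L \<and> {x. poly (map_poly to_ac m) x = 0} \<subseteq> L \<and>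
     (\<forall>x\<in>L. \<forall>y\<in>L. x + y \<in> L \<and> x * y \<in> L) \<and> (\<forall>x\<in>L. inverse x \<in> L)}"

text \<open>The integral closure of \<open>\<O>\<close> in a subfield \<open>L\<close> of the algebraic closure.\<close>
definition integers_of :: "'k::field fls alg_closure set \<Rightarrow> 'k fls alg_closure set" where
  "integers_of L = {x \<in> L. \<exists>p :: 'k fls poly. lead_coeff p = 1 \<and>
     (\<forall>i. Polynomial.coeff p i \<in> integers) \<and> poly (map_poly to_ac p) x = 0}"

text \<open>The maximal ideal, i.e. the set of non-units, of the local ring \<^term>\<open>integers_of L\<close>.\<close>
definition max_ideal_of :: "'k::field fls alg_closure set \<Rightarrow> 'k fls alg_closure set" where
  "max_ideal_of L = {x \<in> integers_of L. \<not> (\<exists>y \<in> integers_of L. x * y = 1)}"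

text \<open>Ramification index one: the uniformizer of \<open>K\<close> still generates the maximal ideal of the
  integers of \<open>L\<close>. (Residue field extensions are separable, the residue field being finite.)\<close>
definition unramified_field :: "'k::field fls alg_closure set \<Rightarrow> bool" where
  "unramified_field L \<longleftrightarrow> max_ideal_of L = {to_ac fls_X * y | y. y \<in> integers_of L}"

definition unramified_poly :: "'k::field fls poly \<Rightarrow> bool" where
  "unramified_poly m \<longleftrightarrow> unramified_field (splitting_field m)"

abbreviation ramified_poly :: "'k::field fls poly \<Rightarrow> bool" where
  "ramified_poly m \<equiv> \<not> unramified_poly m"


section \<open>Classes of quadratic polynomials\<close>

definition quad :: "'k::field fls \<Rightarrow> 'k fls \<Rightarrow> 'k fls poly" where
  "quad c d = [:d, c, 1:]"

text \<open>HOL-Algebra has another constant called \<open>irreducible\<close>, hence the qualified name.\<close>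
abbreviation irred_poly :: "'k::field fls poly \<Rightarrow> bool" where
  "irred_poly m \<equiv> Factorial_Ring.irreducible m"

definition sep_class_A :: "'k::field fls poly set"  \<comment> \<open>\<open>A\<^sup>s\<close>\<close> where
  "sep_class_A = {quad c d | c d. c \<noteq> 0 \<and> (\<not> irred_poly (quad c d) \<or> unramified_poly (quad c d))}"

definition sep_class_B :: "'k::field fls poly set"  \<comment> \<open>\<open>B\<^sup>s\<close>\<close> where
  "sep_class_B = {quad c d | c d. c \<noteq> 0 \<and> irred_poly (quad c d) \<and> ramified_poly (quad c d)}"

definition insep_class_A :: "'k::field fls poly set"  \<comment> \<open>\<open>A\<^sup>i\<close>\<close> where
  "insep_class_A = {quad 0 d | d. \<not> irred_poly (quad 0 d)}"

definition insep_class_B :: "'k::field fls poly set"  \<comment> \<open>\<open>B\<^sup>i\<close>\<close> where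
  "insep_class_B = {quad 0 d | d. irred_poly (quad 0 d)}"

definition reducible_sep :: "'k::field fls poly set" where
  "reducible_sep = {quad c d | c d. c \<noteq> 0 \<and> \<not> irred_poly (quad c d)}"


section \<open>The fake distance\<close>

definition e_coeff :: "'k::field fls \<Rightarrow> 'k fls" where
  "e_coeff a = (if a \<noteq> 0 then a else 1)"

text \<open>The defects below are nonzero ideals for polynomials in the respective class, so
  \<^const>\<open>real_of_ereal\<close> is only applied to finite values.\<close>
definition t_sep :: "'k::field fls \<Rightarrow> 'k fls \<Rightarrow> int" where
  "t_sep a b = - \<lfloor>(real_of_ereal (ideal_val (artin_schreier_defect (b / a^2))) - 1) / 2\<rfloor>"

definition t_insep :: "'k::field fls \<Rightarrow> int" where
  "t_insep b = \<lfloor>(real_of_ereal (ideal_val (quadratic_defect b)) - 1) / 2\<rfloor>"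

definition c_coeff :: "'k::field fls \<Rightarrow> 'k fls \<Rightarrow> int" where
  "c_coeff a b =
     (if quad a b \<in> sep_class_A \<union> insep_class_A then 0
      else if quad a b \<in> sep_class_B then - t_sep a b
      else t_insep b)"

definition Delta :: "'k::field fls \<Rightarrow> 'k fls \<Rightarrow> 'k fls \<Rightarrow> 'k fls \<Rightarrow> 'k fls \<Rightarrow> 'k fls" where
  "Delta a1 b1 a2 b2 lam = lam^2 + a1 * a2 * lam + a1^2 * b2 + a2^2 * b1"

definition fake_distance ::
    "'k::field fls \<Rightarrow> 'k fls \<Rightarrow> 'k fls \<Rightarrow> 'k fls \<Rightarrow> 'k fls \<Rightarrow> ereal" where
  "fake_distance a1 b1 a2 b2 lam =
     ereal (- 1 / 2) * val (Delta a1 b1 a2 b2 lam / ((e_coeff a1)^2 * (e_coeff a2)^2))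
     + ereal (of_int (c_coeff a1 b1)) + ereal (of_int (c_coeff a2 b2))"


section \<open>The Bruhat-Tits tree\<close>

text \<open>A vertex is a closed ball, i.e. a set of elements of \<open>K\<close>. All subgraphs in question are full,
  so a subgraph is represented by its set of vertices.\<close>

definition cball_val :: "'k::field fls \<Rightarrow> int \<Rightarrow> 'k fls set" where
  "cball_val a r = {x. ereal (of_int r) \<le> val (x - a)}"

definition vertices :: "'k::field fls set set" where
  "vertices = {cball_val a r | a r. True}"

definition max_subball :: "'k::field fls set \<Rightarrow> 'k fls set \<Rightarrow> bool" where
  "max_subball B C \<longleftrightarrow> B \<subset> C \<and> \<not> (\<exists>D \<in> vertices. B \<subset> D \<and> D \<subset> C)"

definition adj :: "'k::field fls set \<Rightarrow> 'k fls set \<Rightarrow> bool" where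
  "adj B C \<longleftrightarrow> B \<in> vertices \<and> C \<in> vertices \<and> (max_subball B C \<or> max_subball C B)"

definition tree_dist :: "'k::field fls set \<Rightarrow> 'k fls set \<Rightarrow> nat" where
  "tree_dist B C = (LEAST n. (adj ^^ n) B C)"

definition subgraph_dist :: "'k::field fls set set \<Rightarrow> 'k fls set set \<Rightarrow> enat" where
  "subgraph_dist S T = (INF B\<in>S. INF C\<in>T. enat (tree_dist B C))"


section \<open>Lines, thick lines and infinite foliages\<close>

datatype line_length = Fin_length nat | Inf_length | Two_Inf_length

instantiation line_length :: linorder
begin

fun less_eq_line_length :: "line_length \<Rightarrow> line_length \<Rightarrow> bool" where
  "Fin_length m \<le> Fin_length n \<longleftrightarrow> m \<le> n"
| "Fin_length m \<le> Inf_length \<longleftrightarrow> True"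
| "Inf_length \<le> Fin_length n \<longleftrightarrow> False"
| "Inf_length \<le> Inf_length \<longleftrightarrow> True"
| "x \<le> Two_Inf_length \<longleftrightarrow> True"
| "Two_Inf_length \<le> Fin_length n \<longleftrightarrow> False"
| "Two_Inf_length \<le> Inf_length \<longleftrightarrow> False"

definition less_line_length :: "line_length \<Rightarrow> line_length \<Rightarrow> bool" where
  "less_line_length x y \<longleftrightarrow> x \<le> y \<and> \<not> y \<le> x"

instance
proof
  fix x y z :: line_length
  show "x < y \<longleftrightarrow> x \<le> y \<and> \<not> y \<le> x" by (rule less_line_length_def)
  show "x \<le> x" by (cases x) auto
  show "x \<le> y \<Longrightarrow> y \<le> z \<Longrightarrow> x \<le> z" by (cases x; cases y; cases z) auto
  show "x \<le> y \<Longrightarrow> y \<le> x \<Longrightarrow> x = y" by (cases x; cases y) auto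
  show "x \<le> y \<or> y \<le> x" by (cases x; cases y) auto
qed

end

text \<open>A walk without backtracking, indexed by an interval \<open>I\<close> of integers.\<close>
definition nb_walk :: "int set \<Rightarrow> (int \<Rightarrow> 'k::field fls set) \<Rightarrow> bool" where
  "nb_walk I p \<longleftrightarrow> (\<forall>i\<in>I. p i \<in> vertices) \<and>
     (\<forall>i. i \<in> I \<and> i + 1 \<in> I \<longrightarrow> adj (p i) (p (i + 1))) \<and>
     (\<forall>i. i \<in> I \<and> i + 2 \<in> I \<longrightarrow> p i \<noteq> p (i + 2))"

fun walk_indices :: "line_length \<Rightarrow> int set" where
  "walk_indices (Fin_length n) = {0..int n}"
| "walk_indices Inf_length = {0..}"
| "walk_indices Two_Inf_length = UNIV"

definition is_line :: "'k::field fls set set \<Rightarrow> line_length \<Rightarrow> bool" where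
  "is_line S len \<longleftrightarrow> (\<exists>p. nb_walk (walk_indices len) p \<and> S = p ` walk_indices len)"

definition line_length_of :: "'k::field fls set set \<Rightarrow> line_length" where
  "line_length_of S = (THE len. is_line S len)"

definition thicken :: "'k::field fls set set \<Rightarrow> nat \<Rightarrow> 'k fls set set" where
  "thicken S n = {B \<in> vertices. \<exists>C\<in>S. tree_dist B C \<le> n}"

definition infinite_foliage :: "'k::field fls set set \<Rightarrow> bool" where
  "infinite_foliage S \<longleftrightarrow> (\<exists>v. nb_walk {0..} v \<and> S = (\<Union>n::nat. thicken {v (int n)} n))"


section \<open>Matrices, branches and stems\<close>

text \<open>In characteristic two this is the adjugate of \<open>A\<close>.\<close>
definition mat_bar :: "'k::field fls ^ 2 ^ 2 \<Rightarrow> 'k fls ^ 2 ^ 2" where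
  "mat_bar A = vector [vector [A $ 2 $ 2, A $ 1 $ 2], vector [A $ 2 $ 1, A $ 1 $ 1]]"

definition lattice_of :: "'k::field fls \<Rightarrow> int \<Rightarrow> ('k fls ^ 2) set" where
  "lattice_of a r =
     {x *s vector [a, 1] + y *s vector [fls_X_intpow r, 0] | x y. x \<in> integers \<and> y \<in> integers}"

text \<open>The lattice depends only on the ball, not on the chosen center.\<close>
definition max_order :: "'k::field fls set \<Rightarrow> ('k fls ^ 2 ^ 2) set" where
  "max_order B = {q. \<exists>a r. B = cball_val a r \<and> (\<forall>v \<in> lattice_of a r. q *v v \<in> lattice_of a r)}"

definition branch :: "'k::field fls ^ 2 ^ 2 \<Rightarrow> 'k fls set set" where
  "branch q = {B \<in> vertices. q \<in> max_order B}"

text \<open>The stem of a thick line is unique, since every vertex of the tree has at least three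
  neighbours.\<close>
definition stem :: "'k::field fls ^ 2 ^ 2 \<Rightarrow> 'k fls set set" where
  "stem q = (if infinite_foliage (branch q) then branch q
     else (THE p. (\<exists>len. is_line p len) \<and> (\<exists>n. branch q = thicken p n)))"

definition stem_length :: "'k::field fls ^ 2 ^ 2 \<Rightarrow> line_length" where
  "stem_length q = (if infinite_foliage (branch q) then Inf_length else line_length_of (stem q))"

text \<open>The length denoted by an extended real \<open>x \<ge> 0\<close>, which is an integer or \<open>\<infinity>\<close>, the latter being
  read as \<open>2\<infinity>\<close>. It is applied to \<open>- 2 * d\<close> for a fake distance \<open>d \<le> 0\<close>; see the lemma below.\<close>
definition length_of_ereal :: "ereal \<Rightarrow> line_length" where
  "length_of_ereal x = (if x = \<infinity> then Two_Inf_length else Fin_length (nat \<lfloor>real_of_ereal x\<rfloor>))"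

lemma minus_two_fake_distance_cases:
  "- 2 * fake_distance a1 b1 a2 b2 lam = \<infinity> \<or>
   (\<exists>k::int. - 2 * fake_distance a1 b1 a2 b2 lam = ereal (of_int k))"
proof (cases "Delta a1 b1 a2 b2 lam = 0")
  case True
  then show ?thesis by (simp add: fake_distance_def val_def)
next
  case False
  define w where "w = Delta a1 b1 a2 b2 lam / ((e_coeff a1)^2 * (e_coeff a2)^2)"
  have "w \<noteq> 0" using False by (simp add: w_def e_coeff_def)
  then have "- 2 * fake_distance a1 b1 a2 b2 lam =
      ereal (of_int (fls_subdegree w - 2 * c_coeff a1 b1 - 2 * c_coeff a2 b2))"
    unfolding fake_distance_def w_def[symmetric]
    by (simp add: val_def one_ereal_def numeral_eq_ereal algebra_simps)
  then show ?thesis by blast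
qed

end

theory Submission
  imports Defs
begin

text \<open>
  Up to scalars, which do not affect the stem, a matrix \<open>q\<close> is the binary quadratic form
  \<open>f(x) = \<gamma>x\<^sup>2 + tx + \<beta>\<close> with \<open>\<gamma> = q\<^sub>2\<^sub>1\<close>, \<open>t = tr q\<close>, \<open>\<beta> = q\<^sub>1\<^sub>2\<close>. The largest \<open>m\<close> with
  \<open>q \<in> K + \<pi>\<^sup>m\<DD>\<^sub>B\<close>, called the level of \<open>q\<close> at the ball \<open>B = B\<^sub>a\<^sup>[\<^sup>r\<^sup>]\<close>, is
  \<open>min (\<nu> \<gamma> + r) (\<nu> t) (\<nu> (f a) - r)\<close>. It changes by at most one along an edge, and wherever it is not
  maximal it increases along some edge; hence the branch is a thickening of the set of vertices of
  maximal level \<open>M\<close>, which is the stem, and \<open>M = \<nu>(e) + c\<close>. (For reducible inseparable polynomials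
  the level is unbounded and one takes \<open>M = 0\<close>.)

  Moreover \<open>\<Delta>\<close> is the resultant of the two forms, so \<open>d\<^sub>f = M\<^sub>1 + M\<^sub>2 - \<nu>(\<Delta>)/2\<close>. At a vertex with levels
  \<open>m\<^sub>1\<close> and \<open>m\<^sub>2\<close> one has \<open>\<nu>(\<Delta>) \<ge> 2(m\<^sub>1 + m\<^sub>2)\<close>, with equality exactly if the reduced primitive forms
  have no common zero. A vertex of one stem closest to the other one gives the distance; in the
  remaining cases the intersection is read off in coordinates adapted to one of the stems.
\<close>

section \<open>Valuations and distances between balls\<close>

text \<open>The constants come from the identity \<gamma> f(x) = P(\<gamma> x + \<alpha>), where P
  is the minimal polynomial of q and \<alpha> its upper left entry. At a ball of level at least m
  the bounds on \<gamma> and f(a) multiply to \<nu>(\<gamma> f(a)) \<ge> 2m, free of the radius. So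
  for irreducible P the maximal level depends only on the largest valuation of a value of P: 2M
  gives a single vertex, 2M + 1 an edge. Up to the factor \<open>e_coeff a\<close>, squared, these
  values are the elements whose ideals are intersected in the defects, which explains t_i. The climb
  to maximal level rests on the residue field being perfect: where the level can still grow, the
  reduced form has no middle term, so it is the square of a linear form and its one zero is the
  direction to go. The delicate case is that of two horoballs, where neither form has a maximal
  level. There \<Delta> = \<lambda>^2 bounds the level that both forms can have at one vertex, and
  the vertices with the largest common level form the stem of the intersection.\<close>

definition vge :: "int \<Rightarrow> 'k::field fls \<Rightarrow> bool" where
  "vge n x \<longleftrightarrow> x = 0 \<or> n \<le> fls_subdegree x"

lemma vge_iff_nth: "vge n x \<longleftrightarrow> (\<forall>k<n. fls_nth x k = 0)"
proof
  show "vge n x \<Longrightarrow> \<forall>k<n. fls_nth x k = 0" unfolding vge_def by auto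
  show "\<forall>k<n. fls_nth x k = 0 \<Longrightarrow> vge n x"
    unfolding vge_def using fls_subdegree_geI by blast
qed

lemma vge_iff_val: "vge n x \<longleftrightarrow> ereal (of_int n) \<le> val x"
  by (simp add: vge_def val_def)

lemma vge_0 [simp]: "vge n 0"
  by (simp add: vge_def)

lemma vge_add: "vge n x \<Longrightarrow> vge n y \<Longrightarrow> vge n (x + y)"
  by (simp add: vge_iff_nth)

lemma vge_minus_iff [simp]: "vge n (- x) \<longleftrightarrow> vge n x"
  by (simp add: vge_iff_nth)

lemma vge_diff: "vge n x \<Longrightarrow> vge n y \<Longrightarrow> vge n (x - y)"
  by (simp add: vge_iff_nth)

lemma vge_minus_commute: "vge n (x - y) \<longleftrightarrow> vge n (y - x)"
  by (metis minus_diff_eq vge_minus_iff)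

lemma vge_mono: "vge n x \<Longrightarrow> m \<le> n \<Longrightarrow> vge m x"
  by (auto simp: vge_def)

lemma vge_add_cancel: "vge n y \<Longrightarrow> vge n (x + y) \<longleftrightarrow> vge n x"
  "vge n y \<Longrightarrow> vge n (y + x) \<longleftrightarrow> vge n x"
  by (auto simp: vge_iff_nth)

lemma vge_mult: "vge m x \<Longrightarrow> vge n y \<Longrightarrow> vge (m + n) (x * y)"
  by (cases "x = 0 \<or> y = 0") (auto simp: vge_def)

lemma vge_mult': "vge m x \<Longrightarrow> vge n y \<Longrightarrow> k \<le> m + n \<Longrightarrow> vge k (x * y)"
  using vge_mult vge_mono by blast

text \<open>The negation \<open>\<not> vge (m + 1) x\<close> says that x is nonzero of valuation at
  most m, and such upper bounds add up in products.\<close>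

lemma not_vge_mult: "\<not> vge (m + 1) x \<Longrightarrow> \<not> vge (n + 1) y \<Longrightarrow> m + n + 1 \<le> k \<Longrightarrow> \<not> vge k (x * y)"
  by (auto simp: vge_def)

lemma vge_square: "vge (2 * n) (x\<^sup>2) \<longleftrightarrow> vge n x"
  by (cases "x = 0") (auto simp: vge_def power2_eq_square)

text \<open>Squares have even valuation, so an odd bound on a square is as good as the next even
  one.\<close>

lemma vge_square_odd: "vge (2 * n - 1) (x\<^sup>2) \<longleftrightarrow> vge n x"
  by (cases "x = 0") (auto simp: vge_def power2_eq_square)

lemma vge_X_intpow [simp]: "vge n (fls_X_intpow m :: 'k::field fls) \<longleftrightarrow> n \<le> m"
  unfolding vge_def by simp

lemma vge_subdegree: "vge (fls_subdegree x) x"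
  by (simp add: vge_def)

lemma fls_subdegree_eqI_vge: "vge n x \<Longrightarrow> \<not> vge (n + 1) x \<Longrightarrow> x \<noteq> 0 \<and> fls_subdegree x = n"
  by (auto simp: vge_def)

section \<open>Inclusion and adjacency of balls\<close>

lemma mem_cball_val: "x \<in> cball_val a r \<longleftrightarrow> vge r (x - a)"
  by (simp add: cball_val_def vge_iff_val)

lemma cball_val_subset_iff:
  "cball_val a r \<subseteq> cball_val b s \<longleftrightarrow> s \<le> r \<and> vge s (a - b)"
proof
  assume sub: "cball_val a r \<subseteq> cball_val b s"
  have "a \<in> cball_val a r" by (simp add: mem_cball_val)
  then have "a \<in> cball_val b s" using sub by blast
  then have 1: "vge s (a - b)" by (simp add: mem_cball_val)
  have "a + fls_X_intpow r \<in> cball_val a r" by (simp add: mem_cball_val)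
  then have "a + fls_X_intpow r \<in> cball_val b s" using sub by blast
  then have 2: "vge s (a + fls_X_intpow r - b)" by (simp add: mem_cball_val)
  have "vge s ((a + fls_X_intpow r - b) - (a - b))" using 1 2 by (rule vge_diff[rotated])
  then have "vge s (fls_X_intpow r :: 'a fls)" by simp
  then show "s \<le> r \<and> vge s (a - b)" using 1 by simp
next
  assume *: "s \<le> r \<and> vge s (a - b)"
  show "cball_val a r \<subseteq> cball_val b s"
  proof
    fix x assume "x \<in> cball_val a r"
    then have "vge s (x - a)" using * vge_mono by (auto simp: mem_cball_val)
    then have "vge s ((x - a) + (a - b))" using * vge_add by blast
    then show "x \<in> cball_val b s" by (simp add: mem_cball_val)
  qed
qed

lemma cball_val_eq_iff:
  "cball_val a r = cball_val b s \<longleftrightarrow> r = s \<and> vge r (a - b)"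
  by (auto simp: set_eq_subset cball_val_subset_iff vge_minus_commute)

lemma cball_val_in_vertices [simp]: "cball_val a r \<in> vertices"
  by (auto simp: vertices_def)

lemma verticesE: assumes "B \<in> vertices" obtains a r where "B = cball_val a r"
  using assms by (auto simp: vertices_def)

lemma max_subball_iff:
  assumes "B \<in> vertices" "C \<in> vertices"
  shows "max_subball B C \<longleftrightarrow> (\<exists>a r. B = cball_val a (r + 1) \<and> C = cball_val a r)"
proof
  assume m: "max_subball B C"
  from assms obtain a r b s where B: "B = cball_val a r" and C: "C = cball_val b s"
    by (auto elim!: verticesE)
  have "B \<subset> C" using m by (simp add: max_subball_def)
  then have sub: "s \<le> r" "vge s (a - b)" and ne: "B \<noteq> C" by (auto simp: B C psubset_eq cball_val_subset_iff)
  have C': "C = cball_val a s" using sub by (simp add: C cball_val_eq_iff vge_minus_commute)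
  have "s \<noteq> r" using ne by (auto simp: B C')
  then have sr: "s < r" using sub by simp
  have "r = s + 1"
  proof (rule ccontr)
    assume "r \<noteq> s + 1"
    then have "B \<subset> cball_val a (s + 1)" "cball_val a (s + 1) \<subset> C"
      using sr by (auto simp: B C' psubset_eq cball_val_subset_iff cball_val_eq_iff)
    then show False using m by (auto simp: max_subball_def)
  qed
  then show "\<exists>a r. B = cball_val a (r + 1) \<and> C = cball_val a r" using B C' by blast
next
  assume "\<exists>a r. B = cball_val a (r + 1) \<and> C = cball_val a r"
  then obtain a r where B: "B = cball_val a (r + 1)" and C: "C = cball_val a r" by blast
  show "max_subball B C"
    unfolding max_subball_def
  proof (intro conjI notI)
    show "B \<subset> C" by (auto simp: B C psubset_eq cball_val_subset_iff cball_val_eq_iff)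
    assume "\<exists>D\<in>vertices. B \<subset> D \<and> D \<subset> C"
    then obtain d s where D: "B \<subset> cball_val d s" "cball_val d s \<subset> C"
      by (auto elim!: verticesE)
    then have "s \<le> r + 1" "r \<le> s" "vge s (a - d)"
      by (auto simp: B C psubset_eq cball_val_subset_iff)
    moreover have "s \<noteq> r" "s \<noteq> r + 1" using D \<open>vge s (a - d)\<close>
      by (auto simp: B C psubset_eq cball_val_eq_iff vge_minus_commute)
    ultimately show False by simp
  qed
qed

lemma adj_iff:
  "adj B C \<longleftrightarrow> (\<exists>a r. B = cball_val a (r + 1) \<and> C = cball_val a r \<or>
                       B = cball_val a r \<and> C = cball_val a (r + 1))"
proof (cases "B \<in> vertices \<and> C \<in> vertices")
  case True
  then show ?thesis by (auto simp: adj_def max_subball_iff)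
next
  case False
  then show ?thesis by (auto simp: adj_def)
qed

lemma adj_sym: "adj B C \<Longrightarrow> adj C B"
  by (auto simp: adj_def)

lemma adj_vertices: "adj B C \<Longrightarrow> B \<in> vertices" "adj B C \<Longrightarrow> C \<in> vertices"
  by (auto simp: adj_def)

lemma adj_cball_iff:
  "adj (cball_val a r) C \<longleftrightarrow> C = cball_val a (r - 1) \<or> (\<exists>c. vge r (c - a) \<and> C = cball_val c (r + 1))"
proof
  assume "adj (cball_val a r) C"
  then obtain b s where "cball_val a r = cball_val b (s + 1) \<and> C = cball_val b s \<or>
      cball_val a r = cball_val b s \<and> C = cball_val b (s + 1)"
    by (auto simp: adj_iff)
  then show "C = cball_val a (r - 1) \<or> (\<exists>c. vge r (c - a) \<and> C = cball_val c (r + 1))"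
  proof
    assume *: "cball_val a r = cball_val b (s + 1) \<and> C = cball_val b s"
    then have "r = s + 1" "vge r (a - b)" by (auto simp: cball_val_eq_iff)
    then have "vge s (b - a)" using vge_mono[of r "a - b" s] by (auto simp: vge_minus_commute)
    then show ?thesis using * \<open>r = s + 1\<close> by (auto simp: cball_val_eq_iff)
  next
    assume *: "cball_val a r = cball_val b s \<and> C = cball_val b (s + 1)"
    then have "s = r" "vge r (b - a)" by (auto simp: cball_val_eq_iff vge_minus_commute)
    then show ?thesis using * by auto
  qed
next
  assume "C = cball_val a (r - 1) \<or> (\<exists>c. vge r (c - a) \<and> C = cball_val c (r + 1))"
  then show "adj (cball_val a r) C"
  proof
    assume "C = cball_val a (r - 1)"
    then show ?thesis unfolding adj_iff by (intro exI[of _ a] exI[of _ "r - 1"]) simp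
  next
    assume "\<exists>c. vge r (c - a) \<and> C = cball_val c (r + 1)"
    then obtain c where c: "vge r (c - a)" "C = cball_val c (r + 1)" by blast
    then have "cball_val a r = cball_val c r" by (simp add: cball_val_eq_iff vge_minus_commute)
    then show ?thesis unfolding adj_iff using c by blast
  qed
qed

text \<open>The largest \<open>j\<close> such that some ball of radius exponent \<open>j\<close> contains both balls.\<close>
definition join_level :: "'k::field fls \<Rightarrow> int \<Rightarrow> 'k fls \<Rightarrow> int \<Rightarrow> int" where
  "join_level a r b s =
     (if a = b then min r s else min (min r s) (fls_subdegree (a - b)))"

lemma join_level_eqI:
  assumes "j \<le> r" "j \<le> s" "vge j (a - b)" "j = r \<or> j = s \<or> \<not> vge (j + 1) (a - b)"
  shows "join_level a r b s = j"
  using assms by (auto simp: join_level_def vge_def)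

lemma join_level:
  "join_level a r b s \<le> r" "join_level a r b s \<le> s" "vge (join_level a r b s) (a - b)"
  "join_level a r b s = r \<or> join_level a r b s = s \<or> \<not> vge (join_level a r b s + 1) (a - b)"
  by (auto simp: join_level_def vge_def)

lemma join_level_commute: "join_level a r b s = join_level b s a r"
  using join_level[of b s a r] by (intro join_level_eqI) (auto simp: vge_minus_commute)

lemma vge_diff_trans: "vge n (b - c) \<Longrightarrow> vge n (a - b) \<longleftrightarrow> vge n (a - c)"
  using vge_add_cancel(1)[of n "b - c" "a - b"] by simp

lemma join_level_cong:
  assumes "vge s (b - b')"
  shows "join_level a r b s = join_level a r b' s"
proof (rule join_level_eqI)
  note j = join_level[of a r b' s]
  show "join_level a r b' s \<le> r" "join_level a r b' s \<le> s" using j by auto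
  have "vge (join_level a r b' s) (b - b')" using assms j(2) vge_mono by blast
  then show "vge (join_level a r b' s) (a - b)" using j(3) vge_diff_trans by blast
  show "join_level a r b' s = r \<or> join_level a r b' s = s \<or> \<not> vge (join_level a r b' s + 1) (a - b)"
  proof (cases "join_level a r b' s = s")
    case False
    then have "vge (join_level a r b' s + 1) (b - b')" using assms j(2) by (auto intro: vge_mono)
    then show ?thesis using j(4) vge_diff_trans by blast
  qed auto
qed

section \<open>The tree distance of two balls in terms of the smallest ball containing both\<close>

lemma relpowp_adj_sym: "(adj ^^ n) B C \<Longrightarrow> (adj ^^ n) C B"
proof (induction n arbitrary: B C)
  case (Suc n)
  then obtain D where "(adj ^^ n) B D" "adj D C" by (auto elim: relpowp_Suc_E)
  then show ?case using Suc.IH adj_sym by (metis relpowp_Suc_I2)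
qed auto

lemma relpowp_adj_up: "(adj ^^ n) (cball_val a r) (cball_val a (r - int n))"
proof (induction n)
  case (Suc n)
  have "adj (cball_val a (r - int n)) (cball_val a (r - int (Suc n)))"
    unfolding adj_cball_iff by (rule disjI1, rule arg_cong[where f="cball_val a"]) simp
  then show ?case using Suc by (rule relpowp_Suc_I[rotated])
qed auto

text \<open>Along an edge the expression \<open>r + s - 2 * join_level a r b s\<close> grows by at
  most one: passing to the larger ball lowers the join by at most one, passing to a smaller ball
  never lowers it.\<close>

lemma relpowp_adj_le:
  "(adj ^^ n) (cball_val a r) C \<Longrightarrow> \<exists>b s. C = cball_val b s \<and> r + s - 2 * join_level a r b s \<le> int n"
proof (induction n arbitrary: C)
  case 0
  then have "C = cball_val a r" by simp
  moreover have "join_level a r a r = r" by (simp add: join_level_def)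
  ultimately show ?case by (metis eq_refl of_nat_0 add_diff_cancel_right' mult_2 diff_self)
next
  case (Suc n)
  then obtain D where "(adj ^^ n) (cball_val a r) D" "adj D C" by (auto elim: relpowp_Suc_E)
  then obtain b s where D: "D = cball_val b s" and le: "r + s - 2 * join_level a r b s \<le> int n"
    using Suc.IH by blast
  from \<open>adj D C\<close>[unfolded D adj_cball_iff]
  show ?case
  proof
    assume C: "C = cball_val b (s - 1)"
    have "join_level a r b s \<le> join_level a r b (s - 1) + 1"
      by (auto simp: join_level_def)
    then show ?thesis using le C by (intro exI[of _ b] exI[of _ "s - 1"]) auto
  next
    assume "\<exists>c. vge s (c - b) \<and> C = cball_val c (s + 1)"
    then obtain c where c: "vge s (c - b)" and C: "C = cball_val c (s + 1)" by blast
    have "join_level a r b s = join_level a r c s"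
      using c by (intro join_level_cong) (simp add: vge_minus_commute)
    also have "\<dots> \<le> join_level a r c (s + 1)" by (auto simp: join_level_def)
    finally show ?thesis using le C by (intro exI[of _ c] exI[of _ "s + 1"]) auto
  qed
qed

text \<open>The path climbs from the first ball to the join and descends to the second one.\<close>

lemma relpowp_adj_join:
  "(adj ^^ nat (r + s - 2 * join_level a r b s)) (cball_val a r) (cball_val b s)"
proof -
  define j where "j = join_level a r b s"
  have j: "j \<le> r" "j \<le> s" "vge j (a - b)" using join_level[of a r b s] by (auto simp: j_def)
  have 1: "(adj ^^ nat (r - j)) (cball_val a r) (cball_val a j)"
    using relpowp_adj_up[of "nat (r - j)" a r] j by simp
  have "(adj ^^ nat (s - j)) (cball_val b s) (cball_val b j)"
    using relpowp_adj_up[of "nat (s - j)" b s] j by simp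
  then have 2: "(adj ^^ nat (s - j)) (cball_val a j) (cball_val b s)"
    using relpowp_adj_sym j(3) by (metis cball_val_eq_iff)
  have "nat (r + s - 2 * j) = nat (r - j) + nat (s - j)" using j by simp
  then show ?thesis using relpowp_trans[OF 1 2] by (simp add: j_def[symmetric])
qed

lemma tree_dist_cball:
  "int (tree_dist (cball_val a r) (cball_val b s)) = r + s - 2 * join_level a r b s"
proof -
  have nn: "0 \<le> r + s - 2 * join_level a r b s" using join_level[of a r b s] by linarith
  have "tree_dist (cball_val a r) (cball_val b s) = nat (r + s - 2 * join_level a r b s)"
    unfolding tree_dist_def
  proof (rule Least_equality)
    fix n assume "(adj ^^ n) (cball_val a r) (cball_val b s)"
    then obtain b' s' where *: "cball_val b s = cball_val b' s'"
        "r + s' - 2 * join_level a r b' s' \<le> int n"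
      using relpowp_adj_le by blast
    then have "s' = s" "vge s (b - b')" by (auto simp: cball_val_eq_iff)
    then have "join_level a r b s = join_level a r b' s'" using join_level_cong by blast
    then show "nat (r + s - 2 * join_level a r b s) \<le> n" using * \<open>s' = s\<close> by simp
  qed (rule relpowp_adj_join)
  then show ?thesis using nn by simp
qed

lemma tree_dist_commute:
  assumes "B \<in> vertices" "C \<in> vertices" shows "tree_dist B C = tree_dist C B"
  unfolding tree_dist_def using relpowp_adj_sym by metis

lemma tree_dist_self [simp]: "tree_dist B B = 0"
  unfolding tree_dist_def by (rule Least_eq_0) simp

lemma relpowp_tree_dist:
  assumes "B \<in> vertices" "C \<in> vertices" shows "(adj ^^ tree_dist B C) B C"
proof -
  have "\<exists>n. (adj ^^ n) B C" using assms relpowp_adj_join by (metis verticesE)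
  then show ?thesis unfolding tree_dist_def by (rule LeastI_ex)
qed

lemma tree_dist_le: "(adj ^^ n) B C \<Longrightarrow> tree_dist B C \<le> n"
  unfolding tree_dist_def by (rule Least_le)

lemma tree_dist_eq_0_iff:
  assumes "B \<in> vertices" "C \<in> vertices" shows "tree_dist B C = 0 \<longleftrightarrow> B = C"
  using relpowp_tree_dist[OF assms] by (auto simp: gr0_conv_Suc)

lemma tree_dist_triangle:
  assumes "B \<in> vertices" "C \<in> vertices" "D \<in> vertices"
  shows "tree_dist B D \<le> tree_dist B C + tree_dist C D"
  using assms relpowp_tree_dist by (intro tree_dist_le) (auto simp: relpowp_add)

lemma tree_dist_adj: "adj B C \<Longrightarrow> tree_dist B C = 1"
proof -
  assume a: "adj B C"
  then have "tree_dist B C \<le> 1" by (intro tree_dist_le) auto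
  moreover have "B \<noteq> C" using a by (auto simp: adj_iff cball_val_eq_iff)
  ultimately show ?thesis using tree_dist_eq_0_iff adj_vertices[OF a]
    by (metis One_nat_def le_Suc_eq le_zero_eq)
qed

lemma tree_dist_step:
  assumes "B \<in> vertices" "C \<in> vertices" "B \<noteq> C"
  obtains B' where "adj B B'" "tree_dist B C = Suc (tree_dist B' C)"
proof -
  have "tree_dist B C \<noteq> 0" using assms tree_dist_eq_0_iff by blast
  then obtain n where n: "tree_dist B C = Suc n" by (meson not0_implies_Suc)
  then have "(adj ^^ Suc n) B C" using relpowp_tree_dist assms by metis
  then obtain B' where B': "adj B B'" "(adj ^^ n) B' C" by (meson relpowp_Suc_D2)
  have "tree_dist B' C \<le> n" using B' tree_dist_le by blast
  moreover have "tree_dist B C \<le> 1 + tree_dist B' C"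
    using tree_dist_triangle[of B B' C] tree_dist_adj[OF B'(1)] adj_vertices[OF B'(1)] assms by simp
  ultimately show ?thesis using that B' n by simp
qed

text \<open>The absence of circuits enters in this form: seen from B, at most one neighbour lies in
  the direction of D.\<close>

lemma tree_dist_neighbours:
  assumes "B \<in> vertices" "D \<in> vertices"
  shows "\<exists>N0. \<forall>N. adj B N \<longrightarrow>
     (if N = N0 then tree_dist N D + 1 = tree_dist B D else tree_dist N D = tree_dist B D + 1)"
proof -
  from assms obtain a r d s where B0: "B = cball_val a r" and D: "D = cball_val d s"
    by (auto elim!: verticesE)
  show ?thesis
  proof (cases "r \<le> s \<and> vge r (a - d)")
    case True
    then have B: "B = cball_val d r" by (simp add: B0 cball_val_eq_iff)
    have tB: "int (tree_dist B D) = s - r"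
      unfolding B D tree_dist_cball using True by (simp add: join_level_def)
    show ?thesis
    \<comment> \<open>For r = s the balls coincide and no neighbour is closer; the empty set, which
      is not a ball, then stands for the missing direction.\<close>
    proof (intro exI[of _ "if r < s then cball_val d (r + 1) else {}"] allI impI)
      fix N assume "adj B N"
      then have "N = cball_val d (r - 1) \<or> (\<exists>c. vge r (c - d) \<and> N = cball_val c (r + 1))"
        by (simp add: B adj_cball_iff)
      then show "if N = (if r < s then cball_val d (r + 1) else {}) then tree_dist N D + 1 = tree_dist B D
           else tree_dist N D = tree_dist B D + 1"
      proof
        assume N: "N = cball_val d (r - 1)"
        have "int (tree_dist N D) = s - r + 1"
          unfolding N D tree_dist_cball using True by (simp add: join_level_def)
        moreover have "N \<noteq> (if r < s then cball_val d (r + 1) else {})"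
          using mem_cball_val[of d d "r-1"] by (auto simp: N cball_val_eq_iff)
        ultimately show ?thesis using tB by simp
      next
        assume "\<exists>c. vge r (c - d) \<and> N = cball_val c (r + 1)"
        then obtain c where c: "vge r (c - d)" and N: "N = cball_val c (r + 1)" by blast
        have ne: "N \<noteq> {}" using mem_cball_val[of c c "r+1"] by (auto simp: N)
        show ?thesis
        proof (cases "r < s \<and> vge (r + 1) (c - d)")
          case T: True
          then have N': "N = cball_val d (r + 1)" by (simp add: N cball_val_eq_iff)
          have "int (tree_dist N D) = s - r - 1"
            unfolding N' D tree_dist_cball using T by (simp add: join_level_def)
          then show ?thesis using tB N' T by simp
        next
          case F: False
          have "join_level c (r + 1) d s = r"
            using F True c by (intro join_level_eqI) auto
          then have "int (tree_dist N D) = s - r + 1"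
            unfolding N D tree_dist_cball by simp
          moreover have "N \<noteq> (if r < s then cball_val d (r + 1) else {})"
            using ne F by (auto simp: N cball_val_eq_iff)
          ultimately show ?thesis using tB by simp
        qed
      qed
    qed
  next
    case False
    define j where "j = join_level a r d s"
    have j: "j \<le> r" "j \<le> s" "vge j (a - d)" "j = r \<or> j = s \<or> \<not> vge (j + 1) (a - d)"
      using join_level[of a r d s] by (auto simp: j_def)
    have jr: "j < r" using j False by (cases "j = r") auto
    have tB: "int (tree_dist B D) = r + s - 2 * j" unfolding B0 D tree_dist_cball j_def ..
    show ?thesis
    proof (intro exI[of _ "cball_val a (r - 1)"] allI impI)
      fix N assume "adj B N"
      then have "N = cball_val a (r - 1) \<or> (\<exists>c. vge r (c - a) \<and> N = cball_val c (r + 1))"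
        by (simp add: B0 adj_cball_iff)
      then show "if N = cball_val a (r - 1) then tree_dist N D + 1 = tree_dist B D
           else tree_dist N D = tree_dist B D + 1"
      proof
        assume N: "N = cball_val a (r - 1)"
        have "join_level a (r - 1) d s = j" using j jr by (intro join_level_eqI) auto
        then show ?thesis using tB tree_dist_cball[of a "r - 1" d s] by (simp add: N D)
      next
        assume "\<exists>c. vge r (c - a) \<and> N = cball_val c (r + 1)"
        then obtain c where c: "vge r (c - a)" and N: "N = cball_val c (r + 1)" by blast
        have 1: "vge j (c - a)" "vge (j + 1) (c - a)" using c jr by (auto intro: vge_mono)
        have "vge j (c - d)" using 1 j(3) by (metis vge_diff_trans)
        moreover have "vge (j + 1) (c - d) \<longleftrightarrow> vge (j + 1) (a - d)"
          using 1 by (metis vge_diff_trans vge_minus_commute)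
        ultimately have "join_level c (r + 1) d s = j" using j jr by (intro join_level_eqI) auto
        then have "int (tree_dist N D) = r + s - 2 * j + 1"
          unfolding N D tree_dist_cball by simp
        moreover have "N \<noteq> cball_val a (r - 1)" by (auto simp: N cball_val_eq_iff)
        ultimately show ?thesis using tB by simp
      qed
    qed
  qed
qed

section \<open>Lines and thick lines\<close>

text \<open>Two neighbours cannot both point towards D. Along a walk without backtracking the
  previous vertex is the closer neighbour, so the next one is farther.\<close>

lemma tree_dist_forward:
  assumes "adj B N" "adj B N'" "N \<noteq> N'" "D \<in> vertices" "tree_dist N D < tree_dist B D"
  shows "tree_dist N' D = tree_dist B D + 1"
proof -
  obtain N0 where N0: "\<And>N. adj B N \<Longrightarrow>
     (if N = N0 then tree_dist N D + 1 = tree_dist B D else tree_dist N D = tree_dist B D + 1)"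
    using tree_dist_neighbours[of B D] adj_vertices assms by blast
  show ?thesis using N0[OF assms(1)] N0[OF assms(2)] assms(3,5) by (simp split: if_splits)
qed

section \<open>Walks without backtracking as geodesics\<close>

lemma walk_indices_convex:
  "i \<in> walk_indices len \<Longrightarrow> j \<in> walk_indices len \<Longrightarrow> i \<le> x \<Longrightarrow> x \<le> j \<Longrightarrow> x \<in> walk_indices len"
  by (cases len) auto

lemma walk_indices_zero: "0 \<in> walk_indices len"
  by (cases len) auto

text \<open>Two earlier values enter the induction: with distance k at one position and k + 1 at the
  next, the former vertex is the neighbour closer to the start, and the vertex that follows is a
  different neighbour.\<close>

lemma nb_walk_dist_nat:
  assumes "nb_walk (walk_indices len) p" "i \<in> walk_indices len" "i + int n \<in> walk_indices len"
  shows "tree_dist (p (i + int n)) (p i) = n"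
  using assms(3)
proof (induction n rule: less_induct)
  case (less n)
  have V: "p x \<in> vertices" if "x \<in> walk_indices len" for x using assms that by (auto simp: nb_walk_def)
  have mem: "i + int k \<in> walk_indices len" if "k \<le> n" for k
    using that less.prems assms(2) walk_indices_convex[of i len "i + int n" "i + int k"] by auto
  have A: "adj (p (i + int k)) (p (i + int (Suc k)))" if "Suc k \<le> n" for k
  proof -
    have "i + int k \<in> walk_indices len" "i + int k + 1 \<in> walk_indices len"
      using mem[of k] mem[of "Suc k"] that by (auto simp: algebra_simps)
    then have "adj (p (i + int k)) (p (i + int k + 1))" using assms(1) unfolding nb_walk_def by blast
    then show ?thesis by (simp add: algebra_simps)
  qed
  consider "n = 0" | "n = 1" | k where "n = Suc (Suc k)" by (metis One_nat_def not0_implies_Suc)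
  then show ?case
  proof cases
    case 1 then show ?thesis by simp
  next
    case 2
    then show ?thesis using tree_dist_adj[OF adj_sym[OF A[of 0]]] by simp
  next
    case 3
    have ne: "p (i + int k) \<noteq> p (i + int (Suc (Suc k)))"
    proof -
      have "i + int k \<in> walk_indices len" "i + int k + 2 \<in> walk_indices len"
        using mem[of k] mem[of "Suc (Suc k)"] 3 by (auto simp: algebra_simps)
      then have "p (i + int k) \<noteq> p (i + int k + 2)" using assms(1) unfolding nb_walk_def by blast
      then show ?thesis by (simp add: algebra_simps)
    qed
    have "tree_dist (p (i + int k)) (p i) = k" "tree_dist (p (i + int (Suc k))) (p i) = Suc k"
      using less.IH[of k] less.IH[of "Suc k"] mem[of k] mem[of "Suc k"] 3 by auto
    then have "tree_dist (p (i + int (Suc (Suc k)))) (p i) = Suc k + 1"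
      using tree_dist_forward[of "p (i + int (Suc k))" "p (i + int k)" "p (i + int (Suc (Suc k)))" "p i"]
        ne A[of k] A[of "Suc k"] V[OF assms(2)] 3 adj_sym by auto
    then show ?thesis using 3 by simp
  qed
qed

lemma nb_walk_dist:
  assumes "nb_walk (walk_indices len) p" "i \<in> walk_indices len" "j \<in> walk_indices len"
  shows "int (tree_dist (p i) (p j)) = \<bar>i - j\<bar>"
proof -
  have V: "p i \<in> vertices" "p j \<in> vertices" using assms by (auto simp: nb_walk_def)
  show ?thesis
  proof (cases "i \<le> j")
    case True
    then show ?thesis
      using nb_walk_dist_nat[OF assms(1,2), of "nat (j - i)"] assms tree_dist_commute[OF V] by simp
  next
    case False
    then show ?thesis
      using nb_walk_dist_nat[OF assms(1,3), of "nat (i - j)"] assms by simp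
  qed
qed

lemma is_line_vertices: "is_line S len \<Longrightarrow> S \<subseteq> vertices"
  by (auto simp: is_line_def nb_walk_def)

lemma is_line_nonempty: "is_line S len \<Longrightarrow> S \<noteq> {}"
  using walk_indices_zero by (auto simp: is_line_def)

text \<open>Positions on a line are integers, and of three integers one lies between the others.
  This serves to refute three branches of a line at one vertex.\<close>

lemma is_line_between:
  assumes "is_line S len" "B \<in> S" "C \<in> S" "D \<in> S"
  shows "tree_dist B C = tree_dist B D + tree_dist D C \<or>
         tree_dist B D = tree_dist B C + tree_dist C D \<or>
         tree_dist C D = tree_dist C B + tree_dist B D"
proof -
  obtain p where p: "nb_walk (walk_indices len) p" "S = p ` walk_indices len"
    using assms by (auto simp: is_line_def)
  then obtain i j k where "B = p i" "C = p j" "D = p k"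
      "i \<in> walk_indices len" "j \<in> walk_indices len" "k \<in> walk_indices len"
    using assms by blast
  then have "int (tree_dist B C) = \<bar>i - j\<bar>" "int (tree_dist C B) = \<bar>i - j\<bar>"
    "int (tree_dist B D) = \<bar>i - k\<bar>" "int (tree_dist D B) = \<bar>i - k\<bar>"
    "int (tree_dist C D) = \<bar>j - k\<bar>" "int (tree_dist D C) = \<bar>j - k\<bar>"
    by (simp_all add: nb_walk_dist[OF p(1)])
  then show ?thesis by linarith
qed

text \<open>Among the two subballs around \<open>a\<close> and \<open>a + \<pi>\<^sup>r\<close> and the ball containing the given one,
  at least one leads away from the line: three vertices of the line in these three directions
  would not be aligned.\<close>
lemma is_line_away:
  assumes S: "is_line S len" and B: "B \<in> vertices"
  obtains N where "adj B N" "\<And>D. D \<in> S \<Longrightarrow> tree_dist N D = tree_dist B D + 1"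
proof -
  obtain a r where B: "B = cball_val a r" using B by (rule verticesE)
  define b where "b = a + fls_X_intpow r"
  have ba: "vge r (b - a)" "\<not> vge (r + 1) (b - a)" by (auto simp: b_def)
  \<comment> \<open>Unless D lies in the subball, its join with D is that of B, while the radius
    exponent grows by one.\<close>
  have child: "\<exists>d s. D = cball_val d s \<and> r + 1 \<le> s \<and> vge (r + 1) (d - c)"
    if "vge r (c - a)" "D \<in> S" "tree_dist (cball_val c (r + 1)) D \<noteq> tree_dist B D + 1" for c D
  proof -
    obtain d s where D: "D = cball_val d s"
      using subsetD[OF is_line_vertices[OF S] \<open>D \<in> S\<close>] by (rule verticesE)
    have B': "B = cball_val c r" using that by (simp add: B cball_val_eq_iff vge_minus_commute)
    have "r + 1 \<le> s \<and> vge (r + 1) (d - c)"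
    proof (rule ccontr)
      assume *: "\<not> (r + 1 \<le> s \<and> vge (r + 1) (d - c))"
      have j: "join_level c r d s \<le> r" "join_level c r d s \<le> s" "vge (join_level c r d s) (c - d)"
        "join_level c r d s = r \<or> join_level c r d s = s \<or> \<not> vge (join_level c r d s + 1) (c - d)"
        using join_level[of c r d s] by auto
      then have "join_level c (r + 1) d s = join_level c r d s"
        using * by (intro join_level_eqI) (auto simp: vge_minus_commute)
      then show False
        using that tree_dist_cball[of c r d s] tree_dist_cball[of c "r + 1" d s] by (simp add: D B')
    qed
    then show ?thesis using D by blast
  qed
  have parent: "\<exists>d s. D = cball_val d s \<and> join_level a r d s < r"
    if "D \<in> S" "tree_dist (cball_val a (r - 1)) D \<noteq> tree_dist B D + 1" for D
  proof -
    obtain d s where D: "D = cball_val d s"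
      using subsetD[OF is_line_vertices[OF S] \<open>D \<in> S\<close>] by (rule verticesE)
    have "join_level a r d s < r"
    proof (rule ccontr)
      assume "\<not> join_level a r d s < r"
      then have eq: "join_level a r d s = r" using join_level(1)[of a r d s] by simp
      then have "r \<le> s" "vge r (a - d)" using join_level[of a r d s] by auto
      then have "join_level a (r - 1) d s = r - 1"
        by (intro join_level_eqI) (auto intro: vge_mono)
      then show False
        using that tree_dist_cball[of a r d s] tree_dist_cball[of a "r - 1" d s] eq by (simp add: D B)
    qed
    then show ?thesis using D by blast
  qed
  have "\<exists>N. adj B N \<and> (\<forall>D\<in>S. tree_dist N D = tree_dist B D + 1)"
  proof (rule ccontr)
    assume "\<nexists>N. adj B N \<and> (\<forall>D\<in>S. tree_dist N D = tree_dist B D + 1)"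
    then have contra: "\<exists>D. D \<in> S \<and> tree_dist N D \<noteq> tree_dist B D + 1" if "adj B N" for N
      using that by blast
    have "vge r (a - a)" by simp
    then have "adj B (cball_val a (r + 1))" unfolding B adj_cball_iff by blast
    moreover have "adj B (cball_val b (r + 1))" unfolding B adj_cball_iff using ba by blast
    moreover have "adj B (cball_val a (r - 1))" unfolding B adj_cball_iff by blast
    ultimately obtain D1 D2 D3 where *: "D1 \<in> S" "tree_dist (cball_val a (r + 1)) D1 \<noteq> tree_dist B D1 + 1"
       "D2 \<in> S" "tree_dist (cball_val b (r + 1)) D2 \<noteq> tree_dist B D2 + 1"
       "D3 \<in> S" "tree_dist (cball_val a (r - 1)) D3 \<noteq> tree_dist B D3 + 1"
      using contra by meson
    obtain d1 s1 where D1: "D1 = cball_val d1 s1" "r + 1 \<le> s1" "vge (r + 1) (d1 - a)"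
      using child[of a D1] * by auto
    obtain d2 s2 where D2: "D2 = cball_val d2 s2" "r + 1 \<le> s2" "vge (r + 1) (d2 - b)"
      using child[of b D2] * ba by auto
    obtain d3 s3 where D3: "D3 = cball_val d3 s3" "join_level a r d3 s3 < r"
      using parent[of D3] * by auto
    define j where "j = join_level a r d3 s3"
    have j: "j < r" "j \<le> s3" "vge j (a - d3)" "j = s3 \<or> \<not> vge (j + 1) (a - d3)"
      using join_level[of a r d3 s3] D3 by (auto simp: j_def)
    have cong: "vge n (y - x) \<longleftrightarrow> vge n (z - x)" if "vge n (y - z)" for n x y z
      using vge_add_cancel(2)[OF that, of "z - x"] by simp
    have d1: "vge n (d1 - x) \<longleftrightarrow> vge n (a - x)" if "n \<le> r + 1" for n x
      using vge_mono[OF D1(3) that] by (rule cong)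
    have d2: "vge n (d2 - x) \<longleftrightarrow> vge n (b - x)" if "n \<le> r + 1" for n x
      using vge_mono[OF D2(3) that] by (rule cong)
    have d2': "vge n (d2 - x) \<longleftrightarrow> vge n (a - x)" if "n \<le> r" for n x
      using d2[of n x] cong[OF vge_mono[OF ba(1) that]] that by simp
    have "join_level d1 s1 d2 s2 = r"
    proof (rule join_level_eqI)
      show "r \<le> s1" "r \<le> s2" using D1 D2 by auto
      show "vge r (d1 - d2)" using d1[of r d2] d2[of r a] ba by (simp add: vge_minus_commute)
      show "r = s1 \<or> r = s2 \<or> \<not> vge (r + 1) (d1 - d2)"
        using d1[of "r + 1" d2] d2[of "r + 1" a] ba by (simp add: vge_minus_commute)
    qed
    moreover have "join_level d1 s1 d3 s3 = j"
      using D1 j d1[of j d3] d1[of "j + 1" d3] by (intro join_level_eqI) auto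
    moreover have "join_level d2 s2 d3 s3 = j"
      using D2 j d2'[of j d3] d2'[of "j + 1" d3] by (intro join_level_eqI) auto
    ultimately have
      "int (tree_dist D1 D2) = s1 + s2 - 2 * r" "int (tree_dist D2 D1) = s1 + s2 - 2 * r"
      "int (tree_dist D1 D3) = s1 + s3 - 2 * j" "int (tree_dist D3 D1) = s1 + s3 - 2 * j"
      "int (tree_dist D2 D3) = s2 + s3 - 2 * j" "int (tree_dist D3 D2) = s2 + s3 - 2 * j"
      by (auto simp: D1 D2 D3 tree_dist_cball join_level_commute)
    \<comment> \<open>The three directions separate at B: with s1, s2 > r > j and s3 \<ge> j, none
      of the three distances is the sum of the other two.\<close>
    then show False using is_line_between[OF S *(1,3,5)] D1(2) D2(2) j(1,2) by linarith
  qed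
  then show ?thesis using that by blast
qed

text \<open>Iteration of the step that leads away from the whole line at once. The vertex found
  shows how far a ball around B has to stick out of a thick line.\<close>

lemma is_line_far:
  assumes S: "is_line S len" and B: "B \<in> vertices"
  shows "\<exists>C\<in>vertices. tree_dist C B \<le> k \<and> (\<forall>D\<in>S. tree_dist C D = tree_dist B D + k)"
proof (induction k)
  case 0
  show ?case using B by (intro bexI[of _ B]) auto
next
  case (Suc k)
  then obtain C where C: "C \<in> vertices" "tree_dist C B \<le> k" "\<forall>D\<in>S. tree_dist C D = tree_dist B D + k"
    by blast
  obtain N where N: "adj C N" "\<And>D. D \<in> S \<Longrightarrow> tree_dist N D = tree_dist C D + 1"
    using is_line_away[OF S C(1)] by blast
  then have "tree_dist N B \<le> Suc k"
    using tree_dist_triangle[of N C B] tree_dist_adj[of N C] adj_sym[OF N(1)] adj_vertices[OF N(1)] C(2) B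
    by simp
  then show ?case using N C adj_vertices by force
qed

text \<open>The converse implication being trivial, the thick line determines the distance to the stem,
  hence the stem itself.\<close>
lemma ball_in_thick_line:
  assumes S: "is_line S len" and B: "B \<in> vertices" and sub: "thicken {B} k \<subseteq> thicken S n"
  shows "\<exists>D\<in>S. tree_dist B D + k \<le> n"
proof -
  obtain C where C: "C \<in> vertices" "tree_dist C B \<le> k" "\<forall>D\<in>S. tree_dist C D = tree_dist B D + k"
    using is_line_far[OF S B] by blast
  then have "C \<in> thicken S n" using subsetD[OF sub, of C] by (auto simp: thicken_def)
  then obtain D where "D \<in> S" "tree_dist C D \<le> n" by (auto simp: thicken_def)
  then show ?thesis using C(3) by auto
qed

lemma thicken_mono: "C \<in> S \<Longrightarrow> thicken {C} n \<subseteq> thicken S n"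
  by (auto simp: thicken_def)

lemma thick_line_subset:
  assumes "is_line S len" "is_line S' len'" "thicken S n \<subseteq> thicken S' n'" "C \<in> S"
  shows "\<exists>D\<in>S'. tree_dist C D + n \<le> n'"
proof (rule ball_in_thick_line[OF assms(2)])
  show "C \<in> vertices" using assms is_line_vertices by blast
  show "thicken {C} n \<subseteq> thicken S' n'" using assms thicken_mono by blast
qed

text \<open>The inclusion of each thick line in the other forces equal depths, and then each vertex
  of one stem has distance 0 from the other stem.\<close>

lemma thick_line_unique:
  assumes S: "is_line S len" "is_line S' len'" and eq: "thicken S n = thicken S' n'"
  shows "S = S'"
proof -
  note 1 = thick_line_subset[OF S equalityD1[OF eq]]
  note 2 = thick_line_subset[OF S(2,1) equalityD2[OF eq]]
  obtain C D where "C \<in> S" "D \<in> S'" using S is_line_nonempty by blast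
  then have n: "n = n'" using 1[of C] 2[of D] by fastforce
  show ?thesis
  proof (intro equalityI subsetI)
    fix C assume C: "C \<in> S"
    then obtain D where "D \<in> S'" "tree_dist C D = 0" using 1 n by fastforce
    then show "C \<in> S'"
      using C tree_dist_eq_0_iff[of C D] subsetD[OF is_line_vertices[OF S(1)]] subsetD[OF is_line_vertices[OF S(2)]] by simp
  next
    fix C assume C: "C \<in> S'"
    then obtain D where "D \<in> S" "tree_dist C D = 0" using 2 n by fastforce
    then show "C \<in> S"
      using C tree_dist_eq_0_iff[of C D] subsetD[OF is_line_vertices[OF S(1)]] subsetD[OF is_line_vertices[OF S(2)]] by simp
  qed
qed

text \<open>An infinite foliage contains metric balls of every radius, a thick line of depth n none
  of radius above n.\<close>

lemma thick_line_not_foliage: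
  assumes "is_line S len"
  shows "\<not> infinite_foliage (thicken S n)"
proof
  assume "infinite_foliage (thicken S n)"
  then obtain v where v: "nb_walk {0..} v" "thicken S n = (\<Union>k::nat. thicken {v (int k)} k)"
    by (auto simp: infinite_foliage_def)
  have "v (int (Suc n)) \<in> vertices" using v by (auto simp: nb_walk_def)
  moreover have "thicken {v (int (Suc n))} (Suc n) \<subseteq> thicken S n" unfolding v(2) by blast
  ultimately show False using ball_in_thick_line[OF assms] by fastforce
qed

text \<open>Two parametrisations of the same line differ by an isometry of the index sets. Counting
  indices settles the finite case; a ray and a maximal path are told apart by the end point of the
  ray.\<close>

lemma is_line_length_unique:
  assumes "is_line S len" "is_line S len'"
  shows "len = len'"
proof -
  obtain p where p: "nb_walk (walk_indices len) p" "S = p ` walk_indices len"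
    using assms by (auto simp: is_line_def)
  obtain p' where p': "nb_walk (walk_indices len') p'" "S = p' ` walk_indices len'"
    using assms by (auto simp: is_line_def)
  define f where "f i = (SOME j. j \<in> walk_indices len' \<and> p i = p' j)" for i
  have f: "f i \<in> walk_indices len'" "p i = p' (f i)" if "i \<in> walk_indices len" for i
  proof -
    have "p i \<in> p' ` walk_indices len'" using that p p' by auto
    then have "\<exists>j. j \<in> walk_indices len' \<and> p i = p' j" by auto
    then have "f i \<in> walk_indices len' \<and> p i = p' (f i)" unfolding f_def by (rule someI_ex)
    then show "f i \<in> walk_indices len'" "p i = p' (f i)" by auto
  qed
  have iso: "\<bar>f i - f j\<bar> = \<bar>i - j\<bar>" if "i \<in> walk_indices len" "j \<in> walk_indices len" for i j
    using nb_walk_dist[OF p(1) that] nb_walk_dist[OF p'(1), of "f i" "f j"] f that by simp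
  have surj: "\<exists>i\<in>walk_indices len. j = f i" if "j \<in> walk_indices len'" for j
  proof -
    have "p' j \<in> S" using that p' by auto
    then obtain i where i: "i \<in> walk_indices len" "p' j = p i" using p by auto
    then have "j = f i" using nb_walk_dist[OF p'(1), of j "f i"] f[OF i(1)] that by simp
    then show ?thesis using i by blast
  qed
  have z: "0 \<in> walk_indices len" by (rule walk_indices_zero)
  have sub: "walk_indices len' = f ` walk_indices len" using surj f by auto
  have inj: "inj_on f (walk_indices len)"
  proof (rule inj_onI)
    fix i j assume "i \<in> walk_indices len" "j \<in> walk_indices len" "f i = f j"
    then show "i = j" using iso[of i j] by simp
  qed
  have fin: "finite (walk_indices len') \<longleftrightarrow> finite (walk_indices len)"
    and card: "card (walk_indices len') = card (walk_indices len)"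
    unfolding sub using inj by (auto simp: finite_image_iff card_image)
  have inf: "infinite ({0..} :: int set)" "infinite (UNIV :: int set)"
    using infinite_Ici infinite_UNIV_int by auto
  have ray: False if L: "len = Two_Inf_length" "len' = Inf_length"
  proof -
    have 1: "\<bar>f i - f j\<bar> = \<bar>i - j\<bar>" "0 \<le> f i" for i j using iso[of i j] f(1)[of i] L by auto
    \<comment> \<open>Both \<open>f 0 + 1\<close> and \<open>- f 0 - 1\<close> would have to go to
      \<open>2 * f 0 + 1\<close>, the other position at that distance from \<open>f 0\<close> being
      negative.\<close>
    show False using 1(1)[of "f 0 + 1" 0] 1(1)[of "- f 0 - 1" 0] 1(1)[of "f 0 + 1" "- f 0 - 1"]
        1(2)[of "f 0 + 1"] 1(2)[of "- f 0 - 1"] 1(2)[of 0] by (smt (verit))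
  qed
  have ray': False if L: "len = Inf_length" "len' = Two_Inf_length"
  proof -
    \<comment> \<open>The neighbours of \<open>f 0\<close> on either side would both come from index
      1, the only index adjacent to the end 0 of the ray.\<close>
    obtain i j where ij: "i \<ge> 0" "f 0 + 1 = f i" "j \<ge> 0" "f 0 - 1 = f j"
      using surj[of "f 0 + 1"] surj[of "f 0 - 1"] L by (metis UNIV_I atLeast_iff walk_indices.simps(2,3))
    then have "\<bar>f i - f 0\<bar> = \<bar>i - 0\<bar>" "\<bar>f j - f 0\<bar> = \<bar>j - 0\<bar>" "\<bar>f i - f j\<bar> = \<bar>i - j\<bar>"
      using iso[of i 0] iso[of j 0] iso[of i j] L by simp_all
    then show False using ij by linarith
  qed
  show ?thesis
  proof (cases len)
    case (Fin_length n)
    then have "finite (walk_indices len')" using fin by simp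
    then obtain n' where "len' = Fin_length n'" using inf by (cases len') auto
    then show ?thesis using card Fin_length by simp
  next
    case Inf_length
    then show ?thesis using ray' fin inf by (cases len') auto
  next
    case Two_Inf_length
    then show ?thesis using ray fin inf by (cases len') auto
  qed
qed

lemma line_length_of_eq: "is_line S len \<Longrightarrow> line_length_of S = len"
  unfolding line_length_of_def using is_line_length_unique by blast

lemma stem_thick_line:
  assumes "is_line S len" "branch q = thicken S n"
  shows "stem q = S" "stem_length q = len"
proof -
  have nf: "\<not> infinite_foliage (branch q)" using assms thick_line_not_foliage by auto
  show st: "stem q = S"
    unfolding stem_def if_not_P[OF nf]
  proof (rule the_equality)
    show "(\<exists>len. is_line S len) \<and> (\<exists>n. branch q = thicken S n)" using assms by blast
    show "p = S" if "(\<exists>len. is_line p len) \<and> (\<exists>n. branch q = thicken p n)" for p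
      using that assms thick_line_unique by metis
  qed
  show "stem_length q = len"
    unfolding stem_length_def st using nf assms line_length_of_eq by auto
qed

lemma is_line_singleton: "B \<in> vertices \<Longrightarrow> is_line {B} (Fin_length 0)"
  unfolding is_line_def by (intro exI[of _ "\<lambda>_. B"]) (auto simp: nb_walk_def)

lemma is_line_edge: "adj B C \<Longrightarrow> is_line {B, C} (Fin_length 1)"
  unfolding is_line_def
proof (intro exI[of _ "\<lambda>i. if i = 0 then B else C"] conjI)
  assume a: "adj B C"
  have I: "walk_indices (Fin_length 1) = {0, 1}" by auto
  show "nb_walk (walk_indices (Fin_length 1)) (\<lambda>i. if i = 0 then B else C)"
    unfolding I nb_walk_def using a adj_vertices by auto
  show "{B, C} = (\<lambda>i. if i = 0 then B else C) ` walk_indices (Fin_length 1)"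
    unfolding I by auto
qed

section \<open>Levels of quadratic forms\<close>

type_synonym 'k form = "'k fls \<times> 'k fls \<times> 'k fls"

fun feval :: "'k::field form \<Rightarrow> 'k fls \<Rightarrow> 'k fls" where
  "feval (g, t, b) x = g * x\<^sup>2 + t * x + b"

text \<open>\<open>lev F a r m\<close>: the level of \<open>F\<close> at the ball \<open>B\<^sub>a\<^sup>[\<^sup>r\<^sup>]\<close> is at least \<open>m\<close>.\<close>
fun lev :: "'k::field form \<Rightarrow> 'k fls \<Rightarrow> int \<Rightarrow> int \<Rightarrow> bool" where
  "lev (g, t, b) a r m \<longleftrightarrow> vge (m - r) g \<and> vge m t \<and> vge (m + r) (feval (g, t, b) a)"

text \<open>The branch is the case m = 0 (for integral trace and determinant), the stem of a thick
  line the case of the largest m with a nonempty set.\<close>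

definition lset :: "'k::field form \<Rightarrow> int \<Rightarrow> 'k fls set set" where
  "lset F m = {cball_val a r | a r. lev F a r m}"

text \<open>The resultant, written for characteristic two.\<close>
fun res :: "'k::field form \<Rightarrow> 'k form \<Rightarrow> 'k fls" where
  "res (g1, t1, b1) (g2, t2, b2) =
     (g1 * b2 + g2 * b1)\<^sup>2 + (g1 * t2 + g2 * t1) * (t1 * b2 + t2 * b1)"

abbreviation mid :: "'k::field form \<Rightarrow> 'k fls" where "mid F \<equiv> fst (snd F)"

lemma lset_subset: "lset F m \<subseteq> vertices"
  by (auto simp: lset_def)

lemma lset_mono: "m \<le> n \<Longrightarrow> lset F n \<subseteq> lset F m"
proof
  fix B assume "m \<le> n" "B \<in> lset F n"
  then obtain a r where "B = cball_val a r" "lev F a r n" by (auto simp: lset_def)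
  then have "lev F a r m" using \<open>m \<le> n\<close>
    by (cases F) (auto intro: vge_mono simp del: feval.simps)
  then show "B \<in> lset F m" using \<open>B = cball_val a r\<close> by (auto simp: lset_def)
qed

lemma vge_Suc: "vge n x \<Longrightarrow> fls_nth x n = 0 \<Longrightarrow> vge (n + 1) x"
  by (cases "fls_subdegree x = n") (auto simp: vge_def nth_fls_subdegree_zero_iff)

lemma fls_nth_const_X_intpow:
  fixes g :: "'k::field fls"
  shows "fls_nth (g * (fls_const d * fls_X_intpow n)) k = d * fls_nth g (k - n)"
proof -
  have "g * (fls_const d * fls_X_intpow n) = fls_const d * (fls_X_intpow n * g)"
    by (simp add: ac_simps)
  also have "fls_X_intpow n * g = fls_shift (-n) g" by (rule fls_X_intpow_times_conv_shift)
  finally show ?thesis by (simp only: fls_mult_const_nth fls_shift_nth) simp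
qed

text \<open>The square term has valuation at most n + 2s and the remaining terms have a larger one,
  so nothing can cancel it.\<close>

lemma not_vge_dominant:
  assumes "\<not> vge (n + 1) g" "vge s z" "\<not> vge (s + 1) z" "vge k (t * z + c)" "n + 2 * s + 1 \<le> k" "n + 2 * s + 1 \<le> l"
  shows "\<not> vge l (g * z\<^sup>2 + t * z + c)"
proof
  assume "vge l (g * z\<^sup>2 + t * z + c)"
  then have "vge (n + 2 * s + 1) (g * z\<^sup>2 + (t * z + c))" using assms(6) vge_mono by (simp add: add.assoc)
  moreover have "vge (n + 2 * s + 1) (t * z + c)" using assms(4,5) vge_mono by blast
  ultimately have 1: "vge (n + 2 * s + 1) (g * z\<^sup>2)" using vge_add_cancel by blast
  have "g \<noteq> 0" "z \<noteq> 0" "fls_subdegree z \<le> s" "fls_subdegree g \<le> n"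
    using assms by (auto simp: vge_def)
  then show False using 1 by (auto simp: vge_def power2_eq_square)
qed

section \<open>Arithmetic in characteristic two over a finite residue field\<close>

locale finite_char2 =
  fixes ty :: "'k::{field,finite} itself"
  assumes two_eq_0: "(1::'k) + 1 = 0"
begin

lemma add_self: "x + x = (0::'k fls)"
proof -
  have "x + x = fls_const (1 + 1) * x" by (simp only: fls_plus_const[symmetric] distrib_right fls_const_1 mult_1_left)
  then show ?thesis by (simp only: two_eq_0 fls_const_0 mult_zero_left)
qed

lemma add_self_left: "x + (x + y) = (y::'k fls)"
  by (simp add: add_self flip: add.assoc)

lemma uminus_eq: "- x = (x::'k fls)"
  using add_self[of x] by (simp add: eq_neg_iff_add_eq_0)

lemma diff_eq: "x - y = x + (y::'k fls)"
  by (simp only: diff_conv_add_uminus uminus_eq)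

lemma numeral_fls: "(numeral (Num.Bit0 n) :: 'k fls) = 0" "(numeral (Num.Bit1 n) :: 'k fls) = 1"
  by (simp_all add: numeral.simps add_self)

lemmas char2_simps = add_self add_self_left uminus_eq diff_eq numeral_fls distrib_left distrib_right
  power2_eq_square ac_simps

lemma add_eq_0_iff_eq: "x + y = 0 \<longleftrightarrow> x = (y::'k fls)"
  by (auto simp: add_eq_0_iff uminus_eq)

lemma square_add: "(x + y)\<^sup>2 = x\<^sup>2 + (y\<^sup>2 :: 'k fls)"
  by (simp add: char2_simps)

text \<open>Squaring is injective in characteristic two, hence surjective on a finite field.\<close>

lemma exists_sqrt: "\<exists>y::'k. y\<^sup>2 = w"
proof -
  have "inj (\<lambda>y::'k. y\<^sup>2)"
  proof (rule injI)
    fix x y :: 'k assume "x\<^sup>2 = y\<^sup>2"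
    have "y + y = (1 + 1) * y" by (simp only: distrib_right mult_1_left)
    then have "y + y = 0" by (simp only: two_eq_0 mult_zero_left)
    then have m: "- y = y" by (simp only: neg_eq_iff_add_eq_0)
    have "x = y \<or> x = - y" using \<open>x\<^sup>2 = y\<^sup>2\<close> by (simp only: power2_eq_iff)
    then show "x = y" using m by simp
  qed
  then have "surj (\<lambda>y::'k. y\<^sup>2)" by (rule finite_UNIV_inj_surj[OF finite])
  then show ?thesis by (metis surjD)
qed

text \<open>The cross term 2gaz of the expansion vanishes, so a change of centre keeps g and t and
  only replaces the constant term by the value at the new centre.\<close>

lemma feval_shift: "feval (g, t, b) (a + z) = g * z\<^sup>2 + t * z + (feval (g, t, b) a :: 'k fls)"
  by (simp add: char2_simps)

section \<open>Change of the level along edges\<close>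

lemma lev_cong:
  assumes "vge r (a' - a)" shows "lev F a r m \<longleftrightarrow> lev (F :: 'k form) a' r m"
proof (cases F)
  case (fields g t b)
  define z where "z = a' + a"
  have z: "vge r z" "a' = a + z" using assms by (simp_all add: z_def char2_simps)
  have "vge (m + r) (feval (g, t, b) a') \<longleftrightarrow> vge (m + r) (feval (g, t, b) a)"
    if "vge (m - r) g" "vge m t"
  proof -
    have "vge (2 * r) (z\<^sup>2)" using z by (simp add: vge_square)
    then have "vge (m + r) (g * z\<^sup>2 + t * z)"
      using that z by (intro vge_add) (auto intro: vge_mult')
    then show ?thesis unfolding z(2) feval_shift by (rule vge_add_cancel(2))
  qed
  then show ?thesis by (auto simp: fields simp del: feval.simps)
qed

lemma cball_val_in_lset: "cball_val a r \<in> lset (F :: 'k form) m \<longleftrightarrow> lev F a r m"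
proof
  assume "cball_val a r \<in> lset F m"
  then obtain a' where "vge r (a - a')" "lev F a' r m" by (auto simp: lset_def cball_val_eq_iff)
  then show "lev F a r m" using lev_cong by blast
qed (auto simp: lset_def)

lemma lset_adj:
  assumes "adj B C" "B \<in> lset (F :: 'k form) m" shows "C \<in> lset F (m - 1)"
proof -
  from adj_vertices(1)[OF assms(1)] obtain a r where B: "B = cball_val a r" by (rule verticesE)
  obtain g t b where F: "F = (g, t, b)" by (cases F)
  from assms(1)[unfolded B adj_cball_iff] show ?thesis
  proof
    assume C: "C = cball_val a (r - 1)"
    then show ?thesis using assms(2)
      by (auto simp: B F cball_val_in_lset intro: vge_mono simp del: feval.simps)
  next
    assume "\<exists>c. vge r (c - a) \<and> C = cball_val c (r + 1)"
    then obtain c where c: "vge r (c - a)" and C: "C = cball_val c (r + 1)" by blast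
    have "lev F c r m" using assms(2) lev_cong[OF c] by (simp add: B cball_val_in_lset)
    then show ?thesis
      by (auto simp: C F cball_val_in_lset intro: vge_mono simp del: feval.simps)
  qed
qed

lemma lset_dist:
  assumes "B \<in> lset (F :: 'k form) m" "C \<in> vertices" shows "C \<in> lset F (m - int (tree_dist C B))"
  using assms(2)
proof (induction "tree_dist C B" arbitrary: C)
  case 0
  then show ?case using assms tree_dist_eq_0_iff[of C B] subsetD[OF lset_subset assms(1)] by simp
next
  case (Suc n)
  then have "C \<noteq> B" using tree_dist_self by (metis nat.distinct(1))
  then obtain C' where C': "adj C C'" "tree_dist C B = Suc (tree_dist C' B)"
    using tree_dist_step[of C B] Suc.prems subsetD[OF lset_subset assms(1)] by blast
  then have "C' \<in> lset F (m - int n)" using Suc adj_vertices(2)[OF C'(1)] by simp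
  then have "C \<in> lset F (m - int n - 1)" using lset_adj[OF adj_sym[OF C'(1)]] by blast
  then show ?case by (simp add: Suc.hyps(2)[symmetric] algebra_simps)
qed

text \<open>Modulo \<pi> the middle term disappears. As the residue field is perfect, z can be
  chosen as a constant times \<pi>^r such that the leading coefficients of g z^2 and c
  cancel.\<close>

lemma step_down_coefficient:
  fixes g t c :: "'k fls"
  assumes "vge (m - r) g" "\<not> vge (m - r + 1) g" "vge (m + 1) t" "vge (m + r) c"
  obtains z where "vge r z" "vge (m + r + 1) (g * z\<^sup>2 + t * z + c)"
proof -
  have u: "fls_nth g (m - r) \<noteq> 0" using assms(1,2) vge_Suc by blast
  obtain y :: 'k where y: "y\<^sup>2 = fls_nth c (m + r) / fls_nth g (m - r)" using exists_sqrt by blast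
  define z :: "'k fls" where "z = fls_const y * fls_X_intpow r"
  have z2: "z\<^sup>2 = fls_const (y\<^sup>2) * fls_X_intpow (2 * r)"
    by (simp add: z_def power_mult_distrib fls_X_intpow_power flip: fls_const_power)
  have z: "vge r z" by (cases "y = 0") (auto simp: z_def vge_def)
  have tz: "vge (m + r + 1) (t * z)" using assms(3) z vge_mult'[of "m+1" t r z] by simp
  have gz: "vge (m + r) (g * z\<^sup>2)" using assms(1) z vge_mult'[of "m-r" g "2*r" "z\<^sup>2"] by (simp add: vge_square)
  have "fls_nth (g * z\<^sup>2) (m + r) = fls_nth c (m + r)"
    unfolding z2 fls_nth_const_X_intpow using u y by (simp add: algebra_simps)
  then have "fls_nth (g * z\<^sup>2 - c) (m + r) = 0" by simp
  then have "vge (m + r + 1) (g * z\<^sup>2 - c)" using gz assms(4) vge_diff vge_Suc by blast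
  then have "vge (m + r + 1) ((g * z\<^sup>2 + c) + t * z)" using tz vge_add by (simp add: diff_eq)
  then show ?thesis using that[OF z] by (simp add: ac_simps)
qed

text \<open>If no neighbour does better then the form at the given vertex is of Eisenstein type, and then
  \<open>m\<close> is its maximal level.\<close>
lemma lset_step_up:
  assumes B: "B \<in> lset (F :: 'k form) m" and nB: "B \<notin> lset F (m + 1)" and C: "C \<in> lset F (m + 1)"
  obtains N where "adj B N" "N \<in> lset F (m + 1)"
proof -
  from subsetD[OF lset_subset B] obtain a r where Ba: "B = cball_val a r" by (rule verticesE)
  from subsetD[OF lset_subset C] obtain a' r' where Ca: "C = cball_val a' r'" by (rule verticesE)
  obtain g t b where F: "F = (g, t, b)" by (cases F)
  have B': "vge (m - r) g" "vge (m + r) (feval F a)"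
    using B by (auto simp: Ba F cball_val_in_lset)
  have C': "vge (m + 1 - r') g" "vge (m + 1) t" "vge (m + 1 + r') (feval F a')"
    using C by (auto simp: Ca F cball_val_in_lset)
  show ?thesis
  proof (cases "vge (m - r + 1) g")
    case False
    obtain z0 where z0: "vge r z0" "vge (m + r + 1) (g * z0\<^sup>2 + t * z0 + feval F a)"
      using step_down_coefficient[OF B'(1) False C'(2) B'(2)] .
    define a0 where "a0 = a + z0"
    have c0: "vge (m + r + 1) (feval F a0)" using z0(2) by (simp only: a0_def F feval_shift)
    have "vge r (a0 - a)" using z0 by (simp add: a0_def)
    then have adj: "adj B (cball_val a0 (r + 1))" unfolding Ba adj_cball_iff by blast
    show ?thesis
    proof (cases "vge (m + r + 2) (feval F a0)")
      case True
      then have "cball_val a0 (r + 1) \<in> lset F (m + 1)"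
        using B' C' by (simp add: F cball_val_in_lset add.assoc del: feval.simps) (simp add: ac_simps)
      then show ?thesis using adj that by blast
    next
      case c0n: False
      \<comment> \<open>Eisenstein case: \<nu>(g) = m - r, \<nu>(f(a0)) = m + r + 1 and \<nu>(t) >
        m. The term g z^2 dominates for \<nu>(z) \<le> r and f(a0) otherwise, so the value of f at
        a' stays below the bound m + r + 2 that level m + 1 at C requires.\<close>
      define z where "z = a' + a0"
      have "a' = a0 + z" by (simp add: z_def char2_simps)
      then have fz: "feval F a' = g * z\<^sup>2 + t * z + feval F a0" by (simp only: F feval_shift)
      have r': "r + 1 \<le> r'"
      proof (rule ccontr)
        assume "\<not> r + 1 \<le> r'"
        then show False using C'(1) False vge_mono[of "m + 1 - r'" g "m - r + 1"] by simp
      qed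
      then have fa: "vge (m + r + 2) (g * z\<^sup>2 + t * z + feval F a0)"
        using C'(3) vge_mono[of "m + 1 + r'" _ "m + r + 2"] by (simp add: fz)
      show ?thesis
      proof (cases "vge (r + 1) z")
        case True
        then have "vge (2 * (r + 1)) (z\<^sup>2)" by (simp only: vge_square)
        then have "vge (m + r + 2) (g * z\<^sup>2 + t * z)"
          using B' C' True by (intro vge_add) (auto intro: vge_mult')
        then have "vge (m + r + 2) (feval F a0)" using fa vge_add_cancel(2) by blast
        then show ?thesis using c0n by simp
      next
        case nz: False
        define s where "s = fls_subdegree z"
        have s: "vge s z" "\<not> vge (s + 1) z" "s \<le> r" using nz by (auto simp: s_def vge_def)
        have "vge (m - r + 2 * s + 1) (t * z + feval F a0)"
          using C'(2) s c0 by (intro vge_add) (auto intro: vge_mult' vge_mono)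
        then have "\<not> vge (m + r + 2) (g * z\<^sup>2 + t * z + feval F a0)"
          using s by (intro not_vge_dominant[OF False s(1,2)]) auto
        then show ?thesis using fa by simp
      qed
    qed
  next
    \<comment> \<open>The reduced form is a constant, a square with its zero at infinity. So the
      direction to try is the larger ball, and the argument runs as before with the two outer
      coefficients exchanged.\<close>
    case True
    have nc: "\<not> vge (m + r + 1) (feval F a)"
      using nB True C'(2) by (auto simp: Ba F cball_val_in_lset algebra_simps simp del: feval.simps)
    have adj: "adj B (cball_val a (r - 1))" unfolding Ba adj_cball_iff by blast
    show ?thesis
    proof (cases "vge (m - r + 2) g")
      case True
      then have "cball_val a (r - 1) \<in> lset F (m + 1)"
        using B' C' by (auto simp: F cball_val_in_lset algebra_simps simp del: feval.simps)
      then show ?thesis using adj that by blast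
    next
      case gn: False
      define z where "z = a' + a"
      have "a' = a + z" by (simp add: z_def char2_simps)
      then have fz: "feval F a' = g * z\<^sup>2 + t * z + feval F a" by (simp only: F feval_shift)
      have r': "r \<le> r'"
      proof (rule ccontr)
        assume "\<not> r \<le> r'"
        then show False using C'(1) gn vge_mono[of "m + 1 - r'" g "m - r + 2"] by simp
      qed
      then have fa: "vge (m + r + 1) (g * z\<^sup>2 + t * z + feval F a)"
        using C'(3) vge_mono[of "m + 1 + r'" _ "m + r + 1"] by (simp add: fz)
      show ?thesis
      proof (cases "vge r z")
        case vz: True
        then have "vge (2 * r) (z\<^sup>2)" by (simp add: vge_square)
        then have "vge (m + r + 1) (g * z\<^sup>2 + t * z)"
          using True C' vz by (intro vge_add) (auto intro: vge_mult')
        then have "vge (m + r + 1) (feval F a)" using fa vge_add_cancel(2) by blast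
        then show ?thesis using nc by simp
      next
        case nz: False
        define s where "s = fls_subdegree z"
        have s: "vge s z" "\<not> vge (s + 1) z" "s + 1 \<le> r" using nz by (auto simp: s_def vge_def)
        have "vge (m - r + 1 + 2 * s + 1) (t * z + feval F a)"
          using C'(2) s B' by (intro vge_add) (auto intro: vge_mult' vge_mono)
        moreover have "\<not> vge (m - r + 1 + 1) g" using gn by (simp add: add.assoc)
        ultimately have "\<not> vge (m + r + 1) (g * z\<^sup>2 + t * z + feval F a)"
          using s by (intro not_vge_dominant[of "m - r + 1" g s z "m - r + 1 + 2 * s + 1"]) auto
        then show ?thesis using fa by simp
      qed
    qed
  qed
qed

text \<open>As long as the level is below M some edge raises it, because the nonempty set of level M
  shows that it is not yet maximal.\<close>

lemma lset_near:
  assumes "lset (F :: 'k form) M \<noteq> {}" "B \<in> lset F (M - int k)"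
  shows "\<exists>C\<in>lset F M. tree_dist B C \<le> k"
  using assms(2)
proof (induction k arbitrary: B)
  case 0
  then show ?case by (intro bexI[of _ B]) auto
next
  case (Suc k)
  obtain D where D: "D \<in> lset F M" using assms(1) by blast
  then have "D \<in> lset F (M - int k)" using lset_mono[of "M - int k" M F] by auto
  have "\<exists>N. tree_dist B N \<le> 1 \<and> N \<in> lset F (M - int k)"
  proof (cases "B \<in> lset F (M - int k)")
    case False
    then obtain N where "adj B N" "N \<in> lset F (M - int k)"
      using lset_step_up[of B F "M - int (Suc k)" D] Suc.prems \<open>D \<in> lset F (M - int k)\<close>
      by (auto simp: algebra_simps)
    then show ?thesis using tree_dist_adj by force
  qed (auto intro: exI[of _ B])
  then obtain N C where NC: "tree_dist B N \<le> 1" "N \<in> lset F (M - int k)" "C \<in> lset F M" "tree_dist N C \<le> k"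
    using Suc.IH by blast
  then have "tree_dist B C \<le> Suc k"
    using tree_dist_triangle[of B N C] lset_subset Suc.prems by fastforce
  then show ?case using NC by blast
qed

lemma thicken_lset:
  assumes "lset (F :: 'k form) M \<noteq> {}"
  shows "thicken (lset F M) n = lset F (M - int n)"
proof (intro equalityI subsetI)
  fix B assume "B \<in> thicken (lset F M) n"
  then obtain C where "B \<in> vertices" "C \<in> lset F M" "tree_dist B C \<le> n" by (auto simp: thicken_def)
  then show "B \<in> lset F (M - int n)"
    using lset_dist[of C F M B] lset_mono[of "M - int n" "M - int (tree_dist B C)" F] by auto
next
  fix B assume "B \<in> lset F (M - int n)"
  then show "B \<in> thicken (lset F M) n"
    using lset_near[OF assms] lset_subset by (fastforce simp: thicken_def)
qed

section \<open>The resultant of two forms and their common levels\<close>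

lemma res_commute: "res F1 F2 = res F2 (F1 :: 'k form)"
  by (cases F1; cases F2) (simp add: char2_simps)

text \<open>Translation invariance of the resultant, by which the centre of any given ball may be
  taken as origin.\<close>

lemma res_shift:
  "res (g1, t1, b1) (g2, t2, b2) =
   res (g1, t1, feval (g1, t1, b1) a) (g2, t2, feval (g2, t2, b2) (a :: 'k fls))"
  by (simp add: char2_simps)

text \<open>Every term of the resultant contains as many constant terms as leading coefficients, so
  the bounds m - r and m + r combine and the radius exponent cancels.\<close>

lemma res_vge:
  assumes "B \<in> lset (F1 :: 'k form) m1" "B \<in> lset F2 m2"
  shows "vge (2 * (m1 + m2)) (res F1 F2)"
proof -
  from subsetD[OF lset_subset assms(1)] obtain a r where B: "B = cball_val a r" by (rule verticesE)
  obtain g1 t1 b1 where F1: "F1 = (g1, t1, b1)" by (cases F1)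
  obtain g2 t2 b2 where F2: "F2 = (g2, t2, b2)" by (cases F2)
  define c1 where "c1 = feval F1 a"
  define c2 where "c2 = feval F2 a"
  have h1: "vge (m1 - r) g1" "vge m1 t1" "vge (m1 + r) c1"
    using assms(1) by (auto simp: B F1 c1_def cball_val_in_lset)
  have h2: "vge (m2 - r) g2" "vge m2 t2" "vge (m2 + r) c2"
    using assms(2) by (auto simp: B F2 c2_def cball_val_in_lset)
  have "vge (m1 + m2) (g1 * c2 + g2 * c1)"
    using h1 h2 by (intro vge_add) (auto intro: vge_mult')
  then have "vge (2 * (m1 + m2)) ((g1 * c2 + g2 * c1)\<^sup>2)" by (simp only: vge_square)
  moreover have "vge (m1 + m2 - r) (g1 * t2 + g2 * t1)" "vge (m1 + m2 + r) (t1 * c2 + t2 * c1)"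
    using h1 h2 by (auto intro!: vge_add intro: vge_mult')
  then have "vge (2 * (m1 + m2)) ((g1 * t2 + g2 * t1) * (t1 * c2 + t2 * c1))"
    by (auto intro: vge_mult')
  ultimately have "vge (2 * (m1 + m2)) (res (g1, t1, c1) (g2, t2, c2))" by (simp add: vge_add)
  then show ?thesis using res_shift[of g1 t1 b1 g2 t2 b2 a] by (simp only: c1_def c2_def F1 F2)
qed

text \<open>The edge is a common zero of the two reduced forms: the larger ball bounds the leading
  coefficients, the smaller one the constant terms, so that each product gains one.\<close>

lemma res_vge_adj:
  assumes "adj B C" "B \<in> lset (F1 :: 'k form) m1" "B \<in> lset F2 m2" "C \<in> lset F1 m1" "C \<in> lset F2 m2"
  shows "vge (2 * (m1 + m2) + 1) (res F1 F2)"
proof -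
  obtain a r where BC: "B = cball_val a (r + 1) \<and> C = cball_val a r \<or> B = cball_val a r \<and> C = cball_val a (r + 1)"
    using assms(1) by (auto simp: adj_iff)
  obtain g1 t1 b1 where F1: "F1 = (g1, t1, b1)" by (cases F1)
  obtain g2 t2 b2 where F2: "F2 = (g2, t2, b2)" by (cases F2)
  define c1 where "c1 = feval F1 a"
  define c2 where "c2 = feval F2 a"
  have "cball_val a r \<in> lset F1 m1" "cball_val a (r+1) \<in> lset F1 m1"
    "cball_val a r \<in> lset F2 m2" "cball_val a (r+1) \<in> lset F2 m2" using BC assms by auto
  then have h: "vge (m1 - r) g1" "vge m1 t1" "vge (m1 + r + 1) c1" "vge (m2 - r) g2" "vge m2 t2" "vge (m2 + r + 1) c2"
    by (auto simp: F1 F2 c1_def c2_def cball_val_in_lset add.assoc)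
  have "vge (m1 + m2 + 1) (g1 * c2 + g2 * c1)"
    using h by (intro vge_add) (auto intro: vge_mult')
  then have "vge (2 * (m1 + m2 + 1)) ((g1 * c2 + g2 * c1)\<^sup>2)" by (simp only: vge_square)
  then have "vge (2 * (m1 + m2) + 1) ((g1 * c2 + g2 * c1)\<^sup>2)" by (rule vge_mono) simp
  moreover have "vge (m1 + m2 - r) (g1 * t2 + g2 * t1)" "vge (m1 + m2 + r + 1) (t1 * c2 + t2 * c1)"
    using h by (auto intro!: vge_add intro: vge_mult')
  then have "vge (2 * (m1 + m2) + 1) ((g1 * t2 + g2 * t1) * (t1 * c2 + t2 * c1))"
    by (auto intro: vge_mult')
  ultimately have "vge (2 * (m1 + m2) + 1) (res (g1, t1, c1) (g2, t2, c2))" by (simp add: vge_add)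
  then show ?thesis using res_shift[of g1 t1 b1 g2 t2 b2 a] by (simp only: c1_def c2_def F1 F2)
qed

text \<open>Modulo \<open>\<pi>\<close> the first form is the square of a linear form with zero in the direction of \<open>C\<close>,
  which is not a zero of the second form.\<close>
lemma res_exact:
  assumes "adj B C" "B \<in> lset (F1 :: 'k form) m1" "B \<notin> lset F1 (m1 + 1)" "C \<in> lset F1 m1" "vge (m1 + 1) (mid F1)"
    "B \<in> lset F2 m2" "C \<notin> lset F2 m2"
  shows "\<not> vge (2 * (m1 + m2) + 1) (res F1 F2)"
proof
  assume R: "vge (2 * (m1 + m2) + 1) (res F1 F2)"
  obtain a r where BC: "B = cball_val a (r + 1) \<and> C = cball_val a r \<or> B = cball_val a r \<and> C = cball_val a (r + 1)"
    using assms(1) by (auto simp: adj_iff)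
  obtain g1 t1 b1 where F1: "F1 = (g1, t1, b1)" by (cases F1)
  obtain g2 t2 b2 where F2: "F2 = (g2, t2, b2)" by (cases F2)
  define c1 where "c1 = feval F1 a"
  define c2 where "c2 = feval F2 a"
  have lev1: "cball_val a s \<in> lset F1 m \<longleftrightarrow> vge (m - s) g1 \<and> vge m t1 \<and> vge (m + s) c1" for s m
    by (simp add: F1 c1_def cball_val_in_lset)
  have lev2: "cball_val a s \<in> lset F2 m \<longleftrightarrow> vge (m - s) g2 \<and> vge m t2 \<and> vge (m + s) c2" for s m
    by (simp add: F2 c2_def cball_val_in_lset)
  have t1: "vge (m1 + 1) t1" using assms(5) by (simp add: F1)
  have R': "vge (2 * (m1 + m2) + 1) ((g1 * c2 + g2 * c1)\<^sup>2 + (g1 * t2 + g2 * t1) * (t1 * c2 + t2 * c1))"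
    using R res_shift[of g1 t1 b1 g2 t2 b2 a] by (simp only: c1_def c2_def F1 F2 res.simps)
  \<comment> \<open>Once the mixed product satisfies the odd bound, so does the square, and parity
    then improves its bound by one.\<close>
  have sq: "vge (m1 + m2 + 1) (g1 * c2 + g2 * c1)"
    if "vge (2 * (m1 + m2) + 1) ((g1 * t2 + g2 * t1) * (t1 * c2 + t2 * c1))"
  proof -
    have "vge (2 * (m1 + m2) + 1) ((g1 * c2 + g2 * c1)\<^sup>2)"
      using R' that vge_add_cancel(1) by blast
    then have "vge (2 * (m1 + m2 + 1) - 1) ((g1 * c2 + g2 * c1)\<^sup>2)" by (simp add: algebra_simps)
    then show ?thesis by (simp only: vge_square_odd)
  qed
  from BC show False
  proof
    assume "B = cball_val a (r + 1) \<and> C = cball_val a r"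
    then have B: "B = cball_val a (r + 1)" and C: "C = cball_val a r" by auto
    have h1: "vge (m1 - r) g1" "vge (m1 + r + 1) c1" "\<not> vge (m1 + r + 2) c1"
      using assms(2-4) t1 unfolding B C lev1 by (auto simp: algebra_simps)
    have h2: "vge (m2 - r - 1) g2" "\<not> vge (m2 - r) g2" "vge m2 t2" "vge (m2 + r + 1) c2"
      using assms(6,7) unfolding B C lev2 by (auto simp: algebra_simps intro: vge_mono)
    have "vge (m1 + m2 - r) (g1 * t2 + g2 * t1)" "vge (m1 + m2 + r + 1) (t1 * c2 + t2 * c1)"
      using h1 h2 t1 by (auto intro!: vge_add intro: vge_mult')
    then have "vge (m1 + m2 + 1) (g1 * c2 + g2 * c1)" by (intro sq) (auto intro: vge_mult')
    moreover have "vge (m1 + m2 + 1) (g1 * c2)" using h1 h2 by (auto intro: vge_mult')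
    ultimately have "vge (m1 + m2 + 1) (g2 * c1)" using vge_add_cancel(2) by blast
    then show False using not_vge_mult[of "m2 - r - 1" g2 "m1 + r + 1" c1 "m1 + m2 + 1"] h1 h2
      by (simp add: add.assoc)
  next
    assume "B = cball_val a r \<and> C = cball_val a (r + 1)"
    then have B: "B = cball_val a r" and C: "C = cball_val a (r + 1)" by auto
    have h1: "vge (m1 - r) g1" "vge (m1 + r + 1) c1" "\<not> vge (m1 - r + 1) g1"
      using assms(2-4) t1 unfolding B C lev1 by (auto simp: algebra_simps)
    have h2: "vge (m2 - r) g2" "\<not> vge (m2 + r + 1) c2" "vge m2 t2" "vge (m2 + r) c2"
      using assms(6,7) unfolding B C lev2 by (auto simp: algebra_simps intro: vge_mono)
    have "vge (m1 + m2 - r) (g1 * t2 + g2 * t1)" "vge (m1 + m2 + r + 1) (t1 * c2 + t2 * c1)"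
      using h1 h2 t1 by (auto intro!: vge_add intro: vge_mult')
    then have "vge (m1 + m2 + 1) (g1 * c2 + g2 * c1)" by (intro sq) (auto intro: vge_mult')
    moreover have "vge (m1 + m2 + 1) (g2 * c1)" using h1 h2 by (auto intro: vge_mult')
    ultimately have "vge (m1 + m2 + 1) (g1 * c2)" using vge_add_cancel(1) by blast
    then show False using not_vge_mult[of "m1 - r" g1 "m2 + r" c2 "m1 + m2 + 1"] h1 h2
      by (simp add: add.assoc)
  qed
qed

text \<open>For a closest pair at distance k the second form has exact level M2 - k at B and a
  higher one at the next vertex B' towards C, while B' lies outside the first set. This is the
  situation of \<open>res_exact\<close> with the two forms exchanged.\<close>

lemma disjoint_lsets:
  assumes ne: "lset (F1 :: 'k form) M1 \<noteq> {}" "lset F2 M2 \<noteq> {}" and disj: "lset F1 M1 \<inter> lset F2 M2 = {}"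
  obtains B C where "B \<in> lset F1 M1" "C \<in> lset F2 M2" "0 < tree_dist B C"
    "\<And>B' C'. B' \<in> lset F1 M1 \<Longrightarrow> C' \<in> lset F2 M2 \<Longrightarrow> tree_dist B C \<le> tree_dist B' C'"
    "vge (2 * (M1 + M2 - int (tree_dist B C))) (res F1 F2)"
    "\<not> vge (2 * (M1 + M2 - int (tree_dist B C)) + 1) (res F1 F2)"
proof -
  define P where "P n \<longleftrightarrow> (\<exists>B\<in>lset F1 M1. \<exists>C\<in>lset F2 M2. tree_dist B C = n)" for n
  have "\<exists>n. P n" using ne by (auto simp: P_def)
  then have "P (LEAST n. P n)" by (rule LeastI_ex)
  then obtain B C where BC: "B \<in> lset F1 M1" "C \<in> lset F2 M2" "tree_dist B C = (LEAST n. P n)"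
    by (auto simp: P_def)
  have least: "tree_dist B C \<le> tree_dist B' C'" if "B' \<in> lset F1 M1" "C' \<in> lset F2 M2" for B' C'
    unfolding BC(3) using that by (intro Least_le) (auto simp: P_def)
  have V: "B \<in> vertices" "C \<in> vertices" using BC subsetD[OF lset_subset] by blast+
  have "B \<noteq> C" using BC disj by auto
  then obtain B' where B': "adj B B'" "tree_dist B C = Suc (tree_dist B' C)" using tree_dist_step V by metis
  define k where "k = int (tree_dist B C)"
  have "B' \<notin> lset F1 M1" using least[of B' C] BC(2) B'(2) by auto
  have "B \<in> lset F2 (M2 - k)" using lset_dist[OF BC(2) V(1)] by (simp add: k_def)
  have "B' \<in> lset F2 (M2 - k + 1)"
    using lset_dist[OF BC(2) adj_vertices(2)[OF B'(1)]] B'(2) by (simp add: k_def algebra_simps)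
  have "B \<notin> lset F2 (M2 - k + 1)"
  proof
    assume "B \<in> lset F2 (M2 - k + 1)"
    then have "B \<in> lset F2 (M2 - int (tree_dist B' C))" using B'(2) by (simp add: k_def algebra_simps)
    then obtain D where "D \<in> lset F2 M2" "tree_dist B D \<le> tree_dist B' C" using lset_near[OF ne(2)] by blast
    then show False using least[of B D] BC(1) B'(2) by simp
  qed
  \<comment> \<open>The bound on the middle coefficient is the same at all vertices, so it can be
    taken from B'.\<close>
  have "vge (M2 - k + 1) (mid F2)"
    using \<open>B' \<in> lset F2 (M2 - k + 1)\<close> by (cases F2) (auto simp: lset_def)
  have "B' \<in> lset F2 (M2 - k)" using \<open>B' \<in> lset F2 (M2 - k + 1)\<close> lset_mono[of "M2 - k" "M2 - k + 1" F2] by auto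
  have "\<not> vge (2 * ((M2 - k) + M1) + 1) (res F2 F1)"
    by (rule res_exact[of B B']) fact+
  then have "\<not> vge (2 * (M1 + M2 - k) + 1) (res F1 F2)" by (simp add: res_commute[of F2 F1] algebra_simps)
  moreover have "vge (2 * (M1 + M2 - k)) (res F1 F2)"
    using res_vge[OF BC(1) \<open>B \<in> lset F2 (M2 - k)\<close>] by (simp add: algebra_simps)
  ultimately show ?thesis using that[OF BC(1,2)] least B'(2) by (simp add: k_def)
qed

end

section \<open>Vertices, edges and horoballs\<close>

context finite_char2
begin

section \<open>Stems consisting of a vertex or an edge\<close>

text \<open>If z = y - x had valuation below r, the term g z^2, of valuation at most n + 2r - 2,
  would dominate; this is where the bound n + 2r - 1 comes from.\<close>

lemma feval_close:
  fixes g t b x y :: "'k fls"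
  assumes g: "\<not> vge (n + 1) g" and t: "vge (n + r) t"
    and x: "vge (n + 2 * r - 1) (feval (g, t, b) x)" and y: "vge (n + 2 * r - 1) (feval (g, t, b) y)"
  shows "vge r (y - x)"
proof (rule ccontr)
  define z where "z = y + x"
  assume "\<not> vge r (y - x)"
  then have nz: "\<not> vge r z" by (simp add: z_def char2_simps)
  have "y = x + z" by (simp add: z_def char2_simps)
  then have fy: "feval (g, t, b) y = g * z\<^sup>2 + t * z + feval (g, t, b) x" by (simp only: feval_shift)
  define s where "s = fls_subdegree z"
  have s: "vge s z" "\<not> vge (s + 1) z" "s + 1 \<le> r" using nz by (auto simp: s_def vge_def)
  have "vge (n + 2 * s + 1) (t * z + feval (g, t, b) x)"
    using s by (intro vge_add vge_mult'[OF t s(1)] vge_mono[OF x]) auto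
  then have "\<not> vge (n + 2 * r - 1) (g * z\<^sup>2 + t * z + feval (g, t, b) x)"
    using s by (intro not_vge_dominant[OF g s(1,2)]) auto
  then show False using y unfolding fy by contradiction
qed

text \<open>The product of g and f(x) does not involve the radius. Level M needs r \<ge> M -
  \<nu>(g), and the maximality of the product leaves no room for a larger r; the centre is then
  determined by \<open>feval_close\<close>.\<close>

lemma point_lset:
  fixes g t b x0 :: "'k fls"
  assumes t: "vge M t" and g: "g \<noteq> 0" and x0: "vge (2 * M) (g * feval (g, t, b) x0)"
    and max: "\<And>x. \<not> vge (2 * M + 1) (g * feval (g, t, b) x)"
  shows "lset (g, t, b) M = {cball_val x0 (M - fls_subdegree g)}"
proof -
  define F where "F = (g, t, b)"
  define n where "n = fls_subdegree g"
  have ng: "vge n g" "\<not> vge (n + 1) g" using g by (auto simp: n_def vge_def)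
  have fx0: "vge (2 * M - n) (feval F x0)"
    using x0 not_vge_mult[OF ng(2), of "2 * M - n - 1" "feval F x0" "2 * M"] by (auto simp: F_def simp del: feval.simps)
  have mem: "r = M - n \<and> vge r (a - x0)" if "lev F a r M" for a r
  proof -
    have h: "vge (M - r) g" "vge (M + r) (feval F a)" using that by (auto simp: F_def)
    have "M - r \<le> n" using h(1) g by (simp add: vge_def n_def)
    moreover have "r \<le> M - n"
    proof (rule ccontr)
      assume "\<not> r \<le> M - n"
      then have "vge (2 * M + 1) (g * feval F a)" using vge_mult'[OF ng(1) h(2)] by simp
      then show False using max by (simp add: F_def)
    qed
    ultimately have r: "r = M - n" by simp
    have "vge r (a - x0)"
      using ng(2) by (rule feval_close[of n g r t b])
        (use t fx0 h r in \<open>auto simp: F_def simp del: feval.simps intro: vge_mono\<close>)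
    then show ?thesis using r by simp
  qed
  have "lset F M = {cball_val x0 (M - n)}"
  proof (intro equalityI subsetI)
    fix B assume "B \<in> lset F M"
    then obtain a r where "B = cball_val a r" "lev F a r M" by (auto simp: lset_def)
    then show "B \<in> {cball_val x0 (M - n)}" using mem[of a r] by (auto simp: cball_val_eq_iff)
  next
    fix B assume "B \<in> {cball_val x0 (M - n)}"
    moreover have "lev F x0 (M - n) M" using t ng fx0 by (auto simp: F_def algebra_simps simp del: feval.simps)
    ultimately show "B \<in> lset F M" by (auto simp: cball_val_in_lset)
  qed
  then show ?thesis by (simp only: F_def n_def)
qed

text \<open>One unit of slack in the bound on the product leaves two consecutive radii around the
  same centre.\<close>

lemma edge_lset:
  fixes g t b x0 :: "'k fls"
  assumes t: "vge (M + 1) t" and g: "g \<noteq> 0" and x0: "vge (2 * M + 1) (g * feval (g, t, b) x0)"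
    and max: "\<And>x. \<not> vge (2 * M + 2) (g * feval (g, t, b) x)"
  shows "lset (g, t, b) M =
    {cball_val x0 (M - fls_subdegree g), cball_val x0 (M - fls_subdegree g + 1)}"
proof -
  define F where "F = (g, t, b)"
  define n where "n = fls_subdegree g"
  have ng: "vge n g" "\<not> vge (n + 1) g" using g by (auto simp: n_def vge_def)
  have fx0: "vge (2 * M + 1 - n) (feval F x0)"
    using x0 not_vge_mult[OF ng(2), of "2 * M - n" "feval F x0" "2 * M + 1"]
    by (auto simp: F_def algebra_simps simp del: feval.simps)
  have mem: "(r = M - n \<or> r = M - n + 1) \<and> vge r (a - x0)" if "lev F a r M" for a r
  proof -
    have h: "vge (M - r) g" "vge (M + r) (feval F a)" using that by (auto simp: F_def)
    have "M - r \<le> n" using h(1) g by (simp add: vge_def n_def)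
    moreover have "r \<le> M - n + 1"
    proof (rule ccontr)
      assume "\<not> r \<le> M - n + 1"
      then have "vge (2 * M + 2) (g * feval F a)" using vge_mult'[OF ng(1) h(2)] by simp
      then show False using max by (simp add: F_def)
    qed
    ultimately have r: "r = M - n \<or> r = M - n + 1" by linarith
    have "vge r (a - x0)"
      using ng(2) by (rule feval_close[of n g r t b])
        (use t fx0 h r in \<open>auto simp: F_def simp del: feval.simps intro: vge_mono\<close>)
    then show ?thesis using r by simp
  qed
  have "lset F M \<subseteq> {cball_val x0 (M - n), cball_val x0 (M - n + 1)}"
  proof
    fix B assume "B \<in> lset F M"
    then obtain a r where "B = cball_val a r" "lev F a r M" by (auto simp: lset_def)
    then show "B \<in> {cball_val x0 (M - n), cball_val x0 (M - n + 1)}"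
      using mem[of a r] by (auto simp: cball_val_eq_iff)
  qed
  moreover have "lev F x0 (M - n) M" "lev F x0 (M - n + 1) M"
    using vge_mono[OF t, of M] ng vge_mono[OF ng(1), of "n - 1"] fx0 vge_mono[OF fx0, of "2 * M - n"]
    by (auto simp: F_def algebra_simps simp del: feval.simps)
  then have "{cball_val x0 (M - n), cball_val x0 (M - n + 1)} \<subseteq> lset F M"
    by (auto simp: cball_val_in_lset)
  ultimately have "lset F M = {cball_val x0 (M - n), cball_val x0 (M - n + 1)}" by (rule equalityI)
  then show ?thesis by (simp only: F_def n_def)
qed

lemma lset_empty:
  fixes g t b :: "'k fls"
  assumes "\<And>x. \<not> vge (2 * m) (g * feval (g, t, b) x)"
  shows "lset (g, t, b) m = {}"
proof (rule ccontr)
  assume "lset (g, t, b) m \<noteq> {}"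
  then obtain a r where "vge (m - r) g" "vge (m + r) (feval (g, t, b) a)" by (auto simp: lset_def)
  then have "vge (2 * m) (g * feval (g, t, b) a)" by (auto intro: vge_mult')
  then show False using assms by blast
qed

text \<open>The resultant tells whether both ends of the edge lie in the other set: a common edge
  raises its valuation by \<open>res_vge_adj\<close>, an edge that leaves the other set makes it
  minimal by \<open>res_exact\<close>.\<close>

lemma edge_intersection:
  assumes S1: "lset (F1 :: 'k form) M1 = {B, C}" and adj: "adj B C" and max: "lset F1 (M1 + 1) = {}"
    and mid: "vge (M1 + 1) (mid F1)" and ne: "lset F1 M1 \<inter> lset F2 M2 \<noteq> {}"
  shows "is_line (lset F1 M1 \<inter> lset F2 M2) (Fin_length 0) \<and>
           \<not> vge (2 * (M1 + M2) + 1) (res F1 F2) \<or>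
         is_line (lset F1 M1 \<inter> lset F2 M2) (Fin_length 1) \<and>
           vge (2 * (M1 + M2) + 1) (res F1 F2)"
proof -
  have *: "is_line (lset F1 M1 \<inter> lset F2 M2) (Fin_length 0) \<and> \<not> vge (2 * (M1 + M2) + 1) (res F1 F2)"
    if "lset F1 M1 = {B, C}" "adj B C" "B \<in> lset F2 M2" "C \<notin> lset F2 M2" for B C
  proof -
    have eq: "lset F1 M1 \<inter> lset F2 M2 = {B}" unfolding that(1) using that(3,4) by auto
    have "is_line {B} (Fin_length 0)" using adj_vertices(1)[OF that(2)] by (rule is_line_singleton)
    moreover have "\<not> vge (2 * (M1 + M2) + 1) (res F1 F2)"
    proof (rule res_exact[OF that(2)])
      show "B \<in> lset F1 M1" "C \<in> lset F1 M1" by (simp_all add: that(1))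
      show "B \<notin> lset F1 (M1 + 1)" using max by blast
      show "vge (M1 + 1) (mid F1)" by (rule mid)
    qed (rule that(3), rule that(4))
    ultimately show ?thesis unfolding eq by (rule conjI)
  qed
  consider "B \<in> lset F2 M2" "C \<notin> lset F2 M2" | "C \<in> lset F2 M2" "B \<notin> lset F2 M2"
    | "B \<in> lset F2 M2" "C \<in> lset F2 M2" using ne unfolding S1 by auto
  then show ?thesis
  proof cases
    case 1
    show ?thesis by (rule disjI1) (rule *[OF S1 adj 1])
  next
    case 2
    have S1': "lset F1 M1 = {C, B}" unfolding S1 by (rule insert_commute)
    show ?thesis by (rule disjI1) (rule *[OF S1' adj_sym[OF adj] 2])
  next
    case 3
    have eq: "lset F1 M1 \<inter> lset F2 M2 = {B, C}" unfolding S1 using 3 by auto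
    have BC: "B \<in> lset F1 M1" "C \<in> lset F1 M1" by (simp_all add: S1)
    have "vge (2 * (M1 + M2) + 1) (res F1 F2)"
      by (rule res_vge_adj[OF adj BC(1) 3(1) BC(2) 3(2)])
    then show ?thesis unfolding eq by (intro disjI2 conjI is_line_edge[OF adj])
  qed
qed

section \<open>Horoballs of forms with a double zero\<close>

text \<open>Forms with a double zero on the projective line over K, the second alternative being a
  double zero at infinity. They belong to the reducible inseparable polynomials.\<close>

definition horo :: "'k form \<Rightarrow> bool" where
  "horo F \<longleftrightarrow> (\<exists>g x. g \<noteq> 0 \<and> F = (g, 0, g * x\<^sup>2)) \<or> (\<exists>b. b \<noteq> 0 \<and> F = (0, 0, b))"

lemma horo_cases [consumes 1, case_names finite infinite]:
  assumes "horo F"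
  obtains g x where "g \<noteq> 0" "F = (g, 0, g * x\<^sup>2)" "\<And>a. feval F a = g * (a + x)\<^sup>2"
  | b where "b \<noteq> 0" "F = (0, 0, b)" "\<And>a. feval F a = b"
  using assms unfolding horo_def by (auto simp: square_add distrib_left)

text \<open>The ray runs towards the double zero; the shift by the valuation n of the nonzero
  coefficient makes the level at \<open>v k\<close> equal to k.\<close>

lemma horo_walk:
  assumes "horo F"
  obtains v where "nb_walk {0..} v" "\<And>k. 0 \<le> k \<Longrightarrow> v k \<in> lset F k"
    "\<And>B. B \<in> lset F 0 \<Longrightarrow> \<exists>k\<ge>0. int (tree_dist B (v k)) \<le> k"
  using assms
proof (cases rule: horo_cases)
  case (finite g x)
  define n where "n = fls_subdegree g"
  have ng: "vge n g" "\<not> vge (n + 1) g" using finite by (auto simp: n_def vge_def)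
  define v where "v k = cball_val x (k - n)" for k
  show ?thesis
  proof (rule that)
    show "nb_walk {0..} v"
      unfolding nb_walk_def v_def
    proof (intro conjI ballI allI impI)
      fix i :: int
      have "cball_val x (i + 1 - n) = cball_val x ((i - n) + 1)" by (simp add: algebra_simps)
      moreover have "adj (cball_val x (i - n)) (cball_val x ((i - n) + 1))" unfolding adj_iff by blast
      ultimately show "adj (cball_val x (i - n)) (cball_val x (i + 1 - n))" by simp
    qed (auto simp: cball_val_eq_iff)
    show "v k \<in> lset F k" if "0 \<le> k" for k
      using ng finite(3)[of x] by (simp add: v_def cball_val_in_lset finite(2) add_self del: feval.simps) 
    fix B assume "B \<in> lset F 0"
    then obtain a r where B: "B = cball_val a r" and lev: "vge (- r) g" "vge r (feval F a)"
      by (auto simp: lset_def finite(2))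
    have "- r \<le> n" using lev(1) finite(1) by (simp add: vge_def n_def)
    show "\<exists>k\<ge>0. int (tree_dist B (v k)) \<le> k"
    proof (cases "vge r (a - x)")
      case True
      then have "B = v (r + n)" by (simp add: B v_def cball_val_eq_iff)
      then show ?thesis using \<open>- r \<le> n\<close> by (intro exI[of _ "r + n"]) simp
    next
      case False
      \<comment> \<open>The path from B meets the ray at radius exponent s. Level 0 at B gives r
        \<le> n + 2s, so the distance r - s is at most the index s + n.\<close>
      define s where "s = fls_subdegree (a + x)"
      have "\<not> vge r (a + x)" using False by (simp add: diff_eq)
      then have ax: "a + x \<noteq> 0" "s < r" by (auto simp: s_def vge_def)
      have "r \<le> n + 2 * s" using lev(2) ax finite(1)
        by (auto simp: finite(3) vge_def power2_eq_square n_def s_def simp del: feval.simps)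
      have "join_level a r x s = s"
        using ax by (intro join_level_eqI) (auto simp: s_def diff_eq vge_subdegree)
      then have "int (tree_dist B (v (s + n))) = r - s"
        by (simp add: B v_def tree_dist_cball)
      then show ?thesis using \<open>r \<le> n + 2 * s\<close> ax by (intro exI[of _ "s + n"]) simp
    qed
  qed
next
  case (infinite b)
  define n where "n = fls_subdegree b"
  have nb: "vge n b" using infinite by (auto simp: n_def vge_def)
  define v :: "int \<Rightarrow> 'k fls set" where "v k = cball_val 0 (n - k)" for k
  show ?thesis
  proof (rule that)
    show "nb_walk {0..} v"
      unfolding nb_walk_def v_def
    proof (intro conjI ballI allI impI)
      fix i :: int
      have "cball_val (0 :: 'k fls) (n - i) = cball_val 0 ((n - (i + 1)) + 1)" by (simp add: algebra_simps)
      moreover have "adj (cball_val (0 :: 'k fls) ((n - (i + 1)) + 1)) (cball_val 0 (n - (i + 1)))"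
        unfolding adj_iff by blast
      ultimately show "adj (cball_val (0 :: 'k fls) (n - i)) (cball_val 0 (n - (i + 1)))" by simp
    qed (auto simp: cball_val_eq_iff)
    show "v k \<in> lset F k" if "0 \<le> k" for k
      using nb by (simp add: v_def cball_val_in_lset infinite(2))
    fix B assume "B \<in> lset F 0"
    then obtain a r where B: "B = cball_val a r" and lev: "vge r b"
      by (auto simp: lset_def infinite(2))
    have "r \<le> n" using lev infinite(1) by (simp add: vge_def n_def)
    \<comment> \<open>The ball of exponent j around B contains 0 and therefore lies on the ray; for
      a = 0 the default subdegree 0 does no harm.\<close>
    define j where "j = min r (fls_subdegree a)"
    have "vge j a" by (auto simp: j_def vge_def)
    then have "join_level a r 0 j = j" by (intro join_level_eqI) (auto simp: j_def)
    then have "int (tree_dist B (v (n - j))) = r - j"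
      by (simp add: B v_def tree_dist_cball)
    then show "\<exists>k\<ge>0. int (tree_dist B (v k)) \<le> k"
      using \<open>r \<le> n\<close> by (intro exI[of _ "n - j"]) (simp add: j_def)
  qed
qed

lemma horo_foliage: assumes "horo F" shows "infinite_foliage (lset F 0)"
proof -
  obtain v where v: "nb_walk {0..} v" "\<And>k. 0 \<le> k \<Longrightarrow> v k \<in> lset F k"
    "\<And>B. B \<in> lset F 0 \<Longrightarrow> \<exists>k\<ge>0. int (tree_dist B (v k)) \<le> k"
    using horo_walk[OF assms] by metis
  have "lset F 0 = (\<Union>n::nat. thicken {v (int n)} n)"
  proof (intro equalityI subsetI)
    fix B assume B: "B \<in> lset F 0"
    then obtain k where k: "k \<ge> 0" "int (tree_dist B (v k)) \<le> k" using v(3) by blast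
    then have "B \<in> thicken {v (int (nat k))} (nat k)"
      using subsetD[OF lset_subset B] by (simp add: thicken_def)
    then show "B \<in> (\<Union>n::nat. thicken {v (int n)} n)" by blast
  next
    fix B assume "B \<in> (\<Union>n::nat. thicken {v (int n)} n)"
    then obtain n where n: "B \<in> vertices" "tree_dist B (v (int n)) \<le> n" by (auto simp: thicken_def)
    then show "B \<in> lset F 0"
      using lset_dist[OF v(2)[of "int n"] n(1)] lset_mono[of 0 "int n - int (tree_dist B (v (int n)))" F] by auto
  qed
  then show ?thesis unfolding infinite_foliage_def using v(1) by blast
qed

lemma horo_nonempty: assumes "horo F" shows "lset F m \<noteq> {}"
proof -
  obtain v where v: "\<And>k. 0 \<le> k \<Longrightarrow> v k \<in> lset F k"
    using horo_walk[OF assms] by metis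
  have "v (max 0 m) \<in> lset F m" using v[of "max 0 m"] lset_mono[of m "max 0 m" F] by auto
  then show ?thesis by blast
qed

text \<open>For g (x + x0)^2 the numbers \<nu>(g) + r and \<nu>(f(a)) - r are of the same parity
  unless f(a) = 0, so the level never stays constant along an edge. For a constant form b it is
  \<nu>(b) - r.\<close>

lemma horo_parity:
  assumes "horo F" "adj B C" "B \<in> lset F m" "C \<in> lset F m"
  shows "B \<in> lset F (m + 1) \<or> C \<in> lset F (m + 1)"
proof -
  have *: "cball_val a (r + 1) \<in> lset F (m + 1) \<or> cball_val a r \<in> lset F (m + 1)"
    if "cball_val a (r + 1) \<in> lset F m" "cball_val a r \<in> lset F m" for a r
    using assms(1)
  proof (cases rule: horo_cases)
    case (finite g x)
    have h: "vge (m - r) g" "vge (m + r + 1) (g * (a + x)\<^sup>2)"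
      using that finite(3)[of a] by (auto simp: cball_val_in_lset finite(2) add.assoc simp del: feval.simps)
    show ?thesis
    proof (cases "vge (m + 1 - r) g")
      case True
      then show ?thesis using h finite(3)[of a]
        by (auto simp: cball_val_in_lset finite(2) ac_simps simp del: feval.simps)
    next
      case False
      then have "vge (r + 1) (a + x)"
        using h(2) not_vge_mult[of "m - r" g "2 * r" "(a + x)\<^sup>2" "m + r + 1"] vge_square_odd[of "r + 1" "a + x"]
        by (auto simp: algebra_simps)
      then have "vge (m - r + 2 * (r + 1)) (g * (a + x)\<^sup>2)" using h(1) vge_mult vge_square by blast
      then have "vge (m + 1 + (r + 1)) (g * (a + x)\<^sup>2)" by (simp add: algebra_simps)
      then show ?thesis using h finite(3)[of a]
        by (auto simp: cball_val_in_lset finite(2) algebra_simps simp del: feval.simps)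
    qed
  next
    case (infinite b)
    then show ?thesis using that by (auto simp: cball_val_in_lset algebra_simps)
  qed
  then show ?thesis using assms(2-4) by (auto simp: adj_iff)
qed

lemma horo_mid: "horo F \<Longrightarrow> mid F = 0"
  by (auto simp: horo_def)

lemma horo_feval: "horo F \<Longrightarrow> feval F (a + z) = fst F * z\<^sup>2 + feval F a"
  by (cases F) (auto simp: feval_shift simp del: feval.simps dest: horo_mid)

text \<open>Without middle terms the resultant is the square of \<open>g1 * b2 + g2 * b1\<close>. If
  it vanishes, the forms differ by a factor c and their level sets by the shift \<nu>(c).\<close>

lemma horo_nested:
  assumes "horo F1" "horo F2" "res F1 F2 = 0"
  shows "lset F1 0 \<subseteq> lset F2 0 \<or> lset F2 0 \<subseteq> lset F1 0"
proof -
  obtain g1 b1 where F1: "F1 = (g1, 0, b1)" "g1 \<noteq> 0 \<or> b1 \<noteq> 0" using assms(1) by (auto simp: horo_def)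
  obtain g2 b2 where F2: "F2 = (g2, 0, b2)" "g2 \<noteq> 0 \<or> b2 \<noteq> 0" using assms(2) by (auto simp: horo_def)
  have eq: "g1 * b2 = g2 * b1" using assms(3) by (auto simp: F1 F2 add_eq_0_iff_eq)
  obtain c where c: "c \<noteq> 0" "g2 = c * g1" "b2 = c * b1"
  proof (cases "g1 = 0")
    case True
    then have "b1 \<noteq> 0" "g2 = 0" using F1(2) eq by auto
    then show ?thesis using that[of "b2 / b1"] True F2(2) by auto
  next
    case False
    have "g2 \<noteq> 0" using False F2(2) eq by auto
    moreover have "b2 = (g2 / g1) * b1" using False eq by (simp add: field_simps)
    ultimately show ?thesis using that[of "g2 / g1"] False by simp
  qed
  define n where "n = fls_subdegree c"
  have scale: "vge m (c * x) \<longleftrightarrow> vge (m - n) x" for m x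
    using c(1) by (cases "x = 0") (auto simp: vge_def n_def)
  have "feval F2 a = c * feval F1 a" for a by (simp add: F1 F2 c algebra_simps)
  then have "lev F2 a r m \<longleftrightarrow> lev F1 a r (m - n)" for a r m
    by (simp add: F1(1) F2(1) c(2) scale algebra_simps del: feval.simps)
  then have eq: "lset F2 0 = lset F1 (- n)" by (simp add: lset_def)
  show ?thesis
  proof (cases "0 \<le> - n")
    case True
    then show ?thesis unfolding eq using lset_mono[of 0 "- n" F1] by (intro disjI2)
  next
    case False
    then show ?thesis unfolding eq using lset_mono[of "- n" 0 F1] by (intro disjI1) simp
  qed
qed

end

section \<open>Intersections of two stems\<close>

lemma adj_cball_Suc: "adj (cball_val a r) (cball_val a (r + 1))"
  unfolding adj_iff by blast

lemma nb_walk_segment: "nb_walk UNIV p \<Longrightarrow> i \<le> j \<Longrightarrow> is_line (p ` {i..j}) (Fin_length (nat (j - i)))"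
  unfolding is_line_def
proof (intro exI[of _ "\<lambda>k. p (i + k)"] conjI)
  assume "nb_walk UNIV p" "i \<le> j"
  then show "nb_walk (walk_indices (Fin_length (nat (j - i)))) (\<lambda>k. p (i + k))"
    by (simp add: nb_walk_def flip: add.assoc)
  show "p ` {i..j} = (\<lambda>k. p (i + k)) ` walk_indices (Fin_length (nat (j - i)))"
  proof -
    have "{i..j} = (\<lambda>k. i + k) ` {0..int (nat (j - i))}" using \<open>i \<le> j\<close> by simp
    then show ?thesis by (simp only: image_image walk_indices.simps)
  qed
qed

lemma nb_walk_ray: "nb_walk UNIV p \<Longrightarrow> is_line (p ` {i..}) Inf_length"
  unfolding is_line_def
proof (intro exI[of _ "\<lambda>k. p (i + k)"] conjI)
  assume "nb_walk UNIV p"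
  then show "nb_walk (walk_indices Inf_length) (\<lambda>k. p (i + k))"
    by (simp add: nb_walk_def flip: add.assoc)
  show "p ` {i..} = (\<lambda>k. p (i + k)) ` walk_indices Inf_length"
  proof -
    have "{i..} = (\<lambda>k. i + k) ` {0..}" by simp
    then show ?thesis by (simp only: image_image walk_indices.simps)
  qed
qed

lemma nb_walk_uminus: assumes "nb_walk UNIV p" shows "nb_walk UNIV (\<lambda>i. p (- i))"
proof -
  have p: "p i \<in> vertices" "adj (p i) (p (i + 1))" "p i \<noteq> p (i + 2)" for i
    using assms by (auto simp: nb_walk_def)
  have "adj (p (- i)) (p (- (i + 1)))" for i using adj_sym[OF p(2)[of "- (i + 1)"]] by simp
  moreover have "p (- i) \<noteq> p (- (i + 2))" for i using p(3)[of "- (i + 2)"] by simp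
  ultimately show ?thesis using p(1) unfolding nb_walk_def by simp
qed

lemma nb_walk_ray': assumes "nb_walk UNIV p" shows "is_line (p ` {..j}) Inf_length"
proof -
  have "{..j} = uminus ` {- j..}" by simp
  then have "p ` {..j} = (\<lambda>i. p (- i)) ` {- j..}" by (simp only: image_image)
  then show ?thesis using nb_walk_ray[OF nb_walk_uminus[OF assms], of "- j"] by simp
qed

lemma nb_walk_line: "nb_walk UNIV p \<Longrightarrow> is_line (range p) Two_Inf_length"
  unfolding is_line_def by (intro exI[of _ p]) simp

text \<open>Vanishing of the 2x2 minors, which avoids naming a factor. For forms of matrices it
  amounts to commutation, see \<open>commute_iff_proportional\<close>.\<close>

fun proportional :: "'k::field form \<Rightarrow> 'k form \<Rightarrow> bool" where
  "proportional (g1, t1, b1) (g2, t2, b2) \<longleftrightarrow> g1 * t2 = g2 * t1 \<and> t1 * b2 = t2 * b1 \<and> g1 * b2 = g2 * b1"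

context finite_char2
begin

section \<open>Intersection of two horoballs\<close>

text \<open>The edge that raises the first form is taken. If the second form failed to have level m
  + 1 at its end, \<open>res_exact\<close> would bound the valuation of the resultant by 4m + 2,
  against 2 \<nu>(lam) \<ge> 4m + 4. By \<open>horo_parity\<close> the second level cannot remain at
  m.\<close>

lemma horo_pair_step:
  assumes h: "horo F1" "horo F2" and res: "res F1 F2 = lam\<^sup>2" "lam \<noteq> 0"
    and B: "B \<in> lset F1 m" "B \<in> lset F2 m" and nB: "B \<notin> lset F1 (m + 1)"
    and m: "2 * m + 2 \<le> fls_subdegree lam"
  shows "\<exists>N. adj B N \<and> N \<in> lset F1 (m + 1) \<and> N \<in> lset F2 (m + 1)"
proof -
  obtain C where "C \<in> lset F1 (m + 1)" using horo_nonempty[OF h(1)] by blast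
  then obtain N where N: "adj B N" "N \<in> lset F1 (m + 1)" using lset_step_up[OF B(1) nB] by metis
  have N1: "N \<in> lset F1 m" using N(2) lset_mono[of m "m + 1" F1] by auto
  have R: "vge (2 * (2 * m + 2)) (res F1 F2)"
    using m res by (simp only: vge_square) (simp add: vge_def)
  have mid: "vge k (mid F1)" for k using horo_mid[OF h(1)] by simp
  have "N \<in> lset F2 (m + 1)"
  proof (rule ccontr)
    assume n: "N \<notin> lset F2 (m + 1)"
    show False
    proof (cases "B \<in> lset F2 (m + 1)")
      case True
      have "\<not> vge (2 * (m + (m + 1)) + 1) (res F1 F2)"
        by (rule res_exact[OF N(1) B(1) nB N1 mid True n])
      then show False using vge_mono[OF R, of "2 * (m + (m + 1)) + 1"] by simp
    next
      case False
      then have n': "N \<notin> lset F2 m" using horo_parity[OF h(2) N(1) B(2)] n by blast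
      have "\<not> vge (2 * (m + m) + 1) (res F1 F2)"
        by (rule res_exact[OF N(1) B(1) nB N1 mid B(2) n'])
      then show False using vge_mono[OF R, of "2 * (m + m) + 1"] by simp
    qed
  qed
  then show ?thesis using N by blast
qed

text \<open>Each step raises whichever form is behind, without letting the other one fall below the
  new common level.\<close>

lemma horo_pair_near:
  assumes h: "horo F1" "horo F2" and res: "res F1 F2 = lam\<^sup>2" "lam \<noteq> 0"
    and m: "2 * m \<le> fls_subdegree lam"
    and B: "B \<in> lset F1 (m - int k) \<inter> lset F2 (m - int k)"
  shows "\<exists>C\<in>lset F1 m \<inter> lset F2 m. tree_dist B C \<le> k"
  using B
proof (induction k arbitrary: B)
  case 0
  then show ?case by (intro bexI[of _ B]) auto
next
  case (Suc k)
  have eq: "m - int (Suc k) + 1 = m - int k" by simp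
  have "\<exists>N. tree_dist B N \<le> 1 \<and> N \<in> lset F1 (m - int k) \<inter> lset F2 (m - int k)"
  proof (cases "B \<in> lset F1 (m - int k) \<inter> lset F2 (m - int k)")
    case False
    have "\<exists>N. adj B N \<and> N \<in> lset F1 (m - int k) \<and> N \<in> lset F2 (m - int k)"
    proof (cases "B \<in> lset F1 (m - int k)")
      case True
      then have "B \<notin> lset F2 (m - int (Suc k) + 1)" using False unfolding eq by blast
      then show ?thesis
        using horo_pair_step[OF h(2,1) _ res(2), of B "m - int (Suc k)"] Suc.prems m res(1)
        unfolding eq by (auto simp: res_commute[of F2 F1])
    next
      case False
      then have "B \<notin> lset F1 (m - int (Suc k) + 1)" unfolding eq .
      then show ?thesis
        using horo_pair_step[OF h res, of B "m - int (Suc k)"] Suc.prems m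
        unfolding eq by auto
    qed
    then show ?thesis using tree_dist_adj by force
  qed (auto intro: exI[of _ B])
  then obtain N C where NC: "tree_dist B N \<le> 1" "N \<in> lset F1 (m - int k)"
      "C \<in> lset F1 m \<inter> lset F2 m" "tree_dist N C \<le> k"
    using Suc.IH by blast
  have "B \<in> vertices" "N \<in> vertices" "C \<in> vertices"
    using NC Suc.prems subsetD[OF lset_subset] by blast+
  then have "tree_dist B C \<le> Suc k" using tree_dist_triangle[of B N C] NC by simp
  then show ?case using NC by blast
qed

text \<open>As the resultant is a square, g1 f2(x) + g2 f1(x) has the same valuation \<nu>(lam) for
  all x. The leading coefficients are bounded at the larger ball, the values at the smaller one, and
  this limits s - r.\<close>

lemma horo_pair_close:
  assumes h: "horo F1" "horo F2" and res: "res F1 F2 = lam\<^sup>2" "lam \<noteq> 0"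
    and m: "fls_subdegree lam \<le> 2 * m + 1" and r: "r \<le> s"
    and B: "cball_val a r \<in> lset F1 m" "cball_val a r \<in> lset F2 m"
    and C: "cball_val c s \<in> lset F1 m" "cball_val c s \<in> lset F2 m"
  shows "2 * m + s - r \<le> fls_subdegree lam" "vge r (c - a)"
proof -
  obtain g1 b1 where F1: "F1 = (g1, 0, b1)" using h(1) by (auto simp: horo_def)
  obtain g2 b2 where F2: "F2 = (g2, 0, b2)" using h(2) by (auto simp: horo_def)
  define L where "L = fls_subdegree lam"
  define z where "z = c + a"
  have "c = a + z" by (simp add: z_def char2_simps)
  then have fc: "feval F1 c = g1 * z\<^sup>2 + feval F1 a" "feval F2 c = g2 * z\<^sup>2 + feval F2 a"
    using horo_feval[OF h(1), of a z] horo_feval[OF h(2), of a z] by (simp_all only: F1 F2 fst_conv)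
  have lev: "vge (m - r) g1" "vge (m + r) (feval F1 a)" "vge (m - r) g2" "vge (m + r) (feval F2 a)"
    "vge (m + s) (feval F1 c)" "vge (m + s) (feval F2 c)"
    using B C by (auto simp: F1 F2 cball_val_in_lset)
  have res': "res F1 F2 = (g1 * feval F2 x + g2 * feval F1 x)\<^sup>2" for x
    using res_shift[of g1 0 b1 g2 0 b2 x] by (simp add: F1 F2)
  have nL: "\<not> vge (L + 1) (g1 * feval F2 x + g2 * feval F1 x)" for x
  proof -
    have "\<not> vge (2 * (L + 1)) (lam\<^sup>2)" unfolding vge_square using res(2) by (simp add: vge_def L_def)
    then have "\<not> vge (2 * (L + 1)) ((g1 * feval F2 x + g2 * feval F1 x)\<^sup>2)"
      unfolding res(1)[symmetric] res'[of x] .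
    then show ?thesis unfolding vge_square .
  qed
  show "2 * m + s - r \<le> fls_subdegree lam"
  proof (rule ccontr)
    assume "\<not> 2 * m + s - r \<le> fls_subdegree lam"
    then have "vge (L + 1) (g1 * feval F2 c + g2 * feval F1 c)"
      using lev by (intro vge_add) (auto simp: L_def intro: vge_mult' simp del: feval.simps)
    then show False using nL by blast
  qed
  have *: "vge r z" if g: "\<not> vge (m - r + 2) g" and c: "vge (m + r) c1" "vge (m + s) (g * z\<^sup>2 + c1)" for g c1
  proof (rule ccontr)
    assume "\<not> vge r z"
    then have "\<not> vge (2 * r - 2 + 1) (z\<^sup>2)" using vge_square_odd[of r z] by simp
    then have "\<not> vge (m + r) (g * z\<^sup>2)" using g by (intro not_vge_mult[of "m - r + 1" _ "2 * r - 2"]) (simp_all add: add.assoc)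
    moreover have "vge (m + r) (g * z\<^sup>2 + c1)" using c(2) by (rule vge_mono) (use r in simp)
    ultimately show False using c(1) vge_add_cancel(1) by blast
  qed
  \<comment> \<open>Some leading coefficient has valuation at most m - r + 1, and its square term
    then controls z. Otherwise the constant valuation would be at least 2m + 2.\<close>
  have "\<not> vge (m - r + 2) g1 \<or> \<not> vge (m - r + 2) g2"
  proof (rule ccontr)
    assume "\<not> ?thesis"
    then have "vge (L + 1) (g1 * feval F2 a + g2 * feval F1 a)"
      using lev m by (intro vge_add) (auto simp: L_def intro: vge_mult' simp del: feval.simps)
    then show False using nL by blast
  qed
  then have "vge r z" using *[of g1 "feval F1 a"] *[of g2 "feval F2 a"] lev fc by auto
  then show "vge r (c - a)" by (simp add: z_def diff_eq)
qed

text \<open>Level m for both forms forces \<nu>(lam) \<ge> 2m, so \<open>m\<close> is the largest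
  possible common level. Two vertices attaining it are equal or, for odd \<nu>(lam) only,
  adjacent.\<close>

lemma horo_pair_core:
  assumes h: "horo F1" "horo F2" and res: "res F1 F2 = lam\<^sup>2" "lam \<noteq> 0"
    and m: "m = fls_subdegree lam div 2" and ne: "lset F1 m \<inter> lset F2 m \<noteq> {}"
  shows "is_line (lset F1 m \<inter> lset F2 m) (Fin_length (if even (fls_subdegree lam) then 0 else 1))"
proof -
  define L where "L = fls_subdegree lam"
  define S where "S = lset F1 m \<inter> lset F2 m"
  have close: "s \<le> r + L - 2 * m" "vge r (c - a)" if "cball_val a r \<in> S" "cball_val c s \<in> S" "r \<le> s" for a r c s
    using horo_pair_close[OF h res, of m r s a c] that m unfolding S_def L_def by (auto simp: algebra_simps)
  have VS: "B \<in> vertices" if "B \<in> S" for B using that subsetD[OF lset_subset] unfolding S_def by blast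
  obtain B where B: "B \<in> S" using ne unfolding S_def by blast
  have near: "C = B \<or> odd L \<and> adj B C" if BC: "B \<in> S" "C \<in> S" for B C
  proof -
    obtain a r c s where ar: "B = cball_val a r" "C = cball_val c s"
      using VS BC by (meson verticesE)
    have *: "(r = s \<or> odd L \<and> s = r + 1) \<and> vge r (c - a)"
      if "cball_val a r \<in> S" "cball_val c s \<in> S" "r \<le> s" for a r c s
      using close[OF that] that(3) m unfolding L_def by (auto elim!: oddE evenE)
    show ?thesis
    proof (cases "r \<le> s")
      case True
      then have "(r = s \<or> odd L \<and> s = r + 1) \<and> vge r (c - a)" using * BC ar by blast
      then show ?thesis unfolding ar adj_cball_iff by (auto simp: cball_val_eq_iff vge_minus_commute)
    next
      case False
      then have "(s = r \<or> odd L \<and> r = s + 1) \<and> vge s (a - c)" using *[of c s a r] BC ar by simp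
      then have "C = B \<or> odd L \<and> adj C B" unfolding ar adj_cball_iff by (auto simp: cball_val_eq_iff vge_minus_commute)
      then show ?thesis using adj_sym by blast
    qed
  qed
  show ?thesis
  proof (cases "even L")
    case True
    then have "S = {B}" using near B by blast
    then show ?thesis using is_line_singleton[OF VS[OF B]] True unfolding S_def L_def by simp
  next
    case odd: False
    have "\<exists>C\<in>S. adj B C"
    proof -
      have mid: "vge k (mid F1)" "vge k (mid F2)" for k using horo_mid[OF h(1)] horo_mid[OF h(2)] by auto
      have L: "L = 2 * m + 1" using odd m unfolding L_def by (auto elim!: oddE)
      have R: "vge (2 * L) (res F1 F2)" "\<not> vge (2 * (L + 1)) (res F1 F2)"
        using res by (simp_all only: vge_square) (simp_all add: vge_def L_def)
      \<comment> \<open>For odd \<nu>(lam) the second end has to be produced. At B one form has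
        exact level m, and the edge raising it keeps the other at level m, since the resultant has
        valuation 4m + 2 and not 4m.\<close>
      have up: "\<exists>N. adj B N \<and> N \<in> lset F1 m \<and> N \<in> lset F2 m"
        if h: "horo F1" "horo F2" and R: "vge (2 * L) (res F1 F2)"
          and B: "B \<in> lset F1 m" "B \<in> lset F2 m" and nB: "B \<notin> lset F1 (m + 1)" for F1 F2 :: "'k form"
      proof -
        obtain C where "C \<in> lset F1 (m + 1)" using horo_nonempty[OF h(1)] by blast
        then obtain N where N: "adj B N" "N \<in> lset F1 (m + 1)" using lset_step_up[OF B(1) nB] by metis
        have N1: "N \<in> lset F1 m" using N(2) lset_mono[of m "m + 1" F1] by auto
        have "N \<in> lset F2 m"
        proof (rule ccontr)
          assume n: "N \<notin> lset F2 m"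
          have mid: "vge (m + 1) (mid F1)" using horo_mid[OF h(1)] by simp
          have "\<not> vge (2 * (m + m) + 1) (res F1 F2)"
            by (rule res_exact[OF N(1) B(1) nB N1 mid B(2) n])
          then show False using vge_mono[OF R, of "2 * (m + m) + 1"] L by simp
        qed
        then show ?thesis using N N1 by blast
      qed
      have "B \<notin> lset F1 (m + 1) \<or> B \<notin> lset F2 (m + 1)"
      proof (rule ccontr)
        assume "\<not> ?thesis"
        then have "vge (2 * ((m + 1) + (m + 1))) (res F1 F2)" using res_vge by blast
        then show False using R(2) L by (simp add: algebra_simps)
      qed
      then show ?thesis
      proof
        assume "B \<notin> lset F1 (m + 1)"
        then show ?thesis using up[OF h R(1)] B unfolding S_def by blast
      next
        assume "B \<notin> lset F2 (m + 1)"
        then show ?thesis using up[OF h(2,1)] R(1) B unfolding S_def res_commute[of F2 F1] by blast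
      qed
    qed
    then obtain C where C: "C \<in> S" "adj B C" by blast
    have "D = B \<or> D = C" if D: "D \<in> S" for D
    proof (rule ccontr)
      assume "\<not> (D = B \<or> D = C)"
      \<comment> \<open>A third vertex would be adjacent to both ends, but a tree has no
        triangles.\<close>
      then have "adj B D" "adj C D" "D \<noteq> C" using near[OF B D] near[OF C(1) D] by auto
      then have "tree_dist C C < tree_dist B C" using tree_dist_adj[OF C(2)] by simp
      then have "tree_dist D C = tree_dist B C + 1"
        using tree_dist_forward[OF C(2) \<open>adj B D\<close> \<open>D \<noteq> C\<close>[symmetric] VS[OF C(1)]] by blast
      then show False using tree_dist_adj[OF adj_sym[OF \<open>adj C D\<close>]] tree_dist_adj[OF C(2)] by simp
    qed
    then have "S = {B, C}" using B C by blast
    then show ?thesis using is_line_edge[OF C(2)] odd unfolding S_def L_def by simp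
  qed
qed

text \<open>A vertex where both levels are at least 0 reaches the core of common level m in at most
  m steps, and conversely levels drop by at most one per edge.\<close>

lemma horo_pair:
  assumes h: "horo F1" "horo F2" and res: "res F1 F2 = lam\<^sup>2" "lam \<noteq> 0"
    and ne: "lset F1 0 \<inter> lset F2 0 \<noteq> {}"
  obtains p n where "is_line p (Fin_length (if even (fls_subdegree lam) then 0 else 1))"
    "int n = fls_subdegree lam div 2" "lset F1 0 \<inter> lset F2 0 = thicken p n"
proof -
  define m where "m = fls_subdegree lam div 2"
  have m2: "2 * m \<le> fls_subdegree lam" by (simp add: m_def)
  obtain B where B: "B \<in> lset F1 0" "B \<in> lset F2 0" using ne by blast
  then have "vge (2 * (0 + 0)) (res F1 F2)" by (rule res_vge)
  then have "0 \<le> fls_subdegree lam" using res vge_square[of 0 lam] by (simp add: vge_def)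
  then have m0: "0 \<le> m" by (simp add: m_def)
  define n where "n = nat m"
  have n: "int n = m" using m0 by (simp add: n_def)
  define p where "p = lset F1 m \<inter> lset F2 m"
  have near: "\<exists>C\<in>p. tree_dist B C \<le> n" if "B \<in> lset F1 0 \<inter> lset F2 0" for B
    using horo_pair_near[OF h res m2, of B n] that n unfolding p_def by simp
  have "p \<noteq> {}" using near[of B] B by auto
  then have "is_line p (Fin_length (if even (fls_subdegree lam) then 0 else 1))"
    unfolding p_def using horo_pair_core[OF h res m_def] by blast
  moreover have "lset F1 0 \<inter> lset F2 0 = thicken p n"
  proof (intro equalityI subsetI)
    fix B assume B: "B \<in> lset F1 0 \<inter> lset F2 0"
    then have "B \<in> vertices" using subsetD[OF lset_subset[of F1 0]] by blast
    then show "B \<in> thicken p n" using near[OF B] by (simp add: thicken_def)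
  next
    fix B assume "B \<in> thicken p n"
    then obtain C where C: "B \<in> vertices" "C \<in> p" "tree_dist B C \<le> n" by (auto simp: thicken_def)
    then have "B \<in> lset F1 (m - int (tree_dist B C)) \<inter> lset F2 (m - int (tree_dist B C))"
      using lset_dist[of C F1 m B] lset_dist[of C F2 m B] unfolding p_def by blast
    moreover have "0 \<le> m - int (tree_dist B C)" using C n by simp
    ultimately show "B \<in> lset F1 0 \<inter> lset F2 0" using lset_mono by blast
  qed
  ultimately show ?thesis using that n m_def by blast
qed

section \<open>The axis of a form with two distinct zeros\<close>

text \<open>The zeros are b/t and infinity, and the axis joins them. In coordinates given by these
  zeros the form becomes t x y and F2 becomes A x^2 + t2 x y + C y^2, which makes the resultant and
  the levels along the axis explicit.\<close>

lemma split_axis_infinite: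
  fixes t b :: "'k fls"
  assumes t: "t \<noteq> 0"
  defines "p \<equiv> \<lambda>i::int. cball_val (b / t) i"
  shows "nb_walk UNIV p" "lset (0, t, b :: 'k fls) (fls_subdegree t) = range p"
    "\<exists>A C. res (0, t, b) F2 = t\<^sup>2 * A * C \<and>
       (\<forall>i m. p i \<in> lset F2 m \<longleftrightarrow> vge (m - i) A \<and> vge m (mid F2) \<and> vge (m + i) C) \<and>
       (A = 0 \<and> C = 0 \<longleftrightarrow> proportional (0, t, b) F2)"
proof -
  show "nb_walk UNIV p"
    unfolding nb_walk_def p_def by (auto simp: adj_cball_Suc cball_val_eq_iff)
  have bt: "b = t * (b / t)" using t by simp
  have f: "feval (0, t, b) a = t * (a - b / t)" for a using t by (simp add: diff_eq distrib_left)
  have "lev (0, t, b) a r (fls_subdegree t) \<longleftrightarrow> vge r (a - b / t)" for a r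
  proof -
    have "vge (fls_subdegree t + r) (t * y) \<longleftrightarrow> vge r y" for y
      using t by (cases "y = 0") (auto simp: vge_def)
    then show ?thesis by (simp only: lev.simps f vge_0 vge_subdegree simp_thms)
  qed
  then show "lset (0, t, b) (fls_subdegree t) = range p"
    unfolding lset_def p_def by (auto simp: cball_val_eq_iff) (metis diff_self vge_0)
  obtain g2 t2 b2 where F2: "F2 = (g2, t2, b2)" by (cases F2)
  define C where "C = feval F2 (b / t)"
  have "res (0, t, b) F2 = t\<^sup>2 * g2 * C"
    using res_shift[of 0 t b g2 t2 b2 "b / t"] t by (simp add: F2 C_def add_self power2_eq_square)
  moreover have "p i \<in> lset F2 m \<longleftrightarrow> vge (m - i) g2 \<and> vge m (mid F2) \<and> vge (m + i) C" for i m
    by (simp add: p_def cball_val_in_lset F2 C_def)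
  moreover have "g2 = 0 \<and> C = 0 \<longleftrightarrow> proportional (0, t, b) F2"
    using t by (auto simp: F2 C_def add_eq_0_iff_eq field_simps)
  ultimately show "\<exists>A C. res (0, t, b) F2 = t\<^sup>2 * A * C \<and>
       (\<forall>i m. p i \<in> lset F2 m \<longleftrightarrow> vge (m - i) A \<and> vge m (mid F2) \<and> vge (m + i) C) \<and>
       (A = 0 \<and> C = 0 \<longleftrightarrow> proportional (0, t, b) F2)" by blast
qed

text \<open>Position 0 is the smallest ball containing both zeros, positive positions descend to x1
  and negative ones to x2. The values of F2 at the zeros, divided by their difference w, are its
  outer coefficients in the basis given by the zeros.\<close>

lemma split_axis_finite:
  fixes g x1 x2 :: "'k fls"
  assumes g: "g \<noteq> 0" and x: "x1 \<noteq> x2"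
  defines "w \<equiv> x1 + x2"
  defines "F \<equiv> (g, g * w, g * x1 * x2)"
  defines "p \<equiv> \<lambda>i. if 0 \<le> i then cball_val x1 (fls_subdegree w + i) else cball_val x2 (fls_subdegree w - i)"
  shows "nb_walk UNIV p" "lset F (fls_subdegree (g * w)) = range p"
    "\<exists>A C. res F F2 = (g * w)\<^sup>2 * A * C \<and>
       (\<forall>i m. p i \<in> lset F2 m \<longleftrightarrow> vge (m - i) A \<and> vge m (mid F2) \<and> vge (m + i) C) \<and>
       (A = 0 \<and> C = 0 \<longleftrightarrow> proportional F F2)"
proof -
  define \<rho> where "\<rho> = fls_subdegree w"
  have w: "w \<noteq> 0" using x by (simp add: w_def add_eq_0_iff_eq)
  have vw: "vge \<rho> w" "\<not> vge (\<rho> + 1) w" using w by (auto simp: \<rho>_def vge_def)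
  have w12: "x1 - x2 = w" "x2 - x1 = w" by (simp_all add: w_def diff_eq add.commute)
  have p0: "p i = cball_val x1 (\<rho> + i)" if "0 \<le> i" for i using that by (simp add: p_def \<rho>_def)
  have p1: "p i = cball_val x2 (\<rho> - i)" if "i \<le> 0" for i
    using that vw(1) by (cases "i = 0") (auto simp: p_def \<rho>_def cball_val_eq_iff w12)
  show "nb_walk UNIV p"
    unfolding nb_walk_def
  proof (intro conjI ballI allI impI)
    fix i
    show "p i \<in> vertices" by (simp add: p_def)
    show "adj (p i) (p (i + 1))"
    proof (cases "0 \<le> i")
      case True
      then show ?thesis using adj_cball_Suc[of x1 "\<rho> + i"] by (simp add: p0 add.assoc)
    next
      case False
      then show ?thesis using adj_sym[OF adj_cball_Suc[of x2 "\<rho> - (i + 1)"]] by (simp add: p1)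
    qed
    consider "0 \<le> i" | "i \<le> -2" | "i = -1" by linarith
    then show "p i \<noteq> p (i + 2)"
    proof cases
      case 3
      then show ?thesis using vw(2) by (auto simp: p0 p1 cball_val_eq_iff w12)
    qed (auto simp: p0 p1 cball_val_eq_iff)
  qed
  have f: "feval F a = g * ((a - x1) * (a - x2))" for a
    by (simp add: F_def w_def char2_simps)
  have gw: "fls_subdegree (g * w) = fls_subdegree g + \<rho>" using g w by (simp add: \<rho>_def)
  have sc: "vge m (g * y) \<longleftrightarrow> vge (m - fls_subdegree g) y" for m y
    using g by (cases "y = 0") (auto simp: vge_def)
  have lev: "lev F a r (fls_subdegree (g * w)) \<longleftrightarrow> \<rho> \<le> r \<and> vge (\<rho> + r) ((a - x1) * (a - x2))" for a r
  proof -
    have "vge (fls_subdegree g + \<rho> - r) g \<longleftrightarrow> \<rho> \<le> r" using g by (simp add: vge_def)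
    moreover have "vge (fls_subdegree g + \<rho>) (g * w)" using vge_subdegree[of "g * w"] gw by simp
    moreover have "vge (fls_subdegree g + \<rho> + r) (g * y) \<longleftrightarrow> vge (\<rho> + r) y" for y
      using sc[of "fls_subdegree g + \<rho> + r" y] by simp
    ultimately show ?thesis using f[of a] by (simp only: gw F_def lev.simps simp_thms)
  qed
  show "lset F (fls_subdegree (g * w)) = range p"
  proof (intro equalityI subsetI)
    fix B assume "B \<in> lset F (fls_subdegree (g * w))"
    then obtain a r where B: "B = cball_val a r" and r: "\<rho> \<le> r" and v: "vge (\<rho> + r) ((a - x1) * (a - x2))"
      by (auto simp: lset_def lev)
    \<comment> \<open>Since a - x1 and a - x2 differ by w, one of them has valuation at most \<rho>,
      and the other one must account for r.\<close>
    have "\<not> vge (\<rho> + 1) (a - x1) \<or> \<not> vge (\<rho> + 1) (a - x2)"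
    proof (rule ccontr)
      assume "\<not> ?thesis"
      then have "vge (\<rho> + 1) ((a - x2) - (a - x1))" using vge_diff by blast
      then show False using vw(2) w12 by simp
    qed
    then have "vge r (a - x1) \<or> vge r (a - x2)"
      using not_vge_mult[of "r - 1" "a - x1" \<rho> "a - x2" "\<rho> + r"] not_vge_mult[of \<rho> "a - x1" "r - 1" "a - x2" "\<rho> + r"] v
      by auto
    then have "B = p (r - \<rho>) \<or> B = p (\<rho> - r)"
      using r by (auto simp: B p0 p1 cball_val_eq_iff)
    then show "B \<in> range p" by blast
  next
    fix B assume "B \<in> range p"
    then obtain i where i: "B = p i" by blast
    have sub: "lset F (fls_subdegree (g * w)) = {cball_val a r | a r. \<rho> \<le> r \<and> vge (\<rho> + r) ((a - x1) * (a - x2))}"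
      unfolding lset_def lev ..
    show "B \<in> lset F (fls_subdegree (g * w))"
    proof (cases "0 \<le> i")
      case True
      have "vge (\<rho> + (\<rho> + i)) ((x1 - x1) * (x1 - x2))" by simp
      then show ?thesis unfolding i p0[OF True] sub using True by fastforce
    next
      case False
      have "vge (\<rho> + (\<rho> - i)) ((x2 - x1) * (x2 - x2))" by simp
      then show ?thesis unfolding i using p1[of i] False sub by fastforce
    qed
  qed
  obtain g2 t2 b2 where F2: "F2 = (g2, t2, b2)" by (cases F2)
  define A where "A = feval F2 x2 / w"
  define C where "C = feval F2 x1 / w"
  have Aw: "feval F2 x2 = A * w" and Cw: "feval F2 x1 = C * w" using w by (simp_all add: A_def C_def)
  have "x2 = x1 + w" by (simp add: w_def add_self_left)
  then have x2f: "feval F2 x2 = g2 * w\<^sup>2 + t2 * w + feval F2 x1" by (simp only: F2 feval_shift)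
  then have "A * w = (g2 * w + t2 + C) * w" unfolding Aw Cw by (simp add: char2_simps)
  then have AC: "A = g2 * w + t2 + C" using w by simp
  have "feval F x1 = 0" by (simp add: f)
  then have "res F F2 = (g * (C * w))\<^sup>2 + (g * t2 + g2 * (g * w)) * (g * w * (C * w))"
    using res_shift[of g "g * w" "g * x1 * x2" g2 t2 b2 x1] Cw by (simp add: F_def F2 del: feval.simps)
  also have "\<dots> = (g * w)\<^sup>2 * A * C" unfolding AC by (simp add: char2_simps)
  finally have res: "res F F2 = (g * w)\<^sup>2 * A * C" .
  have scw: "vge (m + \<rho>) (y * w) \<longleftrightarrow> vge m y" for m y
    using w by (cases "y = 0") (auto simp: vge_def \<rho>_def)
  have mem: "p i \<in> lset F2 m \<longleftrightarrow> vge (m - i) A \<and> vge m (mid F2) \<and> vge (m + i) C" for i m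
  proof (cases "0 \<le> i")
    case True
    have "p i \<in> lset F2 m \<longleftrightarrow> vge (m - i) (g2 * w) \<and> vge m t2 \<and> vge (m + i) C"
    proof -
      have "vge (m - i) (g2 * w) \<longleftrightarrow> vge (m - (\<rho> + i)) g2" using scw[of "m - (\<rho> + i)" g2] by simp
      moreover have "vge (m + (\<rho> + i)) (C * w) \<longleftrightarrow> vge (m + i) C"
        using scw[of "m + i" C] by (simp add: ac_simps)
      moreover have "feval (g2, t2, b2) x1 = C * w" using Cw by (simp only: F2)
      ultimately show ?thesis by (simp only: p0[OF True] cball_val_in_lset F2 lev.simps)
    qed
    \<comment> \<open>On this half m - i \<le> m \<le> m + i, so t2 and C do not affect the bound on
      A = g2 w + t2 + C.\<close>
    also have "\<dots> \<longleftrightarrow> vge (m - i) A \<and> vge m t2 \<and> vge (m + i) C"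
    proof -
      have "vge (m - i) A \<longleftrightarrow> vge (m - i) (g2 * w)" if "vge m t2" "vge (m + i) C"
      proof -
        have "vge (m - i) (t2 + C)" using that True by (intro vge_add) (auto intro: vge_mono)
        then show ?thesis unfolding AC add.assoc using vge_add_cancel(1) by blast
      qed
      then show ?thesis by blast
    qed
    finally show ?thesis by (simp add: F2)
  next
    case False
    have "p i \<in> lset F2 m \<longleftrightarrow> vge (m + i) (g2 * w) \<and> vge m t2 \<and> vge (m - i) A"
    proof -
      have "vge (m + i) (g2 * w) \<longleftrightarrow> vge (m - (\<rho> - i)) g2"
        using scw[of "m - (\<rho> - i)" g2] by (simp add: algebra_simps)
      moreover have "vge (m + (\<rho> - i)) (A * w) \<longleftrightarrow> vge (m - i) A"
        using scw[of "m - i" A] by (simp add: algebra_simps)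
      moreover have "feval (g2, t2, b2) x2 = A * w" using Aw by (simp only: F2)
      moreover have "p i = cball_val x2 (\<rho> - i)" using False by (simp add: p1)
      ultimately show ?thesis by (simp only: cball_val_in_lset F2 lev.simps)
    qed
    also have "\<dots> \<longleftrightarrow> vge (m - i) A \<and> vge m t2 \<and> vge (m + i) C"
    proof -
      have CA: "C = g2 * w + (t2 + A)" unfolding AC by (simp add: char2_simps)
      have "vge (m + i) C \<longleftrightarrow> vge (m + i) (g2 * w)" if "vge m t2" "vge (m - i) A"
      proof -
        have "vge (m + i) (t2 + A)" using that False by (intro vge_add) (auto intro: vge_mono)
        then show ?thesis unfolding CA using vge_add_cancel(1) by blast
      qed
      then show ?thesis by blast
    qed
    finally show ?thesis by (simp add: F2)
  qed
  have "A = 0 \<and> C = 0 \<longleftrightarrow> proportional F F2"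
  proof
    assume AC0: "A = 0 \<and> C = 0"
    have "g2 * w + t2 = 0" using AC AC0 by (metis add.right_neutral)
    then have t2: "t2 = g2 * w" using add_eq_0_iff_eq[of "g2 * w" t2] by simp
    have "feval F2 x1 = 0" using Cw AC0 by simp
    then have "b2 = g2 * x1\<^sup>2 + t2 * x1" by (simp add: F2 add_eq_0_iff_eq)
    then have "b2 = g2 * x1 * x2" unfolding t2 by (simp add: w_def char2_simps)
    then show "proportional F F2" using t2 by (simp add: F_def F2 ac_simps)
  next
    assume "proportional F F2"
    then have "g * t2 = g2 * (g * w)" "g * b2 = g2 * (g * x1 * x2)" by (auto simp: F_def F2)
    then have "t2 = g2 * w" "b2 = g2 * x1 * x2" using g by (auto simp: ac_simps)
    then have "feval F2 x1 = 0" "feval F2 x2 = 0" by (simp_all add: F2 w_def char2_simps)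
    then show "A = 0 \<and> C = 0" by (simp add: A_def C_def)
  qed
  then show "\<exists>A C. res F F2 = (g * w)\<^sup>2 * A * C \<and>
       (\<forall>i m. p i \<in> lset F2 m \<longleftrightarrow> vge (m - i) A \<and> vge m (mid F2) \<and> vge (m + i) C) \<and>
       (A = 0 \<and> C = 0 \<longleftrightarrow> proportional F F2)" using res mem by blast
qed

end

section \<open>Defects\<close>

lemma irred_quad_iff:
  fixes c d :: "'k::field fls"
  shows "irred_poly (quad c d) \<longleftrightarrow> (\<forall>x. x\<^sup>2 + c * x + d \<noteq> 0)"
proof
  have deg: "degree (quad c d) = 2" by (simp add: quad_def)
  have ev: "poly (quad c d) x = x\<^sup>2 + c * x + d" for x
    by (simp add: quad_def algebra_simps power2_eq_square)
  show "\<forall>x. x\<^sup>2 + c * x + d \<noteq> 0" if irr: "irred_poly (quad c d)"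
  proof (rule allI, rule notI)
    fix x assume "x\<^sup>2 + c * x + d = 0"
    then have "[:- x, 1:] dvd quad c d" using ev poly_eq_0_iff_dvd by metis
    then obtain r where r: "quad c d = [:- x, 1:] * r" by (auto elim: dvdE)
    then have "r \<noteq> 0" using deg by auto
    then have "degree (quad c d) = 1 + degree r" unfolding r by (subst degree_mult_eq) auto
    then have "degree r = 1" using deg by simp
    then have "\<not> r dvd 1" using is_unit_iff_degree[OF \<open>r \<noteq> 0\<close>] by simp
    moreover have "\<not> [:- x, 1:] dvd 1" using is_unit_iff_degree[of "[:- x, 1:]"] by simp
    ultimately show False using irr r Factorial_Ring.irreducibleD by blast
  qed
  show "irred_poly (quad c d)" if nr: "\<forall>x. x\<^sup>2 + c * x + d \<noteq> 0"
  proof (rule Factorial_Ring.irreducibleI)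
    show nz: "quad c d \<noteq> 0" using deg by auto
    show "\<not> quad c d dvd 1" using deg is_unit_iff_degree[OF nz] by simp
    fix p q assume pq: "quad c d = p * q"
    show "p dvd 1 \<or> q dvd 1"
    proof (rule ccontr)
      assume n: "\<not> (p dvd 1 \<or> q dvd 1)"
      have nz: "p \<noteq> 0" "q \<noteq> 0" using pq deg by auto
      then have "degree p \<noteq> 0" "degree q \<noteq> 0" using n
        by (metis is_unit_iff_degree)+
      moreover have "degree p + degree q = 2" using degree_mult_eq[OF nz] pq deg by simp
      ultimately have "degree p = 1" by simp
      then obtain u v where p: "p = [:u, v:]" "v \<noteq> 0"
        by (metis degree1_coeffs)
      then have "poly (quad c d) (- u / v) = 0" unfolding pq by simp
      then show False unfolding ev using nr by blast
    qed
  qed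
qed

text \<open>Coefficients of the solution of h = c + h^2 without constant term: squaring moves the
  coefficient of index n div 2 to n, so the recursion descends.\<close>

fun as_coeff :: "(nat \<Rightarrow> 'a::comm_ring_1) \<Rightarrow> nat \<Rightarrow> 'a" where
  "as_coeff c n = (if n = 0 then 0 else c n + (if even n then (as_coeff c (n div 2))\<^sup>2 else 0))"

declare as_coeff.simps [simp del]

context finite_char2
begin

lemma add_self_k: "x + x = (0::'k)"
proof -
  have "x + x = (1 + 1) * x" by (simp only: distrib_right mult_1_left)
  then show ?thesis by (simp only: two_eq_0 mult_zero_left)
qed

text \<open>In the product the terms for i and k - i are equal and cancel, so that at most a middle
  term remains.\<close>

lemma fls_square_nth:
  "fls_nth (h\<^sup>2 :: 'k fls) k = (if even k then (fls_nth h (k div 2))\<^sup>2 else 0)"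
proof -
  define d where "d = fls_subdegree h"
  define f where "f i = fls_nth h i * fls_nth h (k - i)" for i
  define I where "I = {d..k - d}"
  have fin: "finite I" by (simp add: I_def)
  have "fls_nth (h\<^sup>2) k = sum f I"
    unfolding power2_eq_square fls_times_nth(2) f_def I_def d_def ..
  also have "I = {i\<in>I. 2 * i < k} \<union> {i\<in>I. k < 2 * i} \<union> {i\<in>I. 2 * i = k}" by auto
  also have "sum f \<dots> = sum f {i\<in>I. 2 * i < k} + sum f {i\<in>I. k < 2 * i} + sum f {i\<in>I. 2 * i = k}"
    by (subst sum.union_disjoint; (subst sum.union_disjoint)?) (auto intro: finite_subset[of _ I] simp: fin)
  also have "sum f {i\<in>I. k < 2 * i} = sum f {i\<in>I. 2 * i < k}"
    by (rule sum.reindex_bij_witness[of _ "\<lambda>i. k - i" "\<lambda>i. k - i"]) (auto simp: I_def f_def mult.commute)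
  also have "sum f {i\<in>I. 2 * i < k} + sum f {i\<in>I. 2 * i < k} = 0" by (rule add_self_k)
  also have "0 + sum f {i\<in>I. 2 * i = k} = (if even k then (fls_nth h (k div 2))\<^sup>2 else 0)"
  proof (cases "even k")
    case True
    then obtain m where m: "k = 2 * m" by (elim evenE)
    show ?thesis
    proof (cases "m \<in> I")
      case True
      then have "{i\<in>I. 2 * i = k} = {m}" by (auto simp: m)
      then show ?thesis by (simp add: m f_def power2_eq_square)
    next
      case False
      then have "{i\<in>I. 2 * i = k} = {}" by (auto simp: m)
      moreover have "m < d" using False by (auto simp: I_def m)
      then have "fls_nth h m = 0" by (simp add: d_def)
      ultimately show ?thesis by (simp only: sum.empty) (simp add: m)
    qed
  next
    case False
    then have "{i\<in>I. 2 * i = k} = {}" by auto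
    then show ?thesis using False by (simp only: sum.empty) simp
  qed
  finally show ?thesis .
qed

text \<open>An instance of Hensel's lemma, solved coefficient by coefficient.\<close>
lemma artin_schreier_root:
  assumes "vge 1 c"
  obtains h where "h\<^sup>2 + h + c = (0 :: 'k fls)"
proof -
  define f where "f k = (if k \<le> 0 then 0 else as_coeff (\<lambda>n. fls_nth c (int n)) (nat k))" for k :: int
  define z where "z = Abs_fls f"
  have z: "fls_nth z k = f k" for k
    unfolding z_def by (rule nth_Abs_fls_lower_bound[of 0]) (simp add: f_def)
  have "fls_nth (z\<^sup>2 + z + c) k = 0" for k
  proof (cases "k \<le> 0")
    case True
    then have "fls_nth c k = 0" using assms by (simp add: vge_iff_nth)
    moreover have "k div 2 \<le> 0" using True by linarith
    ultimately show ?thesis using True by (simp add: fls_square_nth z f_def)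
  next
    case False
    define n where "n = nat k"
    have k: "k = int n" "n > 0" using False by (auto simp: n_def)
    have "f k = fls_nth c k + (if even n then (as_coeff (\<lambda>n. fls_nth c (int n)) (n div 2))\<^sup>2 else 0)"
      using k(2) as_coeff.simps[of "\<lambda>n. fls_nth c (int n)" n] by (simp add: f_def k(1))
    moreover have "fls_nth (z\<^sup>2) k = (if even n then (as_coeff (\<lambda>n. fls_nth c (int n)) (n div 2))\<^sup>2 else 0)"
    proof (cases "even n")
      case True
      then have "n div 2 > 0" using k(2) by auto
      moreover have "k div 2 = int (n div 2)" by (simp add: k(1))
      ultimately show ?thesis using True by (simp add: fls_square_nth z f_def k(1))
    next
      case False
      then show ?thesis by (simp add: fls_square_nth k(1))
    qed
    ultimately have "fls_nth (z\<^sup>2) k + f k + fls_nth c k = 0"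
      by (simp add: ac_simps add_self_k)
    then show ?thesis by (simp add: z)
  qed
  then have "z\<^sup>2 + z + c = 0" by (intro fls_eqI) simp
  then show ?thesis using that by blast
qed

text \<open>The special case of \<open>step_down_coefficient\<close> with leading coefficient 1 and
  no middle term.\<close>

lemma exists_leading_sqrt:
  assumes "vge (2 * m) (x :: 'k fls)"
  obtains y where "vge m y" "vge (2 * m + 1) (y\<^sup>2 + x)"
proof -
  have "\<not> vge (0 + 1) (1 :: 'k fls)" "vge 0 (1 :: 'k fls)" by (auto simp: vge_def)
  moreover have "vge (0 + 1) (0 :: 'k fls)" "vge (m + m) x" using assms by auto
  ultimately obtain z where "vge m z" "vge (m + m + 1) (1 * z\<^sup>2 + 0 * z + x)"
    using step_down_coefficient[of m m "1::'k fls" 0 x] vge_mono[of "m + 1" 0]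
    by (metis add.right_neutral cancel_comm_monoid_add_class.diff_cancel vge_0)
  then show ?thesis using that by simp
qed

lemma bounded_greatest:
  assumes "P (a::int)" "\<And>n. P n \<Longrightarrow> n \<le> b"
  obtains n where "P n" "\<And>m. P m \<Longrightarrow> m \<le> n"
proof -
  define k where "k = (LEAST k. P (b - int k))"
  have "P (b - int (nat (b - a)))" using assms by simp
  then have 1: "P (b - int k)" unfolding k_def by (rule LeastI)
  have "m \<le> b - int k" if "P m" for m
  proof -
    have "P (b - int (nat (b - m)))" using that assms(2) by simp
    then have "k \<le> nat (b - m)" unfolding k_def by (rule Least_le)
    then show ?thesis using assms(2)[OF that] by linarith
  qed
  then show ?thesis using that 1 by blast
qed

text \<open>A largest valuation N exists and is at most 0, because an element of valuation 1 or more
  yields a root by \<open>artin_schreier_root\<close>. For negative even N the leading term could be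
  removed by a square y^2 whose root y has larger valuation than N.\<close>

lemma artin_schreier_cases:
  assumes nr: "\<And>h. h\<^sup>2 + h + c \<noteq> (0 :: 'k fls)"
  obtains (unit) h where "vge 0 (h\<^sup>2 + h + c)" "\<And>h. \<not> vge 1 (h\<^sup>2 + h + c)"
  | (odd) h s where "s \<ge> 1" "vge (1 - 2 * s) (h\<^sup>2 + h + c)" "\<And>h. \<not> vge (2 - 2 * s) (h\<^sup>2 + h + c)"
proof -
  have shift: "k\<^sup>2 + k + (h\<^sup>2 + h + c) = (h + k)\<^sup>2 + (h + k) + c" for h k :: "'k fls"
    by (simp add: char2_simps)
  have ub: "\<not> vge 1 (h\<^sup>2 + h + c)" for h
  proof
    assume "vge 1 (h\<^sup>2 + h + c)"
    then obtain k where "k\<^sup>2 + k + (h\<^sup>2 + h + c) = 0" using artin_schreier_root by blast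
    then show False using nr shift by metis
  qed
  define P where "P n \<longleftrightarrow> (\<exists>h. vge n (h\<^sup>2 + h + c))" for n
  have "P (fls_subdegree (0\<^sup>2 + 0 + c))" unfolding P_def using vge_subdegree by blast
  moreover have "n \<le> 0" if "P n" for n
  proof (rule ccontr)
    assume "\<not> n \<le> 0"
    then show False using that ub vge_mono[of n _ 1] by (auto simp: P_def)
  qed
  ultimately obtain N where N: "P N" "\<And>m. P m \<Longrightarrow> m \<le> N" using bounded_greatest by metis
  have N0: "N \<le> 0" using \<open>\<And>n. P n \<Longrightarrow> n \<le> 0\<close> N(1) by blast
  obtain h where h: "vge N (h\<^sup>2 + h + c)" using N(1) by (auto simp: P_def)
  have max: "\<not> vge (N + 1) (k\<^sup>2 + k + c)" for k using N(2)[of "N + 1"] by (auto simp: P_def)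
  show ?thesis
  proof (cases "N = 0")
    case True
    then show ?thesis using unit h ub by blast
  next
    case False
    have "odd N"
    proof
      assume "even N"
      then obtain m where m: "N = 2 * m" by (elim evenE)
      then obtain y where y: "vge m y" "vge (2 * m + 1) (y\<^sup>2 + (h\<^sup>2 + h + c))"
        using exists_leading_sqrt h by metis
      \<comment> \<open>Here m < 0, hence m \<ge> 2m + 1, and the linear term y is
        negligible.\<close>
      have "vge (2 * m + 1) y" using y(1) N0 False m by (intro vge_mono[OF y(1)]) simp
      then have "vge (2 * m + 1) (y\<^sup>2 + (h\<^sup>2 + h + c) + y)" using y(2) vge_add by blast
      then have "vge (2 * m + 1) (y\<^sup>2 + y + (h\<^sup>2 + h + c))" by (simp only: ac_simps)
      then show False using max[of "h + y"] shift[of y h] m by simp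
    qed
    then obtain j where "N = 2 * j + 1" by (elim oddE)
    then show ?thesis using odd[of "- j" h] h max N0 False by (simp add: algebra_simps)
  qed
qed

text \<open>The root is taken coefficient by coefficient, the residue field being perfect.\<close>

lemma fls_sqrt:
  assumes "\<And>k. odd k \<Longrightarrow> fls_nth b k = 0"
  shows "\<exists>y. y\<^sup>2 = (b :: 'k fls)"
proof -
  define f where "f k = (SOME y. y\<^sup>2 = fls_nth b (2 * k))" for k
  have f: "(f k)\<^sup>2 = fls_nth b (2 * k)" for k unfolding f_def using exists_sqrt by (rule someI_ex)
  have "f k = 0" if "k < - \<bar>fls_subdegree b\<bar>" for k
  proof -
    have "2 * k < fls_subdegree b" using that by linarith
    then have "(f k)\<^sup>2 = 0" using f by simp
    then show ?thesis by simp
  qed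
  then have nth: "fls_nth (Abs_fls f) k = f k" for k
    by (intro nth_Abs_fls_lower_bound[of "- \<bar>fls_subdegree b\<bar>"]) blast
  have "(Abs_fls f)\<^sup>2 = b"
  proof (rule fls_eqI)
    fix k show "fls_nth ((Abs_fls f)\<^sup>2) k = fls_nth b k"
      using assms[of k] by (auto simp: fls_square_nth nth f elim: evenE)
  qed
  then show ?thesis by blast
qed

text \<open>A non-square b has a nonzero coefficient at some odd index k, which no h^2 can change;
  this bounds the valuations. The maximum is odd because a leading term of even degree is a square
  and can be removed.\<close>

lemma insep_odd:
  assumes nr: "\<And>h. h\<^sup>2 + b \<noteq> (0 :: 'k fls)"
  obtains h M where "vge (2 * M + 1) (h\<^sup>2 + b)" "\<And>h. \<not> vge (2 * M + 2) (h\<^sup>2 + b)"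
proof -
  have "\<nexists>y. y\<^sup>2 = b" using nr add_self by metis
  then obtain k where k: "odd k" "fls_nth b k \<noteq> 0" using fls_sqrt by blast
  define P where "P n \<longleftrightarrow> (\<exists>h. vge n (h\<^sup>2 + b))" for n
  have "P (fls_subdegree (0\<^sup>2 + b))" unfolding P_def using vge_subdegree by blast
  moreover have "n \<le> k" if "P n" for n
  proof (rule ccontr)
    assume "\<not> n \<le> k"
    obtain h where "vge n (h\<^sup>2 + b)" using \<open>P n\<close> by (auto simp: P_def)
    then have "fls_nth (h\<^sup>2 + b) k = 0" using \<open>\<not> n \<le> k\<close> by (simp add: vge_iff_nth)
    then show False using k by (simp add: fls_square_nth)
  qed
  ultimately obtain N where N: "P N" "\<And>m. P m \<Longrightarrow> m \<le> N" using bounded_greatest by metis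
  obtain h where h: "vge N (h\<^sup>2 + b)" using N(1) by (auto simp: P_def)
  have max: "\<not> vge (N + 1) (k\<^sup>2 + b)" for k using N(2)[of "N + 1"] by (auto simp: P_def)
  have "odd N"
  proof
    assume "even N"
    then obtain m where m: "N = 2 * m" by (elim evenE)
    then obtain y where y: "vge (2 * m + 1) (y\<^sup>2 + (h\<^sup>2 + b))"
      using exists_leading_sqrt h by metis
    then have "vge (2 * m + 1) ((y + h)\<^sup>2 + b)" by (simp only: square_add add.assoc)
    then show False using max m by blast
  qed
  then obtain M where M: "N = 2 * M + 1" by (elim oddE)
  have "\<not> vge (2 * M + 2) (h\<^sup>2 + b)" for h using max[of h] M by (simp add: add.assoc)
  then show ?thesis using that h M by blast
qed

end

section \<open>Valuations of the defect ideals\<close>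

lemma principal_ideal_eq:
  fixes c :: "'k::field fls"
  assumes c: "c \<noteq> 0"
  shows "principal_ideal c = {x. vge (fls_subdegree c) x}"
proof (intro equalityI subsetI)
  fix x :: "'k fls" assume "x \<in> {x. vge (fls_subdegree c) x}"
  then have "vge 0 (x / c)" using c by (cases "x = 0") (auto simp: vge_def fls_divide_subdegree)
  then have "x / c \<in> integers" using vge_iff_val[of 0 "x / c"] by (simp add: integers_def zero_ereal_def)
  moreover have "x = c * (x / c)" using c by simp
  ultimately show "x \<in> principal_ideal c" unfolding principal_ideal_def by blast
next
  fix x assume "x \<in> principal_ideal c"
  then obtain y where y: "x = c * y" "vge 0 y"
    unfolding principal_ideal_def integers_def using vge_iff_val[of 0] by (auto simp: zero_ereal_def)
  then show "x \<in> {x. vge (fls_subdegree c) x}" using vge_mult'[OF vge_subdegree[of c] y(2)] by simp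
qed

lemma principal_ideal_0: "principal_ideal 0 = {0}"
  by (auto simp: principal_ideal_def integers_def val_def)

lemma val_principal_ideal:
  fixes c d :: "'k::field fls"
  assumes "principal_ideal c = principal_ideal d" "c \<noteq> 0" shows "val d = val c"
proof -
  have "d \<noteq> 0"
  proof
    assume "d = 0"
    have "{x :: 'k fls. vge (fls_subdegree c) x} = principal_ideal c"
      by (simp only: principal_ideal_eq[OF assms(2)])
    also have "\<dots> = {0}" by (simp only: assms(1) \<open>d = 0\<close> principal_ideal_0)
    finally have "{x :: 'k fls. vge (fls_subdegree c) x} = {0}" .
    then show False using assms(2) vge_subdegree[of c] by blast
  qed
  have "{x :: 'k fls. vge (fls_subdegree c) x} = {x :: 'k fls. vge (fls_subdegree d) x}"
    unfolding principal_ideal_eq[OF assms(2), symmetric] principal_ideal_eq[OF \<open>d \<noteq> 0\<close>, symmetric]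
    by (rule assms(1))
  then have "vge (fls_subdegree c) d" "vge (fls_subdegree d) c" using vge_subdegree by blast+
  then show ?thesis using \<open>d \<noteq> 0\<close> assms(2) by (simp add: val_def vge_def)
qed

text \<open>Principal ideals are linearly ordered by valuation, so the intersection is the ideal of
  an element of maximal valuation, which \<open>h0\<close> provides.\<close>

lemma ideal_val_Inter:
  assumes "vge n (f h0)" "\<And>h. \<not> vge (n + 1) (f h)"
  shows "ideal_val (\<Inter>h. principal_ideal (f h)) = ereal (of_int n)"
proof -
  have nz: "f h \<noteq> 0" for h using assms(2)[of h] by auto
  have sub: "fls_subdegree (f h) \<le> n" for h using assms(2)[of h] by (auto simp: vge_def)
  have h0: "fls_subdegree (f h0) = n" using assms(1) nz[of h0] sub[of h0] by (simp add: vge_def)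
  have "(\<Inter>h. principal_ideal (f h)) = principal_ideal (f h0)"
  proof (intro equalityI subsetI)
    fix x assume "x \<in> principal_ideal (f h0)"
    then have "vge n x" by (simp add: principal_ideal_eq[OF nz] h0)
    then show "x \<in> (\<Inter>h. principal_ideal (f h))"
      using vge_mono[OF _ sub] by (auto simp: principal_ideal_eq[OF nz])
  qed blast
  moreover have "(THE v. \<exists>c. principal_ideal (f h0) = principal_ideal c \<and> v = val c) = val (f h0)"
  proof (rule the_equality)
    show "v = val (f h0)" if "\<exists>c. principal_ideal (f h0) = principal_ideal c \<and> v = val c" for v
      using that val_principal_ideal nz by blast
  qed blast
  ultimately show ?thesis unfolding ideal_val_def using nz h0 by (simp add: val_def)
qed

text \<open>The defect has the odd valuation 1 - 2s, so the floor in the definition is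
  exact.\<close>

lemma t_sep_eq:
  assumes "vge (1 - 2 * s) (h0\<^sup>2 + h0 + b / a\<^sup>2)" "\<And>h. \<not> vge (2 - 2 * s) (h\<^sup>2 + h + b / a\<^sup>2)"
  shows "t_sep a b = s"
proof -
  have "ideal_val (artin_schreier_defect (b / a\<^sup>2)) = ereal (of_int (1 - 2 * s))"
    unfolding artin_schreier_defect_def using assms by (intro ideal_val_Inter) (auto simp: algebra_simps)
  then have "real_of_ereal (ideal_val (artin_schreier_defect (b / a\<^sup>2))) = of_int (1 - 2 * s)" by simp
  then have "(real_of_ereal (ideal_val (artin_schreier_defect (b / a\<^sup>2))) - 1) / 2 = of_int (- s)" by simp
  then show ?thesis unfolding t_sep_def by (simp only: floor_of_int minus_minus)
qed

lemma t_insep_eq: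
  assumes "vge (2 * M + 1) (h0\<^sup>2 + b)" "\<And>h. \<not> vge (2 * M + 2) (h\<^sup>2 + b)"
  shows "t_insep b = M"
proof -
  have "ideal_val (quadratic_defect b) = ereal (of_int (2 * M + 1))"
    unfolding quadratic_defect_def using assms by (intro ideal_val_Inter) (auto simp: algebra_simps)
  then have "real_of_ereal (ideal_val (quadratic_defect b)) = of_int (2 * M + 1)" by simp
  then have "(real_of_ereal (ideal_val (quadratic_defect b)) - 1) / 2 = of_int M" by simp
  then show ?thesis unfolding t_insep_def by (simp only: floor_of_int)
qed

section \<open>Ramification of quadratic extensions\<close>

text \<open>Dividing the monic equation by the top power of x gives -1 = y r(y) for y = 1/x and r
  with coefficients in R, so y in M would put -1 into M. This recognises non-integral elements
  without extending the valuation to a larger field.\<close>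

lemma root_inverse_not_in_ideal:
  fixes x :: "'a::field"
  assumes P: "lead_coeff P = 1" "poly P x = 0" "x \<noteq> 0"
    and R: "\<And>i. Polynomial.coeff P i \<in> R" "0 \<in> R" "\<And>x y. x \<in> R \<Longrightarrow> y \<in> R \<Longrightarrow> x + y \<in> R" "\<And>x y. x \<in> R \<Longrightarrow> y \<in> R \<Longrightarrow> x * y \<in> R"
    and M: "M \<subseteq> R" "\<And>x y. x \<in> M \<Longrightarrow> y \<in> R \<Longrightarrow> x * y \<in> M" "-1 \<notin> M"
  shows "inverse x \<notin> M"
proof
  assume y: "inverse x \<in> M"
  obtain a r where ar: "reflect_poly P = pCons a r" by (rule pCons_cases)
  have "a = 1" using ar P(1) coeff_0_reflect_poly[of P] by simp
  have "Polynomial.coeff r i \<in> R" for i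
  proof -
    have "Polynomial.coeff r i = Polynomial.coeff (reflect_poly P) (Suc i)" by (simp add: ar)
    then show ?thesis using R(1,2) by (simp add: coeff_reflect_poly)
  qed
  then have "poly r (inverse x) \<in> R"
  proof (induction r)
    case 0
    then show ?case using R(2) by simp
  next
    case (pCons c r)
    have "c \<in> R" using pCons.prems[of 0] by simp
    moreover have "Polynomial.coeff r i \<in> R" for i using pCons.prems[of "Suc i"] by simp
    then have "poly r (inverse x) \<in> R" by (rule pCons.IH)
    ultimately show ?case using R(3,4) y M(1) by auto
  qed
  then have "inverse x * poly r (inverse x) \<in> M" using M(2) y by blast
  moreover have "poly (reflect_poly P) (inverse x) = 0"
    using poly_reflect_poly_nz[of "inverse x" P] P(2,3) by simp
  then have "inverse x * poly r (inverse x) = -1" by (simp add: ar \<open>a = 1\<close> eq_neg_iff_add_eq_0 add.commute)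
  ultimately show False using M(3) by simp
qed

lemma vge_divide: "vge m x \<Longrightarrow> \<not> vge (l + 1) y \<Longrightarrow> k \<le> m - l \<Longrightarrow> vge k (x / y)"
  by (cases "x = 0"; cases "y = 0") (auto simp: vge_def fls_divide_subdegree)

lemma vge_1_imp_0: "vge 1 x \<Longrightarrow> vge 0 x"
  by (rule vge_mono) auto

context finite_char2
begin

lemma uminus_ac: "- x = (x :: 'k fls alg_closure)"
proof -
  have "x + x = to_ac (1 + 1) * x" by (simp only: to_ac_add to_ac_1 distrib_right mult_1_left)
  also have "\<dots> = 0" by (simp only: add_self to_ac_0 mult_zero_left)
  finally show ?thesis by (simp add: neg_eq_iff_add_eq_0)
qed

end

section \<open>Integers of a quadratic extension K(w)\<close>

locale quadratic_extension = finite_char2 ty for ty :: "'k::{field,finite} itself" +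
  fixes s u :: "'k fls" and w :: "'k fls alg_closure"
  assumes w: "w * w = to_ac s * w + to_ac u"
    and no_root: "\<And>x. x * x + s * x + u \<noteq> 0"
begin

definition el :: "'k fls \<Rightarrow> 'k fls \<Rightarrow> 'k fls alg_closure" where
  "el p q = to_ac p + to_ac q * w"

lemma el_add: "el p q + el p' q' = el (p + p') (q + q')"
  by (simp add: el_def algebra_simps)

lemma el_mult: "el p q * el p' q' = el (p * p' + u * q * q') (p * q' + q * p' + s * q * q')"
proof -
  have "el p q * el p' q' = to_ac (p * p') + to_ac (p * q' + q * p') * w + to_ac (q * q') * (w * w)"
    by (simp add: el_def algebra_simps)
  also have "\<dots> = el (p * p' + u * q * q') (p * q' + q * p' + s * q * q')"
    unfolding w by (simp add: el_def algebra_simps)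
  finally show ?thesis .
qed

lemma to_ac_el: "to_ac p = el p 0"
  by (simp add: el_def)

lemma el_eq_0_iff: "el p q = 0 \<longleftrightarrow> p = 0 \<and> q = 0"
proof
  assume *: "el p q = 0"
  have "q = 0"
  proof (rule ccontr)
    assume q: "q \<noteq> 0"
    have "to_ac q * w = to_ac p" using * uminus_ac[of "to_ac q * w"] by (simp add: el_def add_eq_0_iff)
    then have "w = to_ac (p / q)" using q by (simp add: field_simps)
    then have "to_ac ((p / q) * (p / q)) = to_ac (s * (p / q) + u)" using w by simp
    then have "(p / q) * (p / q) = s * (p / q) + u" by (simp only: to_ac_eq_iff)
    then have "(p / q) * (p / q) + (s * (p / q) + u) = 0" by (simp only: add_eq_0_iff_eq)
    then show False using no_root[of "p / q"] unfolding add.assoc by contradiction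
  qed
  then show "p = 0 \<and> q = 0" using * by (simp add: el_def)
qed (simp add: el_def)

lemma el_eq_iff: "el p q = el p' q' \<longleftrightarrow> p = p' \<and> q = q'"
proof -
  have "el p q = el p' q' \<longleftrightarrow> el p q + el p' q' = 0"
    using uminus_ac by (metis add_eq_0_iff)
  then show ?thesis by (simp add: el_add el_eq_0_iff add_eq_0_iff_eq)
qed

text \<open>The norm of p + q w, whose conjugate is p + s q + q w in characteristic two.\<close>

definition nrm :: "'k fls \<Rightarrow> 'k fls \<Rightarrow> 'k fls" where
  "nrm p q = p * p + s * p * q + u * q * q"

lemma nrm_nonzero: assumes "p \<noteq> 0 \<or> q \<noteq> 0" shows "nrm p q \<noteq> 0"
proof (cases "q = 0")
  case False
  have "nrm p q = q * q * ((p / q) * (p / q) + s * (p / q) + u)"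
    using False by (simp add: nrm_def field_simps)
  then show ?thesis using no_root[of "p / q"] False by simp
qed (use assms in \<open>simp add: nrm_def\<close>)

lemma inverse_el:
  "inverse (el p q) = el ((p + s * q) / nrm p q) (q / nrm p q)"
proof (cases "p = 0 \<and> q = 0")
  case True
  then show ?thesis by (simp add: el_def)
next
  case False
  then have n: "nrm p q \<noteq> 0" using nrm_nonzero by blast
  have "el p q * el ((p + s * q) / nrm p q) (q / nrm p q) = el (nrm p q / nrm p q) 0"
    unfolding el_mult el_eq_iff
  proof
    show "p * ((p + s * q) / nrm p q) + u * q * (q / nrm p q) = nrm p q / nrm p q"
      by (simp add: nrm_def add_divide_distrib[symmetric] algebra_simps)
    have "p * (q / nrm p q) + q * ((p + s * q) / nrm p q) + s * q * (q / nrm p q) =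
        (p * q + q * (p + s * q) + s * q * q) / nrm p q"
      by (simp add: add_divide_distrib algebra_simps)
    also have "p * q + q * (p + s * q) + s * q * q = 0" by (simp add: char2_simps)
    finally show "p * (q / nrm p q) + q * ((p + s * q) / nrm p q) + s * q * (q / nrm p q) = 0" by simp
  qed
  also have "\<dots> = 1" using n by (simp add: el_def)
  finally show ?thesis by (metis inverse_unique)
qed

definition field_ext :: "'k fls alg_closure set" where
  "field_ext = {el p q | p q. True}"

definition integral_lattice :: "'k fls alg_closure set" where
  "integral_lattice = {el p q | p q. vge 0 p \<and> vge 0 q}"

lemma el_in_field_ext: "el p q \<in> field_ext"
  by (auto simp: field_ext_def)

lemma field_extE:
  assumes "x \<in> field_ext" obtains p q where "x = el p q"
  using assms by (auto simp: field_ext_def)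

text \<open>The two roots are \<theta> and \<theta> + a, and \<theta> generates the same field as
  w.\<close>

lemma splitting_field_eq:
  assumes a: "a \<noteq> 0" and root: "to_ac A + to_ac B * w = \<theta>" "B \<noteq> 0"
    and poly: "\<theta> * \<theta> + to_ac a * \<theta> + to_ac b = 0"
  shows "splitting_field (quad a b) = field_ext"
proof -
  have roots: "poly (map_poly to_ac (quad a b)) x = 0 \<longleftrightarrow> x = \<theta> \<or> x = \<theta> + to_ac a" for x
  proof -
    have "map_poly to_ac (quad a b) = [:to_ac b, to_ac a, 1:]"
      by (simp add: quad_def map_poly_pCons)
    then have "poly (map_poly to_ac (quad a b)) x = to_ac b + x * (to_ac a + x)" by simp
    also have "\<dots> = (x - \<theta>) * (x + \<theta> + to_ac a) + (\<theta> * \<theta> + to_ac a * \<theta> + to_ac b)"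
      by (simp add: algebra_simps)
    finally have "poly (map_poly to_ac (quad a b)) x = (x - \<theta>) * (x + \<theta> + to_ac a)"
      by (simp add: poly)
    moreover have "x + \<theta> + to_ac a = x - (\<theta> + to_ac a)"
      by (metis add.assoc diff_conv_add_uminus uminus_ac)
    ultimately show ?thesis by simp
  qed
  show ?thesis
    unfolding splitting_field_def
  proof (intro equalityI subsetI)
    fix x assume x: "x \<in> \<Inter> {L. range to_ac \<subseteq> L \<and> {x. poly (map_poly to_ac (quad a b)) x = 0} \<subseteq> L \<and>
       (\<forall>x\<in>L. \<forall>y\<in>L. x + y \<in> L \<and> x * y \<in> L) \<and> (\<forall>x\<in>L. inverse x \<in> L)}"
    have "range to_ac \<subseteq> field_ext" using to_ac_el by (auto simp: field_ext_def)
    moreover have "\<theta> = el A B" "\<theta> + to_ac a = el (A + a) B" using root by (simp_all add: el_def)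
    then have "{x. poly (map_poly to_ac (quad a b)) x = 0} \<subseteq> field_ext"
      unfolding roots by (auto simp: field_ext_def)
    moreover have "(\<forall>x\<in>field_ext. \<forall>y\<in>field_ext. x + y \<in> field_ext \<and> x * y \<in> field_ext) \<and> (\<forall>x\<in>field_ext. inverse x \<in> field_ext)"
      by (auto elim!: field_extE simp: el_add el_mult inverse_el el_in_field_ext)
    ultimately show "x \<in> field_ext" using x by blast
  next
    fix x assume "x \<in> field_ext"
    then obtain p q where x: "x = to_ac p + to_ac q * w" by (auto simp: field_ext_def el_def)
    show "x \<in> \<Inter> {L. range to_ac \<subseteq> L \<and> {x. poly (map_poly to_ac (quad a b)) x = 0} \<subseteq> L \<and>
       (\<forall>x\<in>L. \<forall>y\<in>L. x + y \<in> L \<and> x * y \<in> L) \<and> (\<forall>x\<in>L. inverse x \<in> L)}"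
    proof (rule InterI, clarify)
      fix L :: "'k fls alg_closure set"
      assume L: "range to_ac \<subseteq> L" "{x. poly (map_poly to_ac (quad a b)) x = 0} \<subseteq> L"
        "\<forall>x\<in>L. \<forall>y\<in>L. x + y \<in> L \<and> x * y \<in> L"
      have K: "to_ac y \<in> L" for y using L(1) by blast
      have "\<theta> \<in> L" using L(2) roots by blast
      then have "to_ac (1 / B) * (to_ac A + \<theta>) \<in> L" using K L(3) by blast
      moreover have "to_ac A + \<theta> = to_ac (A + A) + to_ac B * w" unfolding root(1)[symmetric] by simp
      then have "to_ac A + \<theta> = to_ac B * w" by (simp only: add_self to_ac_0 add_0)
      then have "to_ac (1 / B) * (to_ac A + \<theta>) = w" using root(2) by simp
      ultimately have "w \<in> L" by simp
      then show "x \<in> L" unfolding x using K L(3) by blast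
    qed
  qed
qed

text \<open>M is the prospective maximal ideal: elements outside the lattice have their inverse in M
  and are not integral by \<open>root_inverse_not_in_ideal\<close>.\<close>

lemma integers_of_field_ext:
  assumes s: "vge 0 s" and u: "vge 0 u"
    and M: "M \<subseteq> integral_lattice" "\<And>x y. x \<in> M \<Longrightarrow> y \<in> integral_lattice \<Longrightarrow> x * y \<in> M" "1 \<notin> M"
    and inv: "\<And>p q. \<not> (vge 0 p \<and> vge 0 q) \<Longrightarrow> inverse (el p q) \<in> M"
  shows "integers_of field_ext = integral_lattice"
proof (intro equalityI subsetI)
  fix x assume "x \<in> integers_of field_ext"
  then obtain P :: "'k fls poly" where x: "x \<in> field_ext" and P: "lead_coeff P = 1"
    "\<forall>i. Polynomial.coeff P i \<in> integers" "poly (map_poly to_ac P) x = 0"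
    by (auto simp: integers_of_def)
  obtain p q where pq: "x = el p q" using x by (auto simp: field_ext_def)
  show "x \<in> integral_lattice"
  proof (rule ccontr)
    assume "x \<notin> integral_lattice"
    then have n: "\<not> (vge 0 p \<and> vge 0 q)" by (auto simp: pq integral_lattice_def)
    then have "x \<noteq> 0" by (auto simp: pq el_eq_0_iff)
    have "inverse x \<notin> M"
    proof (rule root_inverse_not_in_ideal[of "map_poly to_ac P"])
      show "lead_coeff (map_poly to_ac P) = 1"
        using P(1) by (simp add: coeff_map_poly degree_map_poly)
      show "Polynomial.coeff (map_poly to_ac P) i \<in> integral_lattice" for i
      proof -
        have "vge 0 (Polynomial.coeff P i)"
          using P(2) by (simp add: integers_def vge_iff_val zero_ereal_def)
        then have "to_ac (Polynomial.coeff P i) \<in> integral_lattice"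
          unfolding to_ac_el integral_lattice_def using vge_0 by blast
        then show ?thesis by (simp add: coeff_map_poly)
      qed
      show "0 \<in> integral_lattice" using el_eq_0_iff[of 0 0] by (force simp: integral_lattice_def)
      show "x + y \<in> integral_lattice" if "x \<in> integral_lattice" "y \<in> integral_lattice" for x y
        using that by (force simp: integral_lattice_def el_add intro: vge_add)
      show "x * y \<in> integral_lattice" if xy: "x \<in> integral_lattice" "y \<in> integral_lattice" for x y
      proof -
        obtain p q p' q' where "x = el p q" "y = el p' q'" "vge 0 p" "vge 0 q" "vge 0 p'" "vge 0 q'"
          using xy by (auto simp: integral_lattice_def)
        then show ?thesis using s u unfolding integral_lattice_def
          by (auto simp: el_mult intro!: vge_add vge_mult'[where m=0 and n=0] exI)
      qed
      show "- 1 \<notin> M" using M(3) by (simp add: uminus_ac)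
    qed (use P \<open>x \<noteq> 0\<close> M in auto)
    then show False using inv[OF n] pq by blast
  qed
next
  fix x assume "x \<in> integral_lattice"
  then obtain p q where pq: "x = el p q" "vge 0 p" "vge 0 q" by (auto simp: integral_lattice_def)
  \<comment> \<open>The characteristic polynomial of p + q w; its trace is s q because 2p =
    0.\<close>
  define P where "P = quad (s * q) (nrm p q)"
  have "vge 0 (s * q)" using s pq vge_mult'[of 0 s 0 q 0] by simp
  moreover have "vge 0 (nrm p q)" unfolding nrm_def
    using s u pq by (auto intro!: vge_add vge_mult'[where m=0 and n=0])
  moreover have "vge 0 (1 :: 'k fls)" by (simp add: vge_def)
  ultimately have "Polynomial.coeff P i \<in> integers" for i
  proof -
    have "vge 0 (Polynomial.coeff P i)"
      using \<open>vge 0 (s * q)\<close> \<open>vge 0 (nrm p q)\<close> \<open>vge 0 1\<close>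
      by (auto simp: P_def quad_def coeff_pCons split: nat.splits)
    then show ?thesis by (simp add: integers_def vge_iff_val zero_ereal_def)
  qed
  moreover have "lead_coeff P = 1" by (simp add: P_def quad_def)
  moreover have "poly (map_poly to_ac P) x = 0"
  proof -
    have "poly (map_poly to_ac P) x = to_ac (nrm p q) + x * (to_ac (s * q) + x)"
      by (simp add: P_def quad_def map_poly_pCons)
    also have "\<dots> = el (nrm p q) 0 + (el p q * el (s * q) 0 + el p q * el p q)"
      by (simp add: to_ac_el pq distrib_left)
    also have "\<dots> = 0"
      unfolding el_mult el_add el_eq_0_iff by (simp add: nrm_def char2_simps)
    finally show ?thesis .
  qed
  ultimately show "x \<in> integers_of field_ext"
    unfolding integers_of_def field_ext_def using pq(1) by blast
qed

text \<open>The hypothesis on u implies that X^2 + X + u has no zero modulo \<pi>. So the norm is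
  anisotropic modulo \<pi>, its valuation is twice the minimum of those of p and q, and \<pi>
  generates the maximal ideal.\<close>

lemma unramified_ext:
  assumes s: "s = 1" and u: "vge 0 u" "\<And>k. \<not> vge 1 (k * k + k + u)"
  shows "unramified_field field_ext"
proof -
  define unif where "unif = to_ac (fls_X :: 'k fls)"
  have nrm: "\<not> vge (2 * n + 1) (nrm p q)" if pq: "vge n p" "vge n q" "\<not> (vge (n + 1) p \<and> vge (n + 1) q)" for n p q
  proof (cases "vge (n + 1) q")
    case True
    then have "\<not> vge (n + 1) p" using pq by blast
    then have "\<not> vge (2 * n + 1) (p * p)" using not_vge_mult[of n p n p "2 * n + 1"] by simp
    moreover have "vge (2 * n + 1) (p * q)" using vge_mult'[OF pq(1) True, of "2 * n + 1"] by simp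
    moreover have "vge (2 * n + 1) (u * q * q)"
      using vge_mult'[OF vge_mult[OF u(1) True] True, of "2 * n + 1"] by simp
    ultimately show ?thesis unfolding nrm_def by (simp add: s vge_add_cancel)
  next
    case False
    then have q: "q \<noteq> 0" by auto
    have "nrm p q = (q * q) * ((p / q) * (p / q) + (p / q) + u)"
      unfolding nrm_def using q by (simp add: s field_simps)
    moreover have "\<not> vge (2 * n + 1) (q * q)" using False not_vge_mult[of n q n q "2 * n + 1"] by simp
    ultimately show ?thesis
      using not_vge_mult[of "2 * n" "q * q" 0 "(p / q) * (p / q) + (p / q) + u" "2 * n + 1"] u(2)[of "p / q"] by simp
  qed
  define M where "M = {el p q | p q. vge 1 p \<and> vge 1 q}"
  have Ml: "el p q \<in> M \<longleftrightarrow> vge 1 p \<and> vge 1 q" for p q by (auto simp: M_def el_eq_iff)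
  have Rl: "el p q \<in> integral_lattice \<longleftrightarrow> vge 0 p \<and> vge 0 q" for p q
    by (auto simp: integral_lattice_def el_eq_iff)
  have one: "1 = el 1 0" by (simp add: el_def)
  have v1: "\<not> vge 1 (1 :: 'k fls)" "vge 0 (1 :: 'k fls)" by (auto simp: vge_def)
  have mult: "x * y \<in> M" if xy: "x \<in> M" "y \<in> integral_lattice" for x y
  proof -
    obtain p q p' q' where "x = el p q" "y = el p' q'" "vge 1 p" "vge 1 q" "vge 0 p'" "vge 0 q'"
      using xy by (auto simp: integral_lattice_def M_def)
    then have *: "x = el p q" "y = el p' q'" "vge 1 p" "vge 1 q" "vge 0 p'" "vge 0 q'" by auto
    have "vge 1 (p * p')" "vge 1 (u * q * q')" "vge 1 (p * q')" "vge 1 (q * p')" "vge 1 (q * q')"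
      using * u(1) vge_mult'[of 1 p 0 p' 1] vge_mult'[OF vge_mult[of 0 u 1 q], of 0 q' 1]
        vge_mult'[of 1 p 0 q' 1] vge_mult'[of 1 q 0 p' 1] vge_mult'[of 1 q 0 q' 1] by auto
    then show ?thesis by (simp add: * el_mult Ml s vge_add)
  qed
  have int: "integers_of field_ext = integral_lattice"
  proof (rule integers_of_field_ext)
    show "vge 0 s" using s v1 by simp
    show "vge 0 u" by (rule u)
    show "M \<subseteq> integral_lattice" by (auto simp: M_def Rl dest: vge_1_imp_0)
    show "1 \<notin> M" using one Ml v1 by metis
    show "inverse (el p q) \<in> M" if "\<not> (vge 0 p \<and> vge 0 q)" for p q
    proof -
      define n where "n = (if p = 0 then fls_subdegree q else if q = 0 then fls_subdegree p else min (fls_subdegree p) (fls_subdegree q))"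
      have n: "vge n p" "vge n q" "\<not> (vge (n + 1) p \<and> vge (n + 1) q)" "n \<le> -1"
        using that by (auto simp: n_def vge_def)
      have "vge n (p + s * q)" using n s vge_add by simp
      then show ?thesis unfolding inverse_el Ml
        using vge_divide[OF _ nrm[OF n(1-3)]] n by auto
    qed
  qed (use mult in auto)
  show ?thesis
    unfolding unramified_field_def max_ideal_of_def int unif_def[symmetric]
  proof (intro equalityI subsetI)
    fix x assume "x \<in> {x \<in> integral_lattice. \<not> (\<exists>y\<in>integral_lattice. x * y = 1)}"
    then have x: "x \<in> integral_lattice" and nu: "\<And>y. y \<in> integral_lattice \<Longrightarrow> x * y \<noteq> 1" by auto
    obtain p q where pq: "x = el p q" "vge 0 p" "vge 0 q" using x by (auto simp: integral_lattice_def)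
    have "vge 1 p \<and> vge 1 q"
    proof (rule ccontr)
      assume n: "\<not> (vge 1 p \<and> vge 1 q)"
      then have N: "\<not> vge (0 + 1) (nrm p q)" using nrm[of 0 p q] pq by simp
      have "vge 0 (p + s * q)" using pq s vge_add by simp
      then have "inverse (el p q) \<in> integral_lattice"
        unfolding inverse_el Rl using vge_divide[OF _ N] pq by simp
      moreover have "x \<noteq> 0" using n by (auto simp: pq el_eq_0_iff)
      ultimately show False using nu[of "inverse x"] pq by simp
    qed
    then have "vge 0 (p / fls_X)" "vge 0 (q / fls_X)"
      using vge_divide[of 1 _ 1 "fls_X :: 'k fls" 0] by (auto simp: vge_def[of _ "fls_X"])
    then have "el (p / fls_X) (q / fls_X) \<in> integral_lattice" by (simp add: Rl)
    moreover have "x = unif * el (p / fls_X) (q / fls_X)"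
    proof -
      have "fls_X * (y / fls_X) = y" for y :: "'k fls"
        by (simp only: times_divide_eq_right nonzero_mult_div_cancel_left[OF fls_X_nonzero])
      then show ?thesis
        unfolding pq(1) unif_def to_ac_el el_mult el_eq_iff
        by (simp only: mult_zero_left mult_zero_right add_0_left add_0_right simp_thms)
    qed
    ultimately show "x \<in> {unif * y |y. y \<in> integral_lattice}" by blast
  next
    fix x assume "x \<in> {unif * y |y. y \<in> integral_lattice}"
    then obtain y where y: "x = unif * y" "y \<in> integral_lattice" by blast
    have "unif \<in> M" unfolding unif_def to_ac_el Ml by (simp add: vge_def)
    then have xM: "x \<in> M" using mult y by blast
    then have "x \<in> integral_lattice" by (auto simp: M_def Rl dest: vge_1_imp_0)
    moreover have "x * z \<noteq> 1" if "z \<in> integral_lattice" for z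
      using mult[OF xM that] one Ml v1 by metis
    ultimately show "x \<in> {x \<in> integral_lattice. \<not> (\<exists>y\<in>integral_lattice. x * y = 1)}" by blast
  qed
qed

text \<open>Eisenstein case: 2 \<nu>(p) and 2 \<nu>(q) + 1 differ by parity, so the norm has the
  smaller of them as its valuation. Then w is a non-unit that is not divisible by \<pi>.\<close>

lemma ramified_ext:
  assumes s: "vge 1 s" and u: "vge 1 u" "\<not> vge 2 u"
  shows "\<not> unramified_field field_ext"
proof
  assume unr: "unramified_field field_ext"
  define M where "M = {el p q | p q. vge 1 p \<and> vge 0 q}"
  have Ml: "el p q \<in> M \<longleftrightarrow> vge 1 p \<and> vge 0 q" for p q by (auto simp: M_def el_eq_iff)
  have Rl: "el p q \<in> integral_lattice \<longleftrightarrow> vge 0 p \<and> vge 0 q" for p q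
    by (auto simp: integral_lattice_def el_eq_iff)
  have one: "1 = el 1 0" by (simp add: el_def)
  have v1: "\<not> vge 1 (1 :: 'k fls)" "vge 0 (1 :: 'k fls)" by (auto simp: vge_def)
  have s0: "vge 0 s" "vge 0 u" using s u vge_mono[of 1 _ 0] by auto
  have int: "integers_of field_ext = integral_lattice"
  proof (rule integers_of_field_ext[OF s0])
    show "M \<subseteq> integral_lattice" by (auto simp: M_def Rl dest: vge_1_imp_0)
    show "1 \<notin> M" using one Ml v1 by metis
    show "x * y \<in> M" if xy: "x \<in> M" "y \<in> integral_lattice" for x y
    proof -
      obtain p q p' q' where *: "x = el p q" "y = el p' q'" "vge 1 p" "vge 0 q" "vge 0 p'" "vge 0 q'"
        using xy by (auto simp: integral_lattice_def M_def)
      have "vge 1 (p * p')" "vge 1 (u * q * q')" "vge 0 (p * q')" "vge 0 (q * p')" "vge 0 (s * q * q')"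
        using * s0 u(1) vge_mult'[of 1 p 0 p' 1] vge_mult'[OF vge_mult[of 1 u 0 q], of 0 q' 1]
          vge_mult'[of 1 p 0 q' 0] vge_mult'[of 0 q 0 p' 0] vge_mult'[OF vge_mult[of 0 s 0 q], of 0 q' 0] by auto
      then show ?thesis by (simp add: * el_mult Ml vge_add)
    qed
    show "inverse (el p q) \<in> M" if n: "\<not> (vge 0 p \<and> vge 0 q)" for p q
    proof -
      define m where "m = fls_subdegree p"
      define n where "n = fls_subdegree q"
      consider "p \<noteq> 0" "q = 0 \<or> m \<le> n" | "q \<noteq> 0" "p = 0 \<or> n < m" using n by fastforce
      then show ?thesis
      proof cases
        case 1
        have p: "vge m p" "\<not> vge (m + 1) p" using 1 by (auto simp: m_def vge_def)
        have q: "vge m q" using 1 by (auto simp: n_def vge_def)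
        have m: "m \<le> -1" using n 1 by (auto simp: m_def n_def vge_def)
        have "\<not> vge (2 * m + 1) (p * p)" using not_vge_mult[OF p(2) p(2), of "2 * m + 1"] by simp
        moreover have "vge (2 * m + 1) (s * p * q)" using vge_mult'[OF vge_mult[OF s p(1)] q, of "2 * m + 1"] by simp
        moreover have "vge (2 * m + 1) (u * q * q)" using vge_mult'[OF vge_mult[OF u(1) q] q, of "2 * m + 1"] by simp
        ultimately have N: "\<not> vge (2 * m + 1) (nrm p q)" unfolding nrm_def by (simp add: vge_add_cancel)
        have "vge m (p + s * q)" using p vge_mult'[OF s q, of m] vge_add by simp
        then show ?thesis unfolding inverse_el Ml using vge_divide[OF _ N] q m by auto
      next
        case 2
        have q: "vge n q" "\<not> vge (n + 1) q" using 2 by (auto simp: n_def vge_def)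
        have p: "vge (n + 1) p" using 2 by (auto simp: m_def vge_def)
        have m: "n \<le> -1" using n 2 by (auto simp: m_def n_def vge_def)
        have "vge (2 * n + 2) (p * p)" using vge_mult'[OF p p, of "2 * n + 2"] by simp
        moreover have "vge (2 * n + 2) (s * p * q)" using vge_mult'[OF vge_mult[OF s p] q(1), of "2 * n + 2"] by simp
        moreover have "\<not> vge (2 * n + 2) (u * q * q)"
        proof -
          have "\<not> vge (2 * n + 1) (q * q)" using not_vge_mult[OF q(2) q(2), of "2 * n + 1"] by simp
          then show ?thesis using not_vge_mult[of 1 u "2 * n" "q * q" "2 * n + 2"] u(2) by (simp add: mult.assoc)
        qed
        ultimately have "\<not> vge (2 * n + 2) (nrm p q)" unfolding nrm_def by (simp only: vge_add_cancel not_False_eq_True)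
        then have N: "\<not> vge ((2 * n + 1) + 1) (nrm p q)" by (simp add: add.assoc)
        have "vge (n + 1) (p + s * q)" using p vge_mult'[OF s q(1), of "n + 1"] vge_add by simp
        then show ?thesis unfolding inverse_el Ml using vge_divide[OF _ N] q m by auto
      qed
    qed
  qed
  have unr': "{x \<in> integral_lattice. \<not> (\<exists>y\<in>integral_lattice. x * y = 1)} = {to_ac fls_X * y | y. y \<in> integral_lattice}"
    using unr unfolding unramified_field_def max_ideal_of_def int .
  have u0: "u \<noteq> 0" using u(2) by auto
  have "el 0 1 \<in> integral_lattice" using v1 by (simp add: Rl)
  moreover have "el 0 1 * y \<noteq> 1" if yl: "y \<in> integral_lattice" for y
  proof
    assume y1: "el 0 1 * y = 1"
    obtain p q where y: "y = el p q" "vge 0 p" "vge 0 q" using yl by (auto simp: integral_lattice_def)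
    then have "u * q = 1" using y1 unfolding y one el_mult el_eq_iff by simp
    moreover have "vge 1 (u * q)" using vge_mult'[OF u(1) y(3), of 1] by simp
    ultimately show False using v1 by simp
  qed
  ultimately have "el 0 1 \<in> {to_ac fls_X * y | y. y \<in> integral_lattice}" using unr' by blast
  then obtain p q where y: "el 0 1 = to_ac fls_X * el p q" "vge 0 q" by (auto simp: integral_lattice_def)
  then have "fls_X * q = 1" unfolding to_ac_el el_mult el_eq_iff by simp
  moreover have "vge 1 (fls_X * q)" using vge_mult'[of 1 fls_X 0 q 1] y(2) by (simp add: vge_def)
  ultimately show False using v1 by simp
qed

end

context finite_char2
begin

text \<open>With \<open>\<theta>\<close> a root of \<open>X\<^sup>2 + aX + b\<close>, the generator \<open>w = s (\<theta>/a + h)\<close> is a root of \<open>X\<^sup>2 + sX + u\<close>.\<close>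
lemma splitting_field_quad:
  fixes a b h s u :: "'k fls"
  assumes a: "a \<noteq> 0" and s: "s \<noteq> 0" and irr: "\<And>h. h\<^sup>2 + h + b / a\<^sup>2 \<noteq> 0"
    and u: "u = s\<^sup>2 * (h\<^sup>2 + h + b / a\<^sup>2)"
  obtains w where "quadratic_extension s u w"
    "splitting_field (quad a b) = quadratic_extension.field_ext w"
proof -
  obtain \<theta> where th: "poly [:to_ac b, to_ac a, 1:] \<theta> = 0"
    using alg_closed_imp_poly_has_root[of "[:to_ac b, to_ac a, 1:]"] by auto
  then have th: "\<theta> * \<theta> + to_ac a * \<theta> + to_ac b = 0" by (simp add: algebra_simps)
  define w where "w = to_ac (s / a) * \<theta> + to_ac (s * h)"
  have sq: "\<theta> * \<theta> = - (to_ac a * \<theta> + to_ac b)" using th unfolding eq_neg_iff_add_eq_0 add.assoc .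
  have add0: "x + x = 0" for x :: "'k fls alg_closure"
    using uminus_ac[of x] by (simp add: neg_eq_iff_add_eq_0)
  interpret Q: quadratic_extension ty s u w
  proof
    have "w * w = to_ac ((s / a)\<^sup>2) * (\<theta> * \<theta>) + to_ac ((s * h)\<^sup>2) + (to_ac (s / a) * \<theta> * to_ac (s * h) + to_ac (s / a) * \<theta> * to_ac (s * h))"
      by (simp add: w_def algebra_simps power2_eq_square)
    also have "\<dots> = to_ac ((s / a)\<^sup>2) * (to_ac a * \<theta> + to_ac b) + to_ac ((s * h)\<^sup>2)"
      unfolding sq uminus_ac add0 by simp
    also have "\<dots> = to_ac s * (to_ac (s / a) * \<theta>) + to_ac (s\<^sup>2 * b / a\<^sup>2 + (s * h)\<^sup>2)"
      using a by (simp add: field_simps power2_eq_square)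
    also have "to_ac (s / a) * \<theta> = w + to_ac (s * h)"
      unfolding w_def add.assoc add0 by simp
    also have "to_ac s * (w + to_ac (s * h)) + to_ac (s\<^sup>2 * b / a\<^sup>2 + (s * h)\<^sup>2) = to_ac s * w + to_ac u"
      by (simp add: u algebra_simps power2_eq_square)
    finally show "w * w = to_ac s * w + to_ac u" .
    show "k * k + s * k + u \<noteq> 0" for k
    proof -
      have "(k / s + h)\<^sup>2 + (k / s + h) + b / a\<^sup>2 = (k / s) * (k / s) + k / s + (h\<^sup>2 + h + b / a\<^sup>2)"
        by (simp add: char2_simps)
      then have "k * k + s * k + u = s\<^sup>2 * ((k / s + h)\<^sup>2 + (k / s + h) + b / a\<^sup>2)"
        using s by (simp add: u field_simps power2_eq_square)
      then show ?thesis using irr s by simp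
    qed
  qed
  have "splitting_field (quad a b) = Q.field_ext"
  proof (rule Q.splitting_field_eq[OF a _ _ th])
    have "to_ac (a * h) + to_ac (a / s) * w = to_ac (a * h + a * h) + \<theta>"
      using a s by (simp add: w_def distrib_left)
    then show "to_ac (a * h) + to_ac (a / s) * w = \<theta>" by (simp only: add_self) simp
    show "a / s \<noteq> 0" using a s by simp
  qed
  then show ?thesis using that[OF Q.quadratic_extension_axioms] by blast
qed

lemma unramified_quad:
  assumes a: "a \<noteq> 0" and irr: "\<And>h. h\<^sup>2 + h + b / a\<^sup>2 \<noteq> (0::'k fls)"
    and h: "vge 0 (h\<^sup>2 + h + b / a\<^sup>2)" "\<And>h. \<not> vge 1 (h\<^sup>2 + h + b / a\<^sup>2)"
  shows "unramified_poly (quad a b)"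
proof -
  define u where "u = h\<^sup>2 + h + b / a\<^sup>2"
  obtain w where w: "quadratic_extension 1 u w"
    "splitting_field (quad a b) = quadratic_extension.field_ext w"
    using splitting_field_quad[OF a _ irr, of 1 u h] by (auto simp: u_def)
  interpret Q: quadratic_extension ty 1 u w by (rule w)
  have "unramified_field Q.field_ext"
  proof (rule Q.unramified_ext)
    show "vge 0 u" using h(1) by (simp add: u_def)
    have "k * k + k + u = (k + h)\<^sup>2 + (k + h) + b / a\<^sup>2" for k by (simp add: u_def char2_simps)
    then show "\<not> vge 1 (k * k + k + u)" for k using h(2)[of "k + h"] by (simp only: not_False_eq_True)
  qed simp
  then show ?thesis by (simp add: unramified_poly_def w)
qed

lemma ramified_quad:
  assumes a: "a \<noteq> 0" and irr: "\<And>h. h\<^sup>2 + h + b / a\<^sup>2 \<noteq> (0::'k fls)"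
    and n: "1 \<le> n" and h: "vge (1 - 2 * n) (h\<^sup>2 + h + b / a\<^sup>2)" "\<And>h. \<not> vge (2 - 2 * n) (h\<^sup>2 + h + b / a\<^sup>2)"
  shows "ramified_poly (quad a b)"
proof -
  \<comment> \<open>The factor s^2 lifts the valuation 1 - 2n to 1, which makes the polynomial of w
    Eisenstein.\<close>
  define s :: "'k fls" where "s = fls_X_intpow n"
  have s: "s \<noteq> 0" "fls_subdegree s = n" by (simp_all add: s_def)
  define u where "u = s\<^sup>2 * (h\<^sup>2 + h + b / a\<^sup>2)"
  obtain w where w: "quadratic_extension s u w"
    "splitting_field (quad a b) = quadratic_extension.field_ext w"
    using splitting_field_quad[OF a s(1) irr u_def] by metis
  interpret Q: quadratic_extension ty s u w by (rule w)
  have "\<not> unramified_field Q.field_ext"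
  proof (rule Q.ramified_ext)
    show "vge 1 s" using n by (simp add: vge_def s)
    have v: "vge (2 * n) (s\<^sup>2)" "\<not> vge (2 * n + 1) (s\<^sup>2)"
      using s by (auto simp: vge_def power2_eq_square)
    show "vge 1 u" using vge_mult[OF v(1) h(1)] by (simp add: u_def)
    show "\<not> vge 2 u"
      using not_vge_mult[OF v(2), of "1 - 2 * n" "h\<^sup>2 + h + b / a\<^sup>2" 2] h(2)[of h] by (simp add: u_def)
  qed
  then show ?thesis by (simp add: unramified_poly_def w)
qed

end

section \<open>Matrices\<close>

text \<open>The zeros of this form are the fixed points of q on the projective line, that is, its
  eigenlines.\<close>

definition form_of :: "'k::field fls ^ 2 ^ 2 \<Rightarrow> 'k form" where
  "form_of q = (q $ 2 $ 1, trace q, q $ 1 $ 2)"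

lemma trace_2: "trace (q :: 'a::comm_ring_1 ^ 2 ^ 2) = q $ 1 $ 1 + q $ 2 $ 2"
  by (simp add: trace_def sum_2)

lemma lattice_of_iff:
  fixes v :: "'k::field fls ^ 2"
  shows "v \<in> lattice_of a r \<longleftrightarrow> vge 0 (v $ 2) \<and> vge r (v $ 1 - v $ 2 * a)"
proof
  have X: "fls_X_intpow r \<noteq> (0 :: 'k fls)" by simp
  assume "v \<in> lattice_of a r"
  then obtain x y where "v = x *s vector [a, 1] + y *s vector [fls_X_intpow r, 0]" "vge 0 x" "vge 0 y"
    by (auto simp: lattice_of_def integers_def vge_iff_val zero_ereal_def)
  then show "vge 0 (v $ 2) \<and> vge r (v $ 1 - v $ 2 * a)"
    using vge_mult'[of 0 y r "fls_X_intpow r" r] by simp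
next
  assume v: "vge 0 (v $ 2) \<and> vge r (v $ 1 - v $ 2 * a)"
  define y where "y = (v $ 1 - v $ 2 * a) / fls_X_intpow r"
  have y: "y * fls_X_intpow r = v $ 1 - v $ 2 * a"
    unfolding y_def by (rule nonzero_eq_divide_eq[THEN iffD1, OF _ refl]) simp
  have "vge 0 y" unfolding y_def
    using v by (intro vge_divide[of r _ r]) auto
  moreover have "v = (v $ 2) *s vector [a, 1] + y *s vector [fls_X_intpow r, 0]"
    by (simp only: vec_eq_iff forall_2 vector_add_component vector_smult_component vector_2 y) simp
  ultimately show "v \<in> lattice_of a r"
    using v unfolding lattice_of_def integers_def
    by (auto simp: vge_iff_val zero_ereal_def)
qed

lemma min_Fin_0: "min (Fin_length 0) x = Fin_length 0" "min x (Fin_length 0) = Fin_length 0"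
  by (cases x; simp add: min_def)+

lemma min_Two: "min Two_Inf_length x = x" "min x Two_Inf_length = x"
  by (cases x; simp add: min_def)+

text \<open>The length \<open>-2d\<^sub>f\<close>, for \<open>m = M\<^sub>1 + M\<^sub>2\<close>.\<close>
definition overlap :: "'k::field fls \<Rightarrow> int \<Rightarrow> line_length" where
  "overlap R m = (if R = 0 then Two_Inf_length else Fin_length (nat (fls_subdegree R - 2 * m)))"

context finite_char2
begin

text \<open>The four conditions express the integrality of the entries of q in the given basis of
  the lattice; the off-diagonal entries are \<gamma> \<pi>^r and f(a) \<pi>^(-r).\<close>

lemma lattice_stable_iff:
  fixes q :: "'k fls ^ 2 ^ 2"
  shows "(\<forall>v\<in>lattice_of a r. q *v v \<in> lattice_of a r) \<longleftrightarrow>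
    vge 0 (q $ 2 $ 1 * a + q $ 2 $ 2) \<and> vge 0 (q $ 2 $ 1 * a + q $ 1 $ 1) \<and>
    vge (- r) (q $ 2 $ 1) \<and> vge r (feval (form_of q) a)"
proof -
  define \<alpha> \<beta> \<gamma> \<delta> where ents: "\<alpha> = q $ 1 $ 1" "\<beta> = q $ 1 $ 2" "\<gamma> = q $ 2 $ 1" "\<delta> = q $ 2 $ 2"
  have mv: "(q *v v) $ 1 = \<alpha> * v $ 1 + \<beta> * v $ 2" "(q *v v) $ 2 = \<gamma> * v $ 1 + \<delta> * v $ 2" for v
    by (simp_all add: matrix_vector_mult_def sum_2 ents)
  have f: "feval (form_of q) a = \<gamma> * a\<^sup>2 + (\<alpha> + \<delta>) * a + \<beta>" by (simp add: form_of_def trace_2 ents)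
  have c2: "(q *v v) $ 2 = v $ 2 * (\<gamma> * a + \<delta>) + \<gamma> * (v $ 1 - v $ 2 * a)" for v
    unfolding mv by (simp add: char2_simps)
  have c1: "(q *v v) $ 1 - (q *v v) $ 2 * a = (\<gamma> * a + \<alpha>) * (v $ 1 - v $ 2 * a) + v $ 2 * feval (form_of q) a" for v
    unfolding mv f by (simp add: char2_simps)
  show ?thesis
    unfolding ents[symmetric]
  proof
    assume st: "\<forall>v\<in>lattice_of a r. q *v v \<in> lattice_of a r"
    have "vector [a, 1] \<in> lattice_of a r" by (simp add: lattice_of_iff vge_def)
    then have "q *v vector [a, 1] \<in> lattice_of a r" using st by blast
    then have 1: "vge 0 (\<gamma> * a + \<delta>)" "vge r (feval (form_of q) a)"
      unfolding lattice_of_iff c1 unfolding c2 by (simp_all del: feval.simps)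
    have "vector [fls_X_intpow r, 0] \<in> lattice_of a r" by (simp add: lattice_of_iff)
    then have "q *v vector [fls_X_intpow r, 0] \<in> lattice_of a r" using st by blast
    then have 2: "vge 0 (\<gamma> * fls_X_intpow r)" "vge r ((\<gamma> * a + \<alpha>) * fls_X_intpow r)"
      unfolding lattice_of_iff c1 unfolding c2 by (simp_all del: feval.simps)
    have X: "\<not> vge (r + 1) (fls_X_intpow r :: 'k fls)" by simp
    have "vge (- r) \<gamma>"
      using 2(1) not_vge_mult[of "- r - 1" \<gamma> r "fls_X_intpow r" 0] X by auto
    moreover have "vge 0 (\<gamma> * a + \<alpha>)"
      using 2(2) not_vge_mult[of "- 1" "\<gamma> * a + \<alpha>" r "fls_X_intpow r" r] X by auto
    ultimately show "vge 0 (\<gamma> * a + \<delta>) \<and> vge 0 (\<gamma> * a + \<alpha>) \<and> vge (- r) \<gamma> \<and> vge r (feval (form_of q) a)"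
      using 1 by blast
  next
    assume h: "vge 0 (\<gamma> * a + \<delta>) \<and> vge 0 (\<gamma> * a + \<alpha>) \<and> vge (- r) \<gamma> \<and> vge r (feval (form_of q) a)"
    show "\<forall>v\<in>lattice_of a r. q *v v \<in> lattice_of a r"
    proof
      fix v assume "v \<in> lattice_of a r"
      then have v: "vge 0 (v $ 2)" "vge r (v $ 1 - v $ 2 * a)" by (auto simp: lattice_of_iff)
      have "vge 0 (v $ 2 * (\<gamma> * a + \<delta>) + \<gamma> * (v $ 1 - v $ 2 * a))"
      proof (rule vge_add)
        show "vge 0 (v $ 2 * (\<gamma> * a + \<delta>))" by (rule vge_mult'[OF v(1), of 0]) (use h in auto)
        show "vge 0 (\<gamma> * (v $ 1 - v $ 2 * a))" by (rule vge_mult'[OF _ v(2), of "- r"]) (use h in auto)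
      qed
      moreover have "vge r ((\<gamma> * a + \<alpha>) * (v $ 1 - v $ 2 * a) + v $ 2 * feval (form_of q) a)"
      proof (rule vge_add)
        show "vge r ((\<gamma> * a + \<alpha>) * (v $ 1 - v $ 2 * a))" by (rule vge_mult'[OF _ v(2), of 0]) (use h in auto)
        show "vge r (v $ 2 * feval (form_of q) a)" by (rule vge_mult'[OF v(1), of r]) (use h in auto)
      qed
      ultimately show "q *v v \<in> lattice_of a r"
        unfolding lattice_of_iff c1 unfolding c2 by blast
    qed
  qed
qed

text \<open>Given integral trace and determinant, the diagonal entries in a basis of the lattice are
  automatically integral, as the roots of a monic integral polynomial.\<close>
lemma branch_eq_lset:
  fixes q :: "'k fls ^ 2 ^ 2"
  assumes t: "vge 0 (trace q)" and d: "vge 0 (det q)"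
  shows "branch q = lset (form_of q) 0"
proof -
  define \<alpha> \<beta> \<gamma> \<delta> where ents: "\<alpha> = q $ 1 $ 1" "\<beta> = q $ 1 $ 2" "\<gamma> = q $ 2 $ 1" "\<delta> = q $ 2 $ 2"
  have tr: "trace q = \<alpha> + \<delta>" by (simp add: trace_2 ents)
  have dt: "det q = \<alpha> * \<delta> + \<beta> * \<gamma>" by (simp add: det_2 ents diff_eq)
  have F: "form_of q = (\<gamma>, \<alpha> + \<delta>, \<beta>)" by (simp add: form_of_def tr ents)
  have *: "(\<forall>v\<in>lattice_of a r. q *v v \<in> lattice_of a r) \<longleftrightarrow> lev (form_of q) a r 0" for a r
  proof -
    define x y where xy: "x = \<gamma> * a + \<delta>" "y = \<gamma> * a + \<alpha>"
    have sum: "x + y = trace q" by (simp add: xy tr char2_simps)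
    have prod: "x * y = \<gamma> * feval (form_of q) a + det q"
      by (simp add: xy F dt char2_simps)
      have "vge 0 x \<and> vge 0 y" if "vge (- r) \<gamma>" "vge r (feval (form_of q) a)"
    proof -
      have "vge 0 (\<gamma> * feval (form_of q) a)" by (rule vge_mult'[OF that]) simp
      then have p: "vge 0 (x * y)" unfolding prod using d vge_add by blast
      have s: "vge 0 (x + y)" using t sum by simp
      have "vge 0 x \<longleftrightarrow> vge 0 y" using s vge_add_cancel by blast
      then show ?thesis using p vge_mono[OF p, of "- 1"] not_vge_mult[of "- 1" x "- 1" y "- 1"] by auto
    qed
    then show ?thesis
      unfolding lattice_stable_iff ents[symmetric] xy[symmetric]
      using t by (auto simp: F tr simp del: feval.simps)
  qed
  show ?thesis
  proof (intro equalityI subsetI)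
    fix B assume "B \<in> branch q"
    then show "B \<in> lset (form_of q) 0" using * by (auto simp: branch_def max_order_def lset_def)
  next
    fix B assume "B \<in> lset (form_of q) 0"
    then show "B \<in> branch q" using * by (auto simp: branch_def max_order_def lset_def)
  qed
qed

text \<open>For a non-scalar matrix the characteristic polynomial is the only monic quadratic
  polynomial that annihilates it.\<close>

lemma trace_det:
  fixes q :: "'k fls ^ 2 ^ 2"
  assumes ns: "\<And>c. q \<noteq> mat c" and root: "q ** q + mat a ** q + mat b = 0"
  shows "trace q = a" "det q = b" "form_of q \<noteq> (0, 0, 0)"
proof -
  define \<alpha> \<beta> \<gamma> \<delta> where ents: "\<alpha> = q $ 1 $ 1" "\<beta> = q $ 1 $ 2" "\<gamma> = q $ 2 $ 1" "\<delta> = q $ 2 $ 2"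
  have e: "(q ** q + mat a ** q + mat b) $ i $ j = 0" for i j using root by simp
  have e11: "\<alpha> * \<alpha> + \<beta> * \<gamma> + a * \<alpha> + b = 0"
    using e[of 1 1] by (simp add: matrix_matrix_mult_def mat_def sum_2 ents)
  have e12: "\<alpha> * \<beta> + \<beta> * \<delta> + a * \<beta> = 0"
    using e[of 1 2] by (simp add: matrix_matrix_mult_def mat_def sum_2 ents)
  have e21: "\<gamma> * \<alpha> + \<delta> * \<gamma> + a * \<gamma> = 0"
    using e[of 2 1] by (simp add: matrix_matrix_mult_def mat_def sum_2 ents)
  have e22: "\<gamma> * \<beta> + \<delta> * \<delta> + a * \<delta> + b = 0"
    using e[of 2 2] by (simp add: matrix_matrix_mult_def mat_def sum_2 ents)
  have ns': "\<not> (\<beta> = 0 \<and> \<gamma> = 0 \<and> \<alpha> = \<delta>)"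
  proof
    assume "\<beta> = 0 \<and> \<gamma> = 0 \<and> \<alpha> = \<delta>"
    then have "q = mat \<alpha>" by (simp add: vec_eq_iff forall_2 mat_def ents)
    then show False using ns by blast
  qed
  have "\<beta> * (\<alpha> + \<delta> + a) = 0" using e12 by (simp add: algebra_simps)
  moreover have "\<gamma> * (\<alpha> + \<delta> + a) = 0" using e21 by (simp add: algebra_simps)
  \<comment> \<open>The sum of the two diagonal equations. Together with the off-diagonal ones, a
    nonzero \<alpha> + \<delta> + a would make q scalar.\<close>
  moreover have "(\<alpha> + \<delta>) * (\<alpha> + \<delta> + a) =
      (\<alpha> * \<alpha> + \<beta> * \<gamma> + a * \<alpha> + b) + (\<gamma> * \<beta> + \<delta> * \<delta> + a * \<delta> + b)"
    by (simp add: char2_simps)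
  then have "(\<alpha> + \<delta>) * (\<alpha> + \<delta> + a) = 0" unfolding e11 e22 by simp
  ultimately have "\<alpha> + \<delta> + a = 0" using ns' add_eq_0_iff_eq[of \<alpha> \<delta>] by auto
  then have t: "\<alpha> + \<delta> = a" by (simp only: add_eq_0_iff_eq)
  then show "trace q = a" by (simp add: trace_2 ents)
  have "\<alpha> * \<delta> + \<beta> * \<gamma> + b = \<alpha> * \<alpha> + \<beta> * \<gamma> + a * \<alpha> + b"
    unfolding t[symmetric] by (simp add: char2_simps)
  then have "\<alpha> * \<delta> + \<beta> * \<gamma> = b" unfolding e11 by (simp only: add_eq_0_iff_eq)
  then show "det q = b" by (simp add: det_2 ents diff_eq)
  show "form_of q \<noteq> (0, 0, 0)" using ns' add_eq_0_iff_eq[of \<alpha> \<delta>] by (auto simp: form_of_def trace_2 ents)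
qed

text \<open>Adding scalars p and r to two matrices of traces a1 and a2 changes lam by
  \<open>p * a2 + r * a1\<close> and leaves \<open>Delta\<close> invariant.\<close>

lemma Delta_identity:
  fixes a1 a2 B p r x y :: "'k fls"
  shows "(p * a2 + r * a1 + B)\<^sup>2 + a1 * a2 * (p * a2 + r * a1 + B) + a1\<^sup>2 * (r\<^sup>2 + r * a2 + y) +
      a2\<^sup>2 * (p\<^sup>2 + p * a1 + x) = B\<^sup>2 + a1 * a2 * B + a1\<^sup>2 * y + a2\<^sup>2 * x"
  by (simp add: char2_simps)

text \<open>The resultant in the shape of \<open>Delta\<close>, with
  \<open>g1 * b2 + g2 * b1\<close> in the place of lam and the products of the outer coefficients in
  the place of the determinants.\<close>

lemma res_expand:
  "res (g1, t1, b1) (g2, t2, b2 :: 'k fls) =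
    (g1 * b2 + g2 * b1)\<^sup>2 + t1 * t2 * (g1 * b2 + g2 * b1) + t1\<^sup>2 * (b2 * g2) + t2\<^sup>2 * (b1 * g1)"
  by (simp add: char2_simps)

lemma commutator_identities:
  fixes a b c d a' b' c' d' :: "'k fls"
  shows "a * a' + b * c' + (a' * a + b' * c) = c * b' + c' * b"
    "a * b' + b * d' + (a' * b + b' * d) = (a + d) * b' + (a' + d') * b"
    "c * a' + d * c' + (c' * a + d' * c) = c * (a' + d') + c' * (a + d)"
    "c * b' + d * d' + (c' * b + d' * d) = c * b' + c' * b"
  by (simp_all add: char2_simps)

lemma Delta_eq_res:
  fixes q1 q2 :: "'k fls ^ 2 ^ 2"
  assumes lam: "q1 ** mat_bar q2 + q2 ** mat_bar q1 = mat lam"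
  shows "Delta (trace q1) (det q1) (trace q2) (det q2) lam = res (form_of q1) (form_of q2)"
proof -
  define \<alpha> \<beta> \<gamma> t where ents: "\<alpha> = q1 $ 1 $ 1" "\<beta> = q1 $ 1 $ 2" "\<gamma> = q1 $ 2 $ 1" "t = trace q1"
  define \<alpha>' \<beta>' \<gamma>' t' where ents': "\<alpha>' = q2 $ 1 $ 1" "\<beta>' = q2 $ 1 $ 2" "\<gamma>' = q2 $ 2 $ 1" "t' = trace q2"
  define B where "B = \<gamma> * \<beta>' + \<gamma>' * \<beta>"
  have d: "q1 $ 2 $ 2 = \<alpha> + t" "q2 $ 2 $ 2 = \<alpha>' + t'"
    by (simp_all add: ents ents' trace_2 add_self_left)
  have det: "det q1 = \<alpha>\<^sup>2 + \<alpha> * t + \<beta> * \<gamma>" "det q2 = \<alpha>'\<^sup>2 + \<alpha>' * t' + \<beta>' * \<gamma>'"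
    by (simp_all add: det_2 d diff_eq distrib_left power2_eq_square ents(1-3) ents'(1-3))
  have "(q1 ** mat_bar q2 + q2 ** mat_bar q1) $ 1 $ 1 = lam" unfolding lam by (simp add: mat_def)
  then have "lam = \<alpha> * (\<alpha>' + t') + \<beta> * \<gamma>' + (\<alpha>' * (\<alpha> + t) + \<beta>' * \<gamma>)"
    unfolding ents(1-3) ents'(1-3) d(1)[unfolded ents(1), symmetric] d(2)[unfolded ents'(1), symmetric]
    by (simp add: matrix_matrix_mult_def mat_bar_def sum_2)
  \<comment> \<open>Subtracting the scalars \<alpha> and \<alpha>' leaves matrices with upper left
    entry 0, for which B takes the place of lam.\<close>
  then have l: "lam = \<alpha> * t' + \<alpha>' * t + B"
    by (simp add: B_def distrib_left ac_simps add_self_left)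
  show ?thesis
    unfolding Delta_def form_of_def ents(4)[symmetric] ents'(4)[symmetric] ents(2,3)[symmetric] ents'(2,3)[symmetric]
      l det Delta_identity res_expand B_def ..
qed

lemma commute_iff_proportional:
  fixes q1 q2 :: "'k fls ^ 2 ^ 2"
  shows "q1 ** q2 = q2 ** q1 \<longleftrightarrow> proportional (form_of q1) (form_of q2)"
proof -
  define a b c d where ents: "a = q1 $ 1 $ 1" "b = q1 $ 1 $ 2" "c = q1 $ 2 $ 1" "d = q1 $ 2 $ 2"
  define a' b' c' d' where ents': "a' = q2 $ 1 $ 1" "b' = q2 $ 1 $ 2" "c' = q2 $ 2 $ 1" "d' = q2 $ 2 $ 2"
  have "q1 ** q2 = q2 ** q1 \<longleftrightarrow>
      a * a' + b * c' + (a' * a + b' * c) = 0 \<and> a * b' + b * d' + (a' * b + b' * d) = 0 \<and>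
      c * a' + d * c' + (c' * a + d' * c) = 0 \<and> c * b' + d * d' + (c' * b + d' * d) = 0"
    unfolding add_eq_0_iff_eq
    by (simp add: vec_eq_iff forall_2 matrix_matrix_mult_def sum_2 ents ents')
  also have "\<dots> \<longleftrightarrow> c * (a' + d') = c' * (a + d) \<and> (a + d) * b' = (a' + d') * b \<and> c * b' = c' * b"
    unfolding commutator_identities add_eq_0_iff_eq
    by (rule iffI; elim conjE; intro conjI; assumption)
  finally show ?thesis by (simp add: form_of_def trace_2 ents ents')
qed

section \<open>Shapes of stems and their intersection with a second stem\<close>

definition point_form :: "'k form \<Rightarrow> int \<Rightarrow> bool" where
  "point_form F M \<longleftrightarrow> (\<exists>B\<in>vertices. lset F M = {B})"

text \<open>The last two clauses record that M is the maximal level and that the reduced form has no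
  middle term, as \<open>res_exact\<close> requires.\<close>

definition edge_form :: "'k form \<Rightarrow> int \<Rightarrow> bool" where
  "edge_form F M \<longleftrightarrow> (\<exists>B C. adj B C \<and> lset F M = {B, C}) \<and> lset F (M + 1) = {} \<and> vge (M + 1) (mid F)"

text \<open>A common description of both kinds of axis, with one zero at infinity or two finite
  zeros: p is the axis, A and C are the outer coefficients of F2 in coordinates given by the zeros
  of F.\<close>

definition split_form :: "'k form \<Rightarrow> int \<Rightarrow> bool" where
  "split_form F M \<longleftrightarrow> mid F \<noteq> 0 \<and> M = fls_subdegree (mid F) \<and>
     (\<exists>p. nb_walk UNIV p \<and> lset F M = range p \<and>
        (\<forall>F2. \<exists>A C. res F F2 = (mid F)\<^sup>2 * A * C \<and>
          (\<forall>i m. p i \<in> lset F2 m \<longleftrightarrow> vge (m - i) A \<and> vge m (mid F2) \<and> vge (m + i) C) \<and>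
          (A = 0 \<and> C = 0 \<longleftrightarrow> proportional F F2)))"

lemma split_form_infinite:
  assumes "t \<noteq> 0" shows "split_form (0, t, b) (fls_subdegree t)"
proof -
  note * = split_axis_infinite[OF assms, of b]
  show ?thesis
    unfolding split_form_def fst_conv snd_conv
    by (intro conjI assms refl exI[of _ "cball_val (b / t)"] allI *)
qed

lemma split_form_finite:
  assumes "g \<noteq> 0" "x1 \<noteq> x2"
  shows "split_form (g, g * (x1 + x2), g * x1 * x2) (fls_subdegree (g * (x1 + x2)))"
proof -
  note * = split_axis_finite[OF assms]
  have "g * (x1 + x2) \<noteq> 0" using assms add_eq_0_iff_eq by simp
  then show ?thesis
    unfolding split_form_def fst_conv snd_conv
    by (intro conjI refl exI[of _ "\<lambda>i. if 0 \<le> i then cball_val x1 (fls_subdegree (x1 + x2) + i)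
        else cball_val x2 (fls_subdegree (x1 + x2) - i)"] allI *)
qed

lemma point_meet:
  assumes "point_form F1 M1" "lset F1 M1 \<inter> lset F2 M2 \<noteq> {}"
  shows "is_line (lset F1 M1 \<inter> lset F2 M2) (Fin_length 0)"
proof -
  obtain B where B: "B \<in> vertices" "lset F1 M1 = {B}" using assms(1) by (auto simp: point_form_def)
  then have "lset F1 M1 \<inter> lset F2 M2 = {B}" using assms(2) by auto
  then show ?thesis using is_line_singleton[OF B(1)] by simp
qed

text \<open>The length is capped at 1, so it only matters whether the resultant exceeds its minimal
  valuation 2 (M1 + M2).\<close>

lemma edge_meet:
  assumes "edge_form F1 M1" "lset F1 M1 \<inter> lset F2 M2 \<noteq> {}" and l: "Fin_length 1 \<le> l"
  shows "is_line (lset F1 M1 \<inter> lset F2 M2) (min (overlap (res F1 F2) (M1 + M2)) (min (Fin_length 1) l))"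
proof -
  obtain B C where BC: "adj B C" "lset F1 M1 = {B, C}" and *: "lset F1 (M1 + 1) = {}" "vge (M1 + 1) (mid F1)"
    using assms(1) by (auto simp: edge_form_def)
  have l1: "min (Fin_length 1) l = Fin_length 1" using l by (simp add: min_def)
  obtain D where D: "D \<in> lset F1 M1" "D \<in> lset F2 M2" using assms(2) by blast
  then have v: "vge (2 * (M1 + M2)) (res F1 F2)" by (rule res_vge)
  from edge_intersection[OF BC(2,1) * assms(2)] show ?thesis
  proof
    assume h: "is_line (lset F1 M1 \<inter> lset F2 M2) (Fin_length 0) \<and> \<not> vge (2 * (M1 + M2) + 1) (res F1 F2)"
    then have "res F1 F2 \<noteq> 0 \<and> fls_subdegree (res F1 F2) = 2 * (M1 + M2)"
      using v fls_subdegree_eqI_vge by blast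
    then have "overlap (res F1 F2) (M1 + M2) = Fin_length 0" by (simp add: overlap_def)
    then show ?thesis using h by (simp only: min_Fin_0)
  next
    assume h: "is_line (lset F1 M1 \<inter> lset F2 M2) (Fin_length 1) \<and> vge (2 * (M1 + M2) + 1) (res F1 F2)"
    then have "Fin_length 1 \<le> overlap (res F1 F2) (M1 + M2)" by (auto simp: overlap_def vge_def)
    then show ?thesis using h unfolding l1 by (simp add: min_absorb2)
  qed
qed

text \<open>The positions on the axis that satisfy both bounds run from M2 - \<nu>(A) to \<nu>(C) -
  M2. The length of this interval is \<nu>(res) - 2 (M1 + M2) because M1 = \<nu>(mid F1). If A or C
  vanishes, the interval is unbounded on one side.\<close>

lemma split_meet:
  assumes sp: "split_form F1 M1" and ne: "lset F1 M1 \<inter> lset F2 M2 \<noteq> {}" and mid: "vge M2 (mid F2)"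
  shows "if res F1 F2 = 0
     then is_line (lset F1 M1 \<inter> lset F2 M2) (if proportional F1 F2 then Two_Inf_length else Inf_length)
     else is_line (lset F1 M1 \<inter> lset F2 M2) (overlap (res F1 F2) (M1 + M2))"
proof -
  obtain p A C where p: "nb_walk UNIV p" "lset F1 M1 = range p" and res: "res F1 F2 = (mid F1)\<^sup>2 * A * C"
    and mem: "\<And>i m. p i \<in> lset F2 m \<longleftrightarrow> vge (m - i) A \<and> vge m (mid F2) \<and> vge (m + i) C"
    and pr: "A = 0 \<and> C = 0 \<longleftrightarrow> proportional F1 F2"
    using sp unfolding split_form_def by meson
  have t: "mid F1 \<noteq> 0" "M1 = fls_subdegree (mid F1)" using sp by (auto simp: split_form_def)
  have eq: "lset F1 M1 \<inter> lset F2 M2 = p ` {i. vge (M2 - i) A \<and> vge (M2 + i) C}"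
    unfolding p(2) using mem mid by auto
  consider "A = 0" "C = 0" | "A = 0" "C \<noteq> 0" | "A \<noteq> 0" "C = 0" | "A \<noteq> 0" "C \<noteq> 0" by blast
  then show ?thesis
  proof cases
    case 1
    then show ?thesis using res pr nb_walk_line[OF p(1)] unfolding eq by simp
  next
    case 2
    then have "{i. vge (M2 - i) A \<and> vge (M2 + i) C} = {..fls_subdegree C - M2}" by (auto simp: vge_def)
    then show ?thesis using 2 res pr nb_walk_ray'[OF p(1)] unfolding eq by simp
  next
    case 3
    then have "{i. vge (M2 - i) A \<and> vge (M2 + i) C} = {M2 - fls_subdegree A..}" by (auto simp: vge_def)
    then show ?thesis using 3 res pr nb_walk_ray[OF p(1)] unfolding eq by simp
  next
    case 4
    define i where "i = M2 - fls_subdegree A"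
    define j where "j = fls_subdegree C - M2"
    have I: "{i. vge (M2 - i) A \<and> vge (M2 + i) C} = {i..j}" using 4 by (auto simp: vge_def i_def j_def)
    have "i \<le> j" using ne unfolding eq I by auto
    have sub: "fls_subdegree (res F1 F2) - 2 * (M1 + M2) = j - i" "res F1 F2 \<noteq> 0"
      using 4 t by (simp_all add: res i_def j_def power2_eq_square)
    then show ?thesis using nb_walk_segment[OF p(1) \<open>i \<le> j\<close>] unfolding eq I by (simp add: overlap_def)
  qed
qed

end

text \<open>Translation by 1 permutes the elements, so their sum does not change when 1 is added to
  each.\<close>

lemma of_nat_CARD: "of_nat CARD('k) = (0 :: 'k::{finite,ring_1})"
proof -
  have "(\<Sum>x\<in>UNIV. x) = (\<Sum>x\<in>UNIV. x + (1 :: 'k))"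
    by (rule sum.reindex_bij_witness[of _ "\<lambda>x. x + 1" "\<lambda>x. x - 1"]) auto
  then show ?thesis by (simp add: sum.distrib)
qed

lemma quad_eq_iff: "quad a b = quad c d \<longleftrightarrow> a = c \<and> b = d"
  by (auto simp: quad_def)

lemma quad_class_iff:
  "quad a b \<in> sep_class_A \<longleftrightarrow> a \<noteq> 0 \<and> (\<not> irred_poly (quad a b) \<or> unramified_poly (quad a b))"
  "quad a b \<in> sep_class_B \<longleftrightarrow> a \<noteq> 0 \<and> irred_poly (quad a b) \<and> ramified_poly (quad a b)"
  "quad a b \<in> insep_class_A \<longleftrightarrow> a = 0 \<and> \<not> irred_poly (quad a b)"
  "quad a b \<in> insep_class_B \<longleftrightarrow> a = 0 \<and> irred_poly (quad a b)"
  "quad a b \<in> reducible_sep \<longleftrightarrow> a \<noteq> 0 \<and> \<not> irred_poly (quad a b)"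
  by (auto simp: sep_class_A_def sep_class_B_def insep_class_A_def insep_class_B_def reducible_sep_def quad_eq_iff)

lemma integers_iff: "x \<in> integers \<longleftrightarrow> vge 0 x"
  by (simp add: integers_def vge_iff_val zero_ereal_def)

lemma fake_distance_eq:
  assumes "M1 = fls_subdegree (e_coeff a1) + c_coeff a1 b1" "M2 = fls_subdegree (e_coeff a2) + c_coeff a2 b2"
    and "R = Delta a1 b1 a2 b2 lam"
  shows "fake_distance a1 b1 a2 b2 lam =
    (if R = 0 then - \<infinity> else ereal (of_int (M1 + M2) - of_int (fls_subdegree R) / 2))"
proof (cases "R = 0")
  case True
  then show ?thesis by (simp add: fake_distance_def assms(3)[symmetric] val_def)
next
  case False
  define e where "e = (e_coeff a1)\<^sup>2 * (e_coeff a2)\<^sup>2"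
  have e: "e \<noteq> 0" by (simp add: e_def e_coeff_def)
  have "fls_subdegree e = 2 * fls_subdegree (e_coeff a1) + 2 * fls_subdegree (e_coeff a2)"
    using e by (simp add: e_def power2_eq_square)
  moreover have "fls_subdegree (R / e) = fls_subdegree R - fls_subdegree e"
    using e False by (simp add: fls_divide_subdegree)
  ultimately have v: "val (R / e) = ereal (of_int (fls_subdegree R) - 2 * of_int (fls_subdegree (e_coeff a1)) - 2 * of_int (fls_subdegree (e_coeff a2)))"
    using e False by (simp add: val_def)
  show ?thesis
    unfolding fake_distance_def assms(3)[symmetric] e_def[symmetric] v
    using False by (simp add: assms(1,2) field_simps)
qed

context finite_char2
begin

section \<open>Classification of the stem of a matrix\<close>

lemma thick_stem:
  fixes F :: "'k form"
  assumes "branch q = lset F 0" "lset F M \<noteq> {}" "is_line (lset F M) len" "0 \<le> M"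
  shows "stem q = lset F M" "stem_length q = len"
proof -
  have "branch q = thicken (lset F M) (nat M)" using thicken_lset[OF assms(2), of "nat M"] assms(1,4) by simp
  then show "stem q = lset F M" "stem_length q = len" using stem_thick_line[OF assms(3)] by auto
qed

text \<open>Each geometric shape is paired with the polynomial classes on which the exceptional
  cases of the theorem depend.\<close>

definition stem_type :: "'k fls ^ 2 ^ 2 \<Rightarrow> 'k fls poly \<Rightarrow> int \<Rightarrow> bool" where
  "stem_type q m M \<longleftrightarrow>
     point_form (form_of q) M \<and> stem_length q = Fin_length 0 \<and> m \<notin> insep_class_A \<and> m \<notin> reducible_sep \<or>
     edge_form (form_of q) M \<and> stem_length q = Fin_length 1 \<and> m \<notin> insep_class_A \<and> m \<notin> reducible_sep \<or>
     horo (form_of q) \<and> M = 0 \<and> stem_length q = Inf_length \<and> m \<in> insep_class_A \<and> m \<notin> reducible_sep \<or>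
     split_form (form_of q) M \<and> stem_length q = Two_Inf_length \<and> m \<notin> insep_class_A \<and> m \<in> reducible_sep"

lemma point_formI:
  fixes F :: "'k form"
  assumes "branch q = lset F 0" "lset F M = {cball_val x r}" "0 \<le> M"
  shows "stem q = lset F M" "stem_length q = Fin_length 0" "point_form F M"
proof -
  have "is_line (lset F M) (Fin_length 0)" unfolding assms(2) by (rule is_line_singleton) simp
  then show "stem q = lset F M" "stem_length q = Fin_length 0" using thick_stem assms by blast+
  show "point_form F M" unfolding point_form_def using assms(2) cball_val_in_vertices by blast
qed

lemma edge_formI:
  fixes F :: "'k form"
  assumes "branch q = lset F 0" "lset F M = {cball_val x r, cball_val x (r + 1)}" "0 \<le> M"
    "lset F (M + 1) = {}" "vge (M + 1) (mid F)"
  shows "stem q = lset F M" "stem_length q = Fin_length 1" "edge_form F M"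
proof -
  have "is_line (lset F M) (Fin_length 1)" unfolding assms(2) by (rule is_line_edge[OF adj_cball_Suc])
  then show "stem q = lset F M" "stem_length q = Fin_length 1" using thick_stem assms by blast+
  show "edge_form F M" unfolding edge_form_def using assms adj_cball_Suc by blast
qed

text \<open>For irreducible polynomials the extremal values found in the analysis of the defects are
  carried over to the form. Reducible ones give a form with zeros on the projective line over K: a
  double zero in the inseparable case, two distinct zeros in the separable one.\<close>

lemma stem_classification:
  fixes q :: "'k fls ^ 2 ^ 2"
  assumes ns: "\<And>c. q \<noteq> mat c" and root: "q ** q + mat a ** q + mat b = 0"
    and int: "a \<in> integers" "b \<in> integers"
  obtains M where "M = fls_subdegree (e_coeff a) + c_coeff a b" "stem q = lset (form_of q) M"
    "lset (form_of q) M \<noteq> {}" "vge M (mid (form_of q))" "stem_type q (quad a b) M"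
proof -
  note td = trace_det[OF ns root]
  define g \<alpha> \<beta> where gab: "g = q $ 2 $ 1" "\<alpha> = q $ 1 $ 1" "\<beta> = q $ 1 $ 2"
  have F: "form_of q = (g, a, \<beta>)" by (simp add: form_of_def td(1) gab)
  have va: "vge 0 a" and vb: "vge 0 b" using int by (auto simp: integers_iff)
  have br: "branch q = lset (g, a, \<beta>) 0"
    unfolding F[symmetric] using va vb by (intro branch_eq_lset) (simp_all add: td)
  have b: "b = \<alpha>\<^sup>2 + \<alpha> * a + \<beta> * g"
    unfolding td(2)[symmetric] td(1)[symmetric] by (simp add: det_2 trace_2 gab char2_simps)
  \<comment> \<open>The right-hand side is the minimal polynomial at g x + \<alpha>.\<close>
  have gf: "g * feval (g, a, \<beta>) x = (g * x + \<alpha>)\<^sup>2 + a * (g * x + \<alpha>) + b" for x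
    unfolding b by (simp add: char2_simps)
  have nz: "g \<noteq> 0 \<or> a \<noteq> 0 \<or> \<beta> \<noteq> 0" using td(3) F by auto
  show ?thesis
  proof (cases "irred_poly (quad a b)")
    case irr: True
    then have nr: "y\<^sup>2 + a * y + b \<noteq> 0" for y by (simp add: irred_quad_iff)
    have g: "g \<noteq> 0" using gf[of 0] nr[of \<alpha>] by auto
    \<comment> \<open>As g \<noteq> 0, every y is of the form g x + \<alpha>, so the products take
      all values of the polynomial.\<close>
    have y_eq: "g * feval (g, a, \<beta>) ((y + \<alpha>) / g) = y\<^sup>2 + a * y + b" for y
    proof -
      have "g * ((y + \<alpha>) / g) = y + \<alpha>" using g by simp
      then have "g * ((y + \<alpha>) / g) + \<alpha> = y" by (simp add: add.assoc add_self)
      then show ?thesis by (simp only: gf)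
    qed
    have cls: "quad a b \<notin> insep_class_A" "quad a b \<notin> reducible_sep"
      using irr by (simp_all add: quad_class_iff)
    show ?thesis
    proof (cases "a = 0")
      case False
      define \<tau> where "\<tau> = fls_subdegree a"
      have va2: "vge (2 * \<tau>) (a\<^sup>2)" "\<not> vge (2 * \<tau> + 1) (a\<^sup>2)" and \<tau>: "vge \<tau> a"
        using False by (auto simp: vge_def \<tau>_def power2_eq_square)
      have \<tau>0: "0 \<le> \<tau>" using va False by (simp add: vge_def \<tau>_def)
      have scale: "(a * h)\<^sup>2 + a * (a * h) + b = a\<^sup>2 * (h\<^sup>2 + h + b / a\<^sup>2)" for h
        using False by (simp add: field_simps power2_eq_square)
      have nr': "h\<^sup>2 + h + b / a\<^sup>2 \<noteq> 0" for h using nr[of "a * h"] unfolding scale by auto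
      have lower: "vge n (h\<^sup>2 + h + b / a\<^sup>2) \<Longrightarrow> vge (2 * \<tau> + n) (g * feval (g, a, \<beta>) ((a * h + \<alpha>) / g))" for n h
        unfolding y_eq scale using va2(1) by (rule vge_mult)
      have upper: "\<not> vge (2 * \<tau> + (n + 1)) (g * feval (g, a, \<beta>) x)"
        if "\<And>h. \<not> vge (n + 1) (h\<^sup>2 + h + b / a\<^sup>2)" for n x
      proof -
        define h where "h = (g * x + \<alpha>) / a"
        have "g * x + \<alpha> = a * h" using False by (simp add: h_def)
        then show ?thesis unfolding gf
          using not_vge_mult[OF va2(2) that[of h], of "2 * \<tau> + (n + 1)"] by (simp only: scale) simp
      qed
      have e: "e_coeff a = a" using False by (simp add: e_coeff_def)
      show ?thesis
      proof (cases rule: artin_schreier_cases[OF nr', case_names unit odd])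
        case (unit h)
        have S: "lset (g, a, \<beta>) \<tau> = {cball_val ((a * h + \<alpha>) / g) (\<tau> - fls_subdegree g)}"
        proof (rule point_lset[OF \<tau> g])
          show "vge (2 * \<tau>) (g * feval (g, a, \<beta>) ((a * h + \<alpha>) / g))" using lower[OF unit(1)] by simp
          show "\<not> vge (2 * \<tau> + 1) (g * feval (g, a, \<beta>) x)" for x using upper[of 0 x] unit(2) by simp
        qed
        have "unramified_poly (quad a b)" by (rule unramified_quad[OF False nr' unit])
        then have c: "c_coeff a b = 0" using False by (simp add: c_coeff_def quad_class_iff)
        note P = point_formI[OF br S \<tau>0]
        show ?thesis
        proof (rule that[of \<tau>])
          show "stem_type q (quad a b) \<tau>" unfolding stem_type_def F using P(2,3) cls by blast
          show "lset (form_of q) \<tau> \<noteq> {}" unfolding F S by blast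
          show "stem q = lset (form_of q) \<tau>" unfolding F by (rule P(1))
        qed (use e c \<tau> in \<open>simp_all add: \<tau>_def F\<close>)
      next
        case (odd h n)
        \<comment> \<open>The largest valuation 2 \<tau> + (1 - 2n) of a value is written as 2M +
          1.\<close>
        define M where "M = \<tau> - n"
        have up: "\<not> vge (2 * M + 2) (g * feval (g, a, \<beta>) x)" for x
          using upper[of "1 - 2 * n" x] odd(3) by (simp add: M_def algebra_simps)
        have lo: "vge (2 * M + 1) (g * feval (g, a, \<beta>) ((a * h + \<alpha>) / g))"
          using lower[OF odd(2)] by (simp add: M_def algebra_simps)
        have t: "vge (M + 1) a" using vge_mono[OF \<tau>, of "M + 1"] odd(1) by (simp add: M_def)
        note S = edge_lset[OF t g lo up]
        \<comment> \<open>The value at y = 0 is the integral element b. It has valuation below 2M +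
          2, hence M \<ge> 0.\<close>
        have "g * feval (g, a, \<beta>) ((0 + \<alpha>) / g) = b" unfolding y_eq by simp
        then have "\<not> vge (2 * M + 2) b" using up by metis
        then have M0: "0 \<le> M" using vge_mono[OF vb, of "2 * M + 2"] by fastforce
        have mx: "lset (g, a, \<beta>) (M + 1) = {}" using up by (intro lset_empty) simp
        have "ramified_poly (quad a b)" by (rule ramified_quad[OF False nr' odd])
        then have c: "c_coeff a b = - n"
          using False irr t_sep_eq[OF odd(2,3)] by (simp add: c_coeff_def quad_class_iff)
        have mid: "vge (M + 1) (mid (g, a, \<beta>))" using t by simp
        note P = edge_formI[OF br S M0 mx mid]
        show ?thesis
        proof (rule that[of M])
          show "stem_type q (quad a b) M" unfolding stem_type_def F using P(2,3) cls by blast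
          show "lset (form_of q) M \<noteq> {}" unfolding F S by blast
          show "stem q = lset (form_of q) M" unfolding F by (rule P(1))
          show "M = fls_subdegree (e_coeff a) + c_coeff a b" by (simp add: e c M_def \<tau>_def)
          show "vge M (mid (form_of q))" using vge_mono[OF t, of M] by (simp add: F)
        qed
      qed
    next
      case True
      have nr': "y\<^sup>2 + b \<noteq> 0" for y using nr[of y] True by simp
      obtain h M where hM: "vge (2 * M + 1) (h\<^sup>2 + b)" "\<And>h. \<not> vge (2 * M + 2) (h\<^sup>2 + b)"
        using insep_odd[OF nr'] by metis
      have up: "\<not> vge (2 * M + 2) (g * feval (g, a, \<beta>) x)" for x
        unfolding gf using hM(2)[of "g * x + \<alpha>"] True by simp
      have lo: "vge (2 * M + 1) (g * feval (g, a, \<beta>) ((h + \<alpha>) / g))"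
        unfolding y_eq using hM(1) True by simp
      have t: "vge (M + 1) a" using True by simp
      note S = edge_lset[OF t g lo up]
      have "\<not> vge (2 * M + 2) b" using hM(2)[of 0] by simp
      then have M0: "0 \<le> M" using vge_mono[OF vb, of "2 * M + 2"] by fastforce
      have mx: "lset (g, a, \<beta>) (M + 1) = {}" using up by (intro lset_empty) simp
      have c: "c_coeff a b = M"
        using True irr t_insep_eq[OF hM] by (simp add: c_coeff_def quad_class_iff)
      have mid: "vge (M + 1) (mid (g, a, \<beta>))" using t by simp
      note P = edge_formI[OF br S M0 mx mid]
      show ?thesis
      proof (rule that[of M])
        show "stem_type q (quad a b) M" unfolding stem_type_def F using P(2,3) cls by blast
        show "lset (form_of q) M \<noteq> {}" unfolding F S by blast
        show "stem q = lset (form_of q) M" unfolding F by (rule P(1))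
        show "M = fls_subdegree (e_coeff a) + c_coeff a b" using c True by (simp add: e_coeff_def)
        show "vge M (mid (form_of q))" using True by (simp add: F)
      qed
    qed
  next
    case red: False
    then obtain y where y: "y\<^sup>2 + a * y + b = 0" by (auto simp: irred_quad_iff)
    define x where "x = (y + \<alpha>) / g"
    have x_root: "\<beta> = g * x\<^sup>2 + a * x" if g: "g \<noteq> 0"
    proof -
      have "g * x = y + \<alpha>" using g by (simp add: x_def)
      then have "g * x + \<alpha> = y" by (simp add: add.assoc add_self)
      then have "g * feval (g, a, \<beta>) x = 0" unfolding gf using y by simp
      then have "g * x\<^sup>2 + a * x + \<beta> = 0" using g by simp
      then show ?thesis by (simp add: add_eq_0_iff_eq)
    qed
    show ?thesis
    proof (cases "a = 0")
      case True
      have h: "horo (form_of q)"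
      proof (cases "g = 0")
        case True
        then show ?thesis using nz \<open>a = 0\<close> by (simp add: F horo_def)
      next
        case False
        then show ?thesis using x_root True by (auto simp: F horo_def)
      qed
      have fo: "infinite_foliage (branch q)" using horo_foliage[OF h] br F by simp
      have "quad a b \<in> insep_class_A" "quad a b \<notin> reducible_sep" using red True by (simp_all add: quad_class_iff)
      moreover have "stem_length q = Inf_length" using fo by (simp add: stem_length_def)
      ultimately have st: "stem_type q (quad a b) 0" using h by (simp add: stem_type_def)
      have c: "c_coeff a b = 0" using \<open>quad a b \<in> insep_class_A\<close> by (simp add: c_coeff_def)
      show ?thesis
      proof (rule that[of 0])
        show "stem q = lset (form_of q) 0" unfolding stem_def if_P[OF fo] F by (rule br)
        show "lset (form_of q) 0 \<noteq> {}" by (rule horo_nonempty[OF h])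
      qed (use True c st in \<open>simp_all add: e_coeff_def F\<close>)
    next
      case False
      define \<tau> where "\<tau> = fls_subdegree a"
      have sp: "split_form (g, a, \<beta>) \<tau>"
      proof (cases "g = 0")
        case True
        then show ?thesis using split_form_infinite[OF False] by (simp add: \<tau>_def)
      next
        case g: False
        \<comment> \<open>The other zero of the form, the sum of the zeros being a/g.\<close>
        define x' where "x' = x + a / g"
        have "x \<noteq> x'" using False g by (simp add: x'_def)
        moreover have "x + x' = a / g" by (simp add: x'_def add_self_left)
        moreover have "g * x * x' = \<beta>" using g x_root[OF g] by (simp add: x'_def field_simps power2_eq_square)
        ultimately show ?thesis using split_form_finite[OF g, of x x'] g by (simp add: \<tau>_def)
      qed
      have \<tau>0: "0 \<le> \<tau>" using va False by (simp add: vge_def \<tau>_def)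
      obtain p where p: "nb_walk UNIV p" "lset (g, a, \<beta>) \<tau> = range p" using sp by (auto simp: split_form_def)
      have ne: "lset (g, a, \<beta>) \<tau> \<noteq> {}" unfolding p(2) by blast
      have "is_line (lset (g, a, \<beta>) \<tau>) Two_Inf_length" unfolding p(2) by (rule nb_walk_line[OF p(1)])
      note st = thick_stem[OF br ne this \<tau>0]
      have cls: "quad a b \<notin> insep_class_A" "quad a b \<in> reducible_sep" "quad a b \<in> sep_class_A"
        using red False by (simp_all add: quad_class_iff)
      show ?thesis
      proof (rule that[of \<tau>])
        show "stem_type q (quad a b) \<tau>" unfolding stem_type_def F using st(2) sp cls by blast
        show "lset (form_of q) \<tau> \<noteq> {}" unfolding F by (rule ne)
        show "stem q = lset (form_of q) \<tau>" unfolding F by (rule st(1))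
        show "\<tau> = fls_subdegree (e_coeff a) + c_coeff a b"
          using False cls by (simp add: \<tau>_def e_coeff_def c_coeff_def)
        show "vge \<tau> (mid (form_of q))" by (simp add: F \<tau>_def vge_subdegree)
      qed
    qed
  qed
qed

lemma subgraph_dist_disjoint:
  assumes ne: "lset (F1 :: 'k form) M1 \<noteq> {}" "lset F2 M2 \<noteq> {}" and disj: "lset F1 M1 \<inter> lset F2 M2 = {}"
  obtains k :: nat where "k > 0" "subgraph_dist (lset F1 M1) (lset F2 M2) = enat k"
    "res F1 F2 \<noteq> 0" "fls_subdegree (res F1 F2) = 2 * (M1 + M2 - int k)"
proof -
  obtain B C where BC: "B \<in> lset F1 M1" "C \<in> lset F2 M2" "0 < tree_dist B C"
    and min: "\<And>B' C'. B' \<in> lset F1 M1 \<Longrightarrow> C' \<in> lset F2 M2 \<Longrightarrow> tree_dist B C \<le> tree_dist B' C'"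
    and v: "vge (2 * (M1 + M2 - int (tree_dist B C))) (res F1 F2)"
      "\<not> vge (2 * (M1 + M2 - int (tree_dist B C)) + 1) (res F1 F2)"
    using disjoint_lsets[OF assms] by metis
  have "subgraph_dist (lset F1 M1) (lset F2 M2) = enat (tree_dist B C)"
    unfolding subgraph_dist_def
  proof (rule antisym)
    show "(INF B\<in>lset F1 M1. INF C\<in>lset F2 M2. enat (tree_dist B C)) \<le> enat (tree_dist B C)"
      by (rule INF_lower2[OF BC(1)], rule INF_lower2[OF BC(2)], rule order_refl)
    show "enat (tree_dist B C) \<le> (INF B\<in>lset F1 M1. INF C\<in>lset F2 M2. enat (tree_dist B C))"
      using min by (intro INF_greatest) simp
  qed
  then show ?thesis using that[of "tree_dist B C"] BC(3) fls_subdegree_eqI_vge[OF v] by blast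
qed

lemma overlap_commute: "overlap (res F1 F2) (M1 + M2) = overlap (res F2 (F1 :: 'k form)) (M2 + M1)"
  by (simp add: res_commute[of F1 F2] add.commute)

text \<open>If the first stem is an edge and the second a vertex, the roles are exchanged, as
  \<open>edge_meet\<close> needs the other length to be at least 1.\<close>

lemma meet_point_or_edge:
  assumes st: "stem_type q2 m2 M2"
    and small: "point_form (form_of q1) M1 \<and> stem_length q1 = Fin_length 0 \<or> edge_form (form_of q1) M1 \<and> stem_length q1 = Fin_length 1"
    and ne: "lset (form_of q1) M1 \<inter> lset (form_of q2) M2 \<noteq> {}"
  shows "is_line (lset (form_of q1) M1 \<inter> lset (form_of q2) M2)
    (min (overlap (res (form_of q1) (form_of q2)) (M1 + M2)) (min (stem_length q1) (stem_length q2)))"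
  using small
proof
  assume h: "point_form (form_of q1) M1 \<and> stem_length q1 = Fin_length 0"
  then show ?thesis using point_meet[OF _ ne] by (simp add: min_Fin_0)
next
  assume h: "edge_form (form_of q1) M1 \<and> stem_length q1 = Fin_length 1"
  show ?thesis
  proof (cases "Fin_length 1 \<le> stem_length q2")
    case True
    then show ?thesis using edge_meet[OF _ ne] h by simp
  next
    case False
    then have "point_form (form_of q2) M2" "stem_length q2 = Fin_length 0"
      using st by (auto simp: stem_type_def)
    then show ?thesis using point_meet[of "form_of q2" M2 "form_of q1" M1] ne by (simp add: min_Fin_0 Int_commute)
  qed
qed

end

theorem theorem2p2:
  fixes a1 b1 a2 b2 lam :: "'k::{field,finite} fls"
    and q1 q2 :: "'k fls ^ 2 ^ 2"
    and \<tau> :: nat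
    and d :: ereal
  assumes card_k: "CARD('k) = 2 ^ \<tau>"
    and integral: "a1 \<in> integers" "b1 \<in> integers" "a2 \<in> integers" "b2 \<in> integers"
    and nonscalar: "\<And>c. q1 \<noteq> mat c" "\<And>c. q2 \<noteq> mat c"
    and root1: "q1 ** q1 + mat a1 ** q1 + mat b1 = 0"
    and root2: "q2 ** q2 + mat a2 ** q2 + mat b2 = 0"
    and lam: "q1 ** mat_bar q2 + q2 ** mat_bar q1 = mat lam"
    and d: "d = fake_distance a1 b1 a2 b2 lam"
  shows "(d > 0 \<longrightarrow> d = ereal_of_enat (subgraph_dist (stem q1) (stem q2))) \<and>
    (d \<le> 0 \<longrightarrow>
       stem q1 \<inter> stem q2 \<noteq> {} \<and>
       (if quad a1 b1 \<in> insep_class_A \<and> quad a2 b2 \<in> insep_class_A then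
          (lam \<noteq> 0 \<longrightarrow>
             (\<exists>p n. is_line p (Fin_length (if even (fls_subdegree lam) then 0 else 1)) \<and>
                    int n = \<lfloor>of_int (fls_subdegree lam) / (2::real)\<rfloor> \<and>
                    stem q1 \<inter> stem q2 = thicken p n)) \<and>
          (lam = 0 \<longrightarrow> stem q1 \<subseteq> stem q2 \<or> stem q2 \<subseteq> stem q1)
        else if quad a1 b1 \<in> reducible_sep \<and> quad a2 b2 \<in> reducible_sep \<and> d = - \<infinity> then
          (q1 ** q2 = q2 ** q1 \<longrightarrow> is_line (stem q1 \<inter> stem q2) Two_Inf_length) \<and>
          (q1 ** q2 \<noteq> q2 ** q1 \<longrightarrow> is_line (stem q1 \<inter> stem q2) Inf_length)
        else
          is_line (stem q1 \<inter> stem q2)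
            (min (length_of_ereal (- 2 * d)) (min (stem_length q1) (stem_length q2)))))"
proof -
  have "of_nat CARD('k) = (0 :: 'k)" by (rule of_nat_CARD)
  then have "(2 :: 'k) ^ \<tau> = 0" using card_k by simp
  then have "(2 :: 'k) = 0" by simp
  then interpret finite_char2 "TYPE('k)" by unfold_locales simp
  define F1 F2 where F12: "F1 = form_of q1" "F2 = form_of q2"
  obtain M1 where M1: "M1 = fls_subdegree (e_coeff a1) + c_coeff a1 b1" "stem q1 = lset F1 M1"
    "lset F1 M1 \<noteq> {}" "vge M1 (mid F1)" "stem_type q1 (quad a1 b1) M1"
    unfolding F12 using stem_classification[OF nonscalar(1) root1 integral(1,2)] by metis
  obtain M2 where M2: "M2 = fls_subdegree (e_coeff a2) + c_coeff a2 b2" "stem q2 = lset F2 M2"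
    "lset F2 M2 \<noteq> {}" "vge M2 (mid F2)" "stem_type q2 (quad a2 b2) M2"
    unfolding F12 using stem_classification[OF nonscalar(2) root2 integral(3,4)] by metis
  define R where "R = res F1 F2"
  have RD: "R = Delta a1 b1 a2 b2 lam"
    using Delta_eq_res[OF lam] trace_det(1,2)[OF nonscalar(1) root1] trace_det(1,2)[OF nonscalar(2) root2]
    by (simp add: R_def F12)
  have d_eq: "d = (if R = 0 then - \<infinity> else ereal (of_int (M1 + M2) - of_int (fls_subdegree R) / 2))"
    unfolding d by (rule fake_distance_eq[OF M1(1) M2(1) RD])
  show ?thesis
  \<comment> \<open>The split is by whether the stems meet and not by the sign of d: disjoint stems
    give d > 0 and meeting ones d \<le> 0, so each implication concerns one case.\<close>
  proof (cases "stem q1 \<inter> stem q2 = {}")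
    case True
    then obtain k :: nat where k: "k > 0" "subgraph_dist (stem q1) (stem q2) = enat k"
      "R \<noteq> 0" "fls_subdegree R = 2 * (M1 + M2 - int k)"
      using subgraph_dist_disjoint[OF M1(3) M2(3)] unfolding M1(2) M2(2) R_def by metis
    have "d = ereal (real k)" using k(3,4) d_eq by simp
    then show ?thesis using k(1,2) by simp
  next
    case ne: False
    then have ne': "lset F1 M1 \<inter> lset F2 M2 \<noteq> {}" by (simp add: M1(2) M2(2))
    then obtain B where "B \<in> lset F1 M1" "B \<in> lset F2 M2" by blast
    then have vR: "vge (2 * (M1 + M2)) R" unfolding R_def by (rule res_vge)
    have d0: "\<not> 0 < d"
    proof (cases "R = 0")
      case False
      then have "2 * (M1 + M2) \<le> fls_subdegree R" using vR by (simp add: vge_def)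
      then have "2 * real_of_int (M1 + M2) \<le> real_of_int (fls_subdegree R)" by linarith
      then show ?thesis using False d_eq by simp
    qed (use d_eq in simp)
    have dinf: "d = - \<infinity> \<longleftrightarrow> R = 0" using d_eq by simp
    have len: "length_of_ereal (- 2 * d) = overlap R (M1 + M2)"
    proof (cases "R = 0")
      case True
      then show ?thesis using d_eq by (simp add: length_of_ereal_def overlap_def)
    next
      case False
      have "- 2 * d = ereal (real_of_int (fls_subdegree R - 2 * (M1 + M2)))"
        using False d_eq by (simp add: one_ereal_def numeral_eq_ereal algebra_simps)
      then show ?thesis using False by (simp add: length_of_ereal_def overlap_def del: of_int_diff of_int_mult of_int_add)
    qed
    define J where "J = lset F1 M1 \<inter> lset F2 M2"
    have J: "stem q1 \<inter> stem q2 = J" by (simp add: J_def M1(2) M2(2))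
    have nJ: "J \<noteq> {}" using ne J by simp
    define small where "small q M \<longleftrightarrow> point_form (form_of q) M \<and> stem_length q = Fin_length 0 \<or>
        edge_form (form_of q) M \<and> stem_length q = Fin_length 1" for q :: "'k fls ^ 2 ^ 2" and M :: int
    define hor where "hor q m M \<longleftrightarrow> horo (form_of q) \<and> M = 0 \<and> stem_length q = Inf_length \<and>
        m \<in> insep_class_A \<and> m \<notin> reducible_sep" for q :: "'k fls ^ 2 ^ 2" and m :: "'k fls poly" and M :: int
    define spl where "spl q m M \<longleftrightarrow> split_form (form_of q) M \<and> stem_length q = Two_Inf_length \<and>
        m \<notin> insep_class_A \<and> m \<in> reducible_sep" for q :: "'k fls ^ 2 ^ 2" and m :: "'k fls poly" and M :: int
    have cases: "small q M \<and> m \<notin> insep_class_A \<and> m \<notin> reducible_sep \<or> hor q m M \<or> spl q m M"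
      if "stem_type q m M" for q m M
      using that unfolding stem_type_def small_def hor_def spl_def by blast
    have rest: ?thesis
      if "\<not> (quad a1 b1 \<in> insep_class_A \<and> quad a2 b2 \<in> insep_class_A)"
        "\<not> (quad a1 b1 \<in> reducible_sep \<and> quad a2 b2 \<in> reducible_sep \<and> R = 0)"
        "is_line J (min (overlap R (M1 + M2)) (min (stem_length q1) (stem_length q2)))"
      unfolding J len dinf if_not_P[OF that(1)] if_not_P[OF that(2)] using that(3) nJ d0 by blast
    \<comment> \<open>A horoball form has middle coefficient 0, so it is not proportional to a form
      with two distinct zeros, and a vanishing resultant leaves a ray. This agrees with the general
      formula, the lengths of the stems being \<infinity> and 2\<infinity>.\<close>
    have sh: "is_line J (min (overlap R (M1 + M2)) Inf_length)"
      if s: "split_form F M" and h: "horo F'" and R': "R = res F F'" and J': "J = lset F M \<inter> lset F' M'"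
        and M': "M1 + M2 = M + M'" and v: "vge M' (mid F')" for F F' :: "'k form" and M M'
    proof -
      have "mid F \<noteq> 0" using s by (simp add: split_form_def)
      then have np: "\<not> proportional F F'"
        using h by (cases F) (auto simp: horo_def)
      have "if R = 0 then is_line J Inf_length else is_line J (overlap R (M1 + M2))"
        using split_meet[OF s _ v] np nJ unfolding R' J' M' by (simp split: if_splits)
      moreover have "overlap R (M1 + M2) \<le> Inf_length" if "R \<noteq> 0" using that by (simp add: overlap_def)
      moreover have "overlap R (M1 + M2) = Two_Inf_length" if "R = 0" using that by (simp add: overlap_def)
      ultimately show ?thesis by (cases "R = 0") (simp_all add: min_Two min_absorb1)
    qed
    consider (small1) "small q1 M1" "quad a1 b1 \<notin> insep_class_A" "quad a1 b1 \<notin> reducible_sep"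
      | (small2) "small q2 M2" "quad a2 b2 \<notin> insep_class_A" "quad a2 b2 \<notin> reducible_sep"
      | (hh) "hor q1 (quad a1 b1) M1" "hor q2 (quad a2 b2) M2"
      | (hs) "hor q1 (quad a1 b1) M1" "spl q2 (quad a2 b2) M2"
      | (sh) "spl q1 (quad a1 b1) M1" "hor q2 (quad a2 b2) M2"
      | (ss) "spl q1 (quad a1 b1) M1" "spl q2 (quad a2 b2) M2"
      using cases[OF M1(5)] cases[OF M2(5)] by blast
    then show ?thesis
    proof cases
      case small1
      have "is_line J (min (overlap R (M1 + M2)) (min (stem_length q1) (stem_length q2)))"
        unfolding J_def R_def F12
        by (rule meet_point_or_edge[OF M2(5)]) (use small1(1) ne' in \<open>simp_all add: small_def F12\<close>)
      then show ?thesis using small1 by (intro rest) auto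
    next
      case small2
      have "is_line (lset F2 M2 \<inter> lset F1 M1) (min (overlap (res F2 F1) (M2 + M1)) (min (stem_length q2) (stem_length q1)))"
        unfolding F12
        by (rule meet_point_or_edge[OF M1(5)]) (use small2(1) ne' in \<open>simp_all add: small_def F12 Int_commute\<close>)
      then have "is_line J (min (overlap R (M1 + M2)) (min (stem_length q1) (stem_length q2)))"
        by (simp only: J_def R_def Int_commute overlap_commute[of F1 F2] min.commute)
      then show ?thesis using small2 by (intro rest) auto
    next
      case hh
      have h: "horo F1" "horo F2" and M: "M1 = 0" "M2 = 0" using hh by (auto simp: hor_def F12)
      have A: "quad a1 b1 \<in> insep_class_A" "quad a2 b2 \<in> insep_class_A" using hh by (auto simp: hor_def)
      \<comment> \<open>Both traces vanish, so only the term lam^2 of \<open>Delta\<close>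
        survives.\<close>
      have Rl: "res F1 F2 = lam\<^sup>2" using RD A unfolding R_def quad_class_iff Delta_def by simp
      have 1: "\<exists>p n. is_line p (Fin_length (if even (fls_subdegree lam) then 0 else 1)) \<and>
           int n = \<lfloor>of_int (fls_subdegree lam) / (2::real)\<rfloor> \<and> J = thicken p n" if l: "lam \<noteq> 0"
      proof -
        obtain p n where pn: "is_line p (Fin_length (if even (fls_subdegree lam) then 0 else 1))"
          "int n = fls_subdegree lam div 2" "lset F1 0 \<inter> lset F2 0 = thicken p n"
          using horo_pair[OF h Rl l] ne' unfolding M by metis
        moreover have "\<lfloor>of_int (fls_subdegree lam) / (2::real)\<rfloor> = fls_subdegree lam div 2"
          using floor_divide_of_int_eq[of "fls_subdegree lam" 2] by simp
        ultimately show ?thesis unfolding J_def M by metis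
      qed
      have 2: "stem q1 \<subseteq> stem q2 \<or> stem q2 \<subseteq> stem q1" if "lam = 0"
        using horo_nested[OF h] Rl that unfolding M1(2) M2(2) M by simp
      show ?thesis unfolding J if_P[OF conjI[OF A]] using 1 2 nJ d0 by blast
    next
      case hs
      have "is_line J (min (overlap R (M1 + M2)) Inf_length)"
      proof (rule sh)
        show "split_form F2 M2" "horo F1" using hs by (auto simp: spl_def hor_def F12)
        show "vge M1 (mid F1)" by (rule M1)
      qed (auto simp: R_def J_def res_commute[of F1 F2])
      then show ?thesis using hs by (intro rest) (auto simp: hor_def spl_def min_Two)
    next
      case sh: sh
      have "is_line J (min (overlap R (M1 + M2)) Inf_length)"
      proof (rule \<open>\<And>F M F' M'. split_form F M \<Longrightarrow> horo F' \<Longrightarrow> R = res F F' \<Longrightarrow> J = lset F M \<inter> lset F' M' \<Longrightarrow>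
          M1 + M2 = M + M' \<Longrightarrow> vge M' (mid F') \<Longrightarrow> is_line J (min (overlap R (M1 + M2)) Inf_length)\<close>)
        show "split_form F1 M1" "horo F2" using sh by (auto simp: spl_def hor_def F12)
        show "vge M2 (mid F2)" by (rule M2)
      qed (auto simp: R_def J_def)
      then show ?thesis using sh by (intro rest) (auto simp: hor_def spl_def min_Two)
    next
      case ss
      have sp: "split_form F1 M1" and l: "stem_length q1 = Two_Inf_length" "stem_length q2 = Two_Inf_length"
        and cls: "quad a1 b1 \<notin> insep_class_A" "quad a1 b1 \<in> reducible_sep" "quad a2 b2 \<in> reducible_sep"
        using ss by (auto simp: spl_def F12)
      have com: "q1 ** q2 = q2 ** q1 \<longleftrightarrow> proportional F1 F2" unfolding F12 by (rule commute_iff_proportional)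
      note m = split_meet[OF sp ne' M2(4), folded R_def J_def]
      show ?thesis
      proof (cases "R = 0")
        case True
        have c1: "\<not> (quad a1 b1 \<in> insep_class_A \<and> quad a2 b2 \<in> insep_class_A)"
          and c2: "quad a1 b1 \<in> reducible_sep \<and> quad a2 b2 \<in> reducible_sep \<and> R = 0"
          using cls True by auto
        have "is_line J (if proportional F1 F2 then Two_Inf_length else Inf_length)"
          using m True by simp
        then have "(proportional F1 F2 \<longrightarrow> is_line J Two_Inf_length) \<and>
            (\<not> proportional F1 F2 \<longrightarrow> is_line J Inf_length)"
          by (simp split: if_splits)
        then show ?thesis unfolding J com dinf if_not_P[OF c1] if_P[OF c2] using nJ d0 by blast
      next
        case False
        then show ?thesis using m cls l by (intro rest) (auto simp: min_Two)
      qed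
    qed
  qed
qed

end
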